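(* There exists a positive integer $N$ such that for every integer $n\ge N$ and every integer $k$ with $0\le k\le n-2$, the $k$-point-fixing graph $\mathcal{F}(n,k)$ has the Aldous property if and only if $2\le k\le n-2$.
   Context: $S_n$ is the symmetric group on $[n]=\{1,2,\ldots,n\}$, $n\ge 3$. For a finite group $G$ with identity $e$ and an inverse-closed subset $S\subseteq G\setminus\{e\}$, the Cayley graph $\mathrm{Cay}(G,S)$ is the simple undirected $|S|$-regular graph with vertex set $G$ and edge set $\{\{g,gs\} : g\in G, s\in S\}$. The eigenvalues of a graph are those of its adjacency matrix, listed with multiplicity in non-ascending order $\lambda_1\ge\lambda_2\ge\cdots$; similarly $\lambda_1(M)$ denotes the largest eigenvalue of a matrix $M$ with real eigenvalues. For $0\le k\le n-2$, the $k$-point-fixing graph $\mathcal{F}(n,k)$ is the Cayley graph $\mathrm{Cay}(S_n,S)$ where $S$ is the set of all permutations in $S_n$ fixing exactly $k$ points of $[n]$. The standard representation $\rho_{(n-1,1)}$ of $S_n$ is the irreducible complex representation (Specht module) corresponding to the partition $(n-1,1)$ of $n$; it has dimension $n-1$ and character $\chi_{(n-1,1)}(\sigma)=(\text{number of fixed points of }\sigma)-1$. For $S\subseteq S_n$ put $\rho_{(n-1,1)}(S)=\sum_{s\in S}\rho_{(n-1,1)}(s)$. Aldous property: $\mathrm{Cay}(S_n,S)$ has the Aldous property if its strictly second largest eigenvalue (the largest eigenvalue strictly smaller than the degree $|S|$) is attained by the standard representation, that is, $\lambda_{t+1}(\mathrm{Cay}(S_n,S))=\lambda_1(\rho_{(n-1,1)}(S))$,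 where $t=[S_n:\langle S\rangle]$ is the index in $S_n$ of the subgroup generated by $S$. (When $S$ is closed under conjugation, $\rho_{(n-1,1)}(S)$ is a scalar matrix and $\lambda_1(\rho_{(n-1,1)}(S))=\sum_{\sigma\in S}\chi_{(n-1,1)}(\sigma)/(n-1)$.) *)

theory Defs
  imports
    "HOL-Algebra.Sym_Groups"
    "HOL-Algebra.Generated_Groups"
    "HOL-Library.Countable_Set"
    "HOL-Computational_Algebra.Polynomial"
    "Jordan_Normal_Form.Char_Poly"
begin

section \<open>Eigenvalues in non-ascending order\<close>

text \<open>
  The roots of the characteristic polynomial, with multiplicity. Used only for matrices all of whose
  complex eigenvalues are real, so that \<^const>\<open>Re\<close> loses no information.
\<close>

definition eigenvalue_list :: "complex mat \<Rightarrow> real list" where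
  "eigenvalue_list M = rev (sorted_list_of_multiset (image_mset Re (proots (char_poly M))))"

text \<open>Eigenvalues are numbered from 1, lists from 0.\<close>

definition lambda :: "nat \<Rightarrow> complex mat \<Rightarrow> real" where
  "lambda i M = eigenvalue_list M ! (i - 1)"


section \<open>Cayley graphs\<close>

text \<open>A simple undirected graph is given by its vertices and its edges, which are two-element sets.\<close>

type_synonym 'a graph = "'a set \<times> 'a set set"

definition cayley_graph :: "('a, 'b) monoid_scheme \<Rightarrow> 'a set \<Rightarrow> 'a graph" where
  "cayley_graph G S = (carrier G, {{g, g \<otimes>\<^bsub>G\<^esub> s} | g s. g \<in> carrier G \<and> s \<in> S})"

text \<open>
  The rows and columns follow the enumeration \<^const>\<open>from_nat_into\<close> of the (finite) vertex set. A
  different enumeration conjugates the matrix by a permutation matrix, which leaves its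
  characteristic polynomial unchanged.
\<close>

definition adjacency_matrix :: "'a graph \<Rightarrow> complex mat" where
  "adjacency_matrix \<Gamma> = (let V = fst \<Gamma>; E = snd \<Gamma>; v = from_nat_into V in
     mat (card V) (card V) (\<lambda>(i, j). if {v i, v j} \<in> E then 1 else 0))"

definition graph_lambda :: "nat \<Rightarrow> 'a graph \<Rightarrow> real" where
  "graph_lambda i \<Gamma> = lambda i (adjacency_matrix \<Gamma>)"


section \<open>The standard representation of the symmetric group\<close>

text \<open>
  A tabloid of shape $(n-1,1)$ is determined by the single entry of its second row, so the
  permutation module on these tabloids has a basis $e_1, \dots, e_n$ with $\sigma e_i =
  e_{\sigma(i)}$. The Specht module is the submodule spanned by the polytabloids $e_i - e_j$, and
  the polytabloids of the standard tableaux, $e_i - e_1$ for $2 \le i \le n$, are a basis of it.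
  The matrix below is the action of $\sigma$ in this basis; its row and column indices
  $0, \dots, n-2$ stand for $2, \dots, n$.
\<close>

definition std_rep :: "nat \<Rightarrow> (nat \<Rightarrow> nat) \<Rightarrow> complex mat" where
  "std_rep n \<sigma> = mat (n - 1) (n - 1)
     (\<lambda>(i, j). of_bool (\<sigma> (j + 2) = i + 2) - of_bool (\<sigma> 1 = i + 2))"

definition std_rep_sum :: "nat \<Rightarrow> (nat \<Rightarrow> nat) set \<Rightarrow> complex mat" where
  "std_rep_sum n S = mat (n - 1) (n - 1) (\<lambda>ij. \<Sum>\<sigma>\<in>S. std_rep n \<sigma> $$ ij)"

definition fixed_points :: "nat \<Rightarrow> (nat \<Rightarrow> nat) \<Rightarrow> nat set" where
  "fixed_points n \<sigma> = {i \<in> {1..n}. \<sigma> i = i}"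

lemma std_rep_select:
  fixes f :: "nat \<Rightarrow> complex"
  assumes "a \<in> {1..n}"
  shows "(\<Sum>k<n - 1. (f (k + 2) - f 1) * of_bool (a = k + 2)) = f a - f 1"
proof (cases "a = 1")
  case True
  then show ?thesis by simp
next
  case False
  then have "a - 2 < n - 1" "a = (a - 2) + 2" using assms by auto
  then obtain b where b: "b < n - 1" "a = b + 2" by blast
  have "(\<Sum>k<n - 1. (f (k + 2) - f 1) * of_bool (a = k + 2))
      = (\<Sum>k<n - 1. if k = b then f (k + 2) - f 1 else 0)"
    by (rule sum.cong) (auto simp: b)
  then show ?thesis using b by simp
qed

lemma std_rep_action:
  assumes "\<sigma> permutes {1..n}" "j < n - 1"
  defines "e \<equiv> \<lambda>i x::nat. of_bool (x = i) :: complex"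
  shows "e (\<sigma> (j + 2)) x - e (\<sigma> 1) x
       = (\<Sum>i<n - 1. std_rep n \<sigma> $$ (i, j) * (e (i + 2) x - e 1 x))"
proof -
  have in_range: "\<sigma> (j + 2) \<in> {1..n}" "\<sigma> 1 \<in> {1..n}"
    using assms(2) permutes_in_image[OF assms(1)] by auto
  have "(\<Sum>i<n - 1. std_rep n \<sigma> $$ (i, j) * (e (i + 2) x - e 1 x))
      = (\<Sum>i<n - 1. (e (i + 2) x - e 1 x) * of_bool (\<sigma> (j + 2) = i + 2))
        - (\<Sum>i<n - 1. (e (i + 2) x - e 1 x) * of_bool (\<sigma> 1 = i + 2))"
    unfolding sum_subtractf[symmetric] using assms(2)
    by (intro sum.cong) (auto simp: std_rep_def algebra_simps)
  also have "\<dots> = (e (\<sigma> (j + 2)) x - e 1 x) - (e (\<sigma> 1) x - e 1 x)"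
    using std_rep_select[OF in_range(1), of "\<lambda>i. e i x"]
      std_rep_select[OF in_range(2), of "\<lambda>i. e i x"] by simp
  finally show ?thesis by simp
qed

lemma std_rep_one: "std_rep n id = 1\<^sub>m (n - 1)"
  by (rule eq_matI) (auto simp: std_rep_def)

lemma std_rep_mult:
  assumes "\<sigma> permutes {1..n}" "\<tau> permutes {1..n}"
  shows "std_rep n (\<sigma> \<circ> \<tau>) = std_rep n \<sigma> * std_rep n \<tau>"
proof (rule eq_matI)
  fix i j
  assume "i < dim_row (std_rep n \<sigma> * std_rep n \<tau>)" "j < dim_col (std_rep n \<sigma> * std_rep n \<tau>)"
  then have ij: "i < n - 1" "j < n - 1" by (auto simp: std_rep_def)
  have in_range: "\<tau> (j + 2) \<in> {1..n}" "\<tau> 1 \<in> {1..n}"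
    using ij permutes_in_image[OF assms(2)] by auto
  let ?f = "\<lambda>a::nat. of_bool (\<sigma> a = i + 2) :: complex"
  have "(std_rep n \<sigma> * std_rep n \<tau>) $$ (i, j)
      = (\<Sum>k<n - 1. (?f (k + 2) - ?f 1) * of_bool (\<tau> (j + 2) = k + 2))
        - (\<Sum>k<n - 1. (?f (k + 2) - ?f 1) * of_bool (\<tau> 1 = k + 2))"
    unfolding sum_subtractf[symmetric] using ij
    by (auto simp: std_rep_def scalar_prod_def atLeast0LessThan right_diff_distrib
        intro!: sum.cong)
  also have "\<dots> = (?f (\<tau> (j + 2)) - ?f 1) - (?f (\<tau> 1) - ?f 1)"
    using std_rep_select[OF in_range(1), of ?f] std_rep_select[OF in_range(2), of ?f] by simp
  also have "\<dots> = std_rep n (\<sigma> \<circ> \<tau>) $$ (i, j)"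
    using ij by (simp add: std_rep_def)
  finally show "std_rep n (\<sigma> \<circ> \<tau>) $$ (i, j) = (std_rep n \<sigma> * std_rep n \<tau>) $$ (i, j)" ..
qed (auto simp: std_rep_def)

lemma std_rep_character:
  assumes "\<sigma> permutes {1..n}" "n \<ge> 1"
  shows "(\<Sum>i<n - 1. std_rep n \<sigma> $$ (i, i)) = of_nat (card (fixed_points n \<sigma>)) - 1"
proof -
  have in_range: "\<sigma> 1 \<in> {1..n}"
    using assms(2) permutes_in_image[OF assms(1)] by auto
  let ?f = "\<lambda>a::nat. of_bool (a \<noteq> 1) :: complex"
  have "(\<Sum>i<n - 1. std_rep n \<sigma> $$ (i, i))
      = (\<Sum>i<n - 1. of_bool (\<sigma> (i + 2) = i + 2))
        - (\<Sum>i<n - 1. (?f (i + 2) - ?f 1) * of_bool (\<sigma> 1 = i + 2))"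
    unfolding sum_subtractf[symmetric] by (intro sum.cong) (auto simp: std_rep_def)
  also have "\<dots> = (\<Sum>i<n - 1. of_bool (\<sigma> (i + 2) = i + 2)) + of_bool (\<sigma> 1 = 1) - 1"
    using std_rep_select[OF in_range, of ?f] by simp
  also have "(\<Sum>i<n - 1. of_bool (\<sigma> (i + 2) = i + 2))
      = (\<Sum>a\<in>{2..n}. of_bool (\<sigma> a = a) :: complex)"
    by (rule sum.reindex_bij_witness[of _ "\<lambda>a. a - 2" "\<lambda>i. i + 2"]) auto
  also have "(\<Sum>a\<in>{2..n}. of_bool (\<sigma> a = a) :: complex) + of_bool (\<sigma> 1 = 1)
      = (\<Sum>a\<in>{1..n}. of_bool (\<sigma> a = a))"
    unfolding sum.atLeast_Suc_atMost[OF assms(2)]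
    by (simp only: numeral_2_eq_2 One_nat_def add.commute)
  also have "\<dots> = of_nat (card (fixed_points n \<sigma>))"
    by (simp add: fixed_points_def Int_def of_bool_def sum.If_cases)
  finally show ?thesis .
qed


section \<open>The Aldous property and the point-fixing graphs\<close>

text \<open>
  The Aldous property of the Cayley graph of $S_n$ with connection set $S$. The rank $t + 1$ picks
  out the largest eigenvalue below the degree $|S|$, since the degree has multiplicity $t$, the
  number of connected components.
\<close>

definition aldous_property :: "nat \<Rightarrow> (nat \<Rightarrow> nat) set \<Rightarrow> bool" where
  "aldous_property n S \<longleftrightarrow>
     (let t = card (rcosets\<^bsub>sym_group n\<^esub> (generate (sym_group n) S))
      in graph_lambda (t + 1) (cayley_graph (sym_group n) S) = lambda 1 (std_rep_sum n S))"

text \<open>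
  The graph $\mathcal{F}(n,k)$ is the Cayley graph of the symmetric group with this connection set.
\<close>

definition point_fixing_set :: "nat \<Rightarrow> nat \<Rightarrow> (nat \<Rightarrow> nat) set" where
  "point_fixing_set n k = {\<sigma> \<in> carrier (sym_group n). card (fixed_points n \<sigma>) = k}"

end

theory Submission
  imports
    Defs
    "HOL-Analysis.Inner_Product"
    "Jordan_Normal_Form.Jordan_Normal_Form_Uniqueness"
    "Jordan_Normal_Form.Jordan_Normal_Form_Existence"
begin

text \<open>
  Write \<open>[n] = {1..n}\<close>. For a weight \<open>w\<close> on the natural numbers and a set \<open>I\<close> of points, let \<open>T_I^w\<close> be the operator
  \<open>f \<mapsto> (\<sigma> \<mapsto> (1 / |I|!) \<Sum>\<^sub>s w(fix s) f(\<sigma> s))\<close> on functions of permutations of \<open>[n]\<close>, where \<open>s\<close> runs over the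
  permutations of \<open>I\<close> and \<open>fix s\<close> counts the fixed points of \<open>s\<close> in \<open>I\<close>. For \<open>I = [n]\<close> and the indicator weight \<open>[x = k]\<close> it
  is the adjacency operator of \<open>F(n,k)\<close> divided by \<open>n!\<close>. The proof rests on one
  recursion for these operators.

  A permutation with \<open>x > 0\<close> fixed points lies in exactly \<open>x\<close> of the point stabilisers. Hence
  \<open>T_I^w = w(0) P_I + (1 / |I|) \<Sum>\<^sub>i T_(I - i)^w'\<close> with \<open>w'(x) = (w(x + 1) - w(0)) / (x + 1)\<close> and \<open>P_I\<close> the average over all
  permutations of \<open>I\<close> (\<open>weighted_avg_one_at_zero\<close>). A function \<open>f\<close> with \<open>P_I f = 0\<close> is an orthogonal sum \<open>u + r\<close>: the
  part \<open>u\<close> is a sum of functions invariant under stabilisers of single points of \<open>I\<close>, and there \<open>T_I^w\<close> is multiplication by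
  \<open>E[w(X) (X - 1)] / (|I| - 1)\<close>, \<open>X\<close> being the number of fixed points of a random permutation of \<open>I\<close> (this is the component of the
  standard representation, \<open>weighted_avg_point_invariant\<close>); the rest \<open>r\<close> is killed by every \<open>P_(I - i)\<close>, so by the recursion
  \<open>T_I^w\<close> acts on it as an average of operators \<open>T_(I - i)^w'\<close> to which an induction hypothesis applies. Therefore an upper
  bound for the quadratic form of \<open>T_I^w\<close> on \<open>P_I f = 0\<close> follows from the standard eigenvalue and the same bound one level
  down (\<open>spectral_bound_step\<close>).

  Let \<open>m = n - k\<close>. For \<open>w = [x = k]\<close> the weight \<open>w'\<close> is a multiple of \<open>[x = k - 1]\<close>, and the standard eigenvalue divided by the
  degree, \<open>(k - 1) / (m + k - 1)\<close>, increases with \<open>k\<close>. So everything reduces to derangements of \<open>m\<close> points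
  (\<open>spectral_bound_fixing\<close>). From \<open>[x = 0]\<close> the recursion leads to multiples of the weights \<open>1 / (x + d)\<close>, a family
  that it preserves, and every nontrivial eigenvalue turns out to be at most \<open>10 / (11 (m - 3))\<close> times the degree
  (\<open>spectral_bound_derangements\<close>). For \<open>n \<ge> 100\<close>, \<open>k \<ge> 2\<close> and \<open>m \<ge> 4\<close> this is below \<open>(k - 1) / (n - 1)\<close>. The case \<open>m = 2\<close> needs
  only the standard eigenvalue. For \<open>m = 3\<close> the connection set consists of even permutations and the sign is a second
  eigenfunction for the degree; the recursion is then run on functions orthogonal to both characters.

  The resulting gap says that the eigenfunctions for the degree are spanned by one or two characters. This gives both the
  multiplicity of the degree and, applied to the indicator function of the subgroup generated by the connection set, its
  index; so the eigenvalue in the definition of the Aldous property is the largest one below the degree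
  (locale \<open>point_fixing_gap\<close>).

  For \<open>k \<le> 1\<close> the standard eigenvalue is at most \<open>0\<close>. If no other eigenvalue below the degree \<open>D\<close> were positive, then, since the eigenvalues
  sum to \<open>0\<close> and their squares sum to \<open>n! D\<close>, one would get \<open>n! D \<le> 2 D\<^sup>2\<close>, but at most \<open>3/8\<close> of all permutations
  have exactly \<open>k\<close> fixed points (\<open>lambda_two_pos\<close>).
\<close>

section \<open>Weighted averages over permutations\<close>

definition num_fixed :: "'i set \<Rightarrow> ('i \<Rightarrow> 'i) \<Rightarrow> nat" where
  "num_fixed I s = card {i \<in> I. s i = i}"

definition weighted_avg ::
  "'i set \<Rightarrow> (nat \<Rightarrow> real) \<Rightarrow> (('i \<Rightarrow> 'i) \<Rightarrow> 'a::real_vector) \<Rightarrow> ('i \<Rightarrow> 'i) \<Rightarrow> 'a" where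
  "weighted_avg I w f \<sigma> =
     (\<Sum>s | s permutes I. w (num_fixed I s) *\<^sub>R f (\<sigma> \<circ> s)) /\<^sub>R fact (card I)"

abbreviation avg :: "'i set \<Rightarrow> (('i \<Rightarrow> 'i) \<Rightarrow> 'a::real_vector) \<Rightarrow> ('i \<Rightarrow> 'i) \<Rightarrow> 'a" where
  "avg I \<equiv> weighted_avg I (\<lambda>_. 1)"

text \<open>
  The operator applied to the constant function, that is, the expectation of \<open>w(X)\<close> for the number \<open>X\<close> of fixed points of
  a uniformly random permutation of \<open>I\<close>. All identities for the operators thus specialise to expectations.
\<close>

definition expect :: "'i set \<Rightarrow> (nat \<Rightarrow> real) \<Rightarrow> real" where
  "expect I w = weighted_avg I w (\<lambda>_. 1) id"

text \<open>
  The weight that appears one level down when one fixed point is split off.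
\<close>

definition diff_quot :: "(nat \<Rightarrow> real) \<Rightarrow> nat \<Rightarrow> real" where
  "diff_quot w x = (w (Suc x) - w 0) / real (Suc x)"

lemma expect_eq: "expect I w = (\<Sum>s | s permutes I. w (num_fixed I s)) / fact (card I)"
  by (simp add: expect_def weighted_avg_def divide_inverse mult.commute)

lemma weighted_avg_scale_weight:
  "weighted_avg I (\<lambda>x. c * w x) f \<sigma> = c *\<^sub>R weighted_avg I w f \<sigma>"
  by (simp add: weighted_avg_def scaleR_sum_right mult.left_commute mult.assoc)

lemma weighted_avg_add:
  "weighted_avg I w (\<lambda>\<sigma>. f \<sigma> + g \<sigma>) \<sigma> = weighted_avg I w f \<sigma> + weighted_avg I w g \<sigma>"
  by (simp add: weighted_avg_def scaleR_add_right sum.distrib)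

lemma weighted_avg_diff:
  "weighted_avg I w (\<lambda>\<sigma>. f \<sigma> - g \<sigma>) \<sigma> = weighted_avg I w f \<sigma> - weighted_avg I w g \<sigma>"
  by (simp add: weighted_avg_def scaleR_diff_right sum_subtractf)

lemma weighted_avg_scale:
  "weighted_avg I w (\<lambda>\<sigma>. c *\<^sub>R f \<sigma>) \<sigma> = c *\<^sub>R weighted_avg I w f \<sigma>"
  by (simp add: weighted_avg_def scaleR_sum_right mult.left_commute mult.commute)

lemma weighted_avg_zero [simp]: "weighted_avg I w (\<lambda>_. 0) \<sigma> = 0"
  by (simp add: weighted_avg_def)

lemma weighted_avg_sum:
  "weighted_avg I w (\<lambda>\<sigma>. \<Sum>j\<in>J. f j \<sigma>) \<sigma> = (\<Sum>j\<in>J. weighted_avg I w (f j) \<sigma>)"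
  by (induction J rule: infinite_finite_induct) (simp_all add: weighted_avg_add)

lemma num_fixed_conj:
  assumes "p permutes I"
  shows "num_fixed I (p \<circ> s \<circ> inv' p) = num_fixed I s"
proof -
  have fix_iff: "p (s (inv' p x)) = x \<longleftrightarrow> s (inv' p x) = inv' p x" for x
    using permutes_inverses[OF assms] by metis
  have "bij_betw p {i \<in> I. s i = i} {i \<in> I. (p \<circ> s \<circ> inv' p) i = i}"
    by (rule bij_betw_byWitness[where f'="inv' p"])
      (auto simp: permutes_inverses[OF assms] permutes_in_image[OF assms]
        permutes_in_image[OF permutes_inv[OF assms]] fix_iff)
  then show ?thesis
    using bij_betw_same_card by (simp add: num_fixed_def) fastforce
qed

lemma num_fixed_inv:
  assumes "s permutes I"
  shows "num_fixed I (inv' s) = num_fixed I s"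
proof -
  have "inv' s i = i \<longleftrightarrow> s i = i" for i using permutes_inverses[OF assms] by metis
  then show ?thesis by (simp add: num_fixed_def)
qed

lemma sum_permutes_conj:
  assumes "p permutes I"
  shows "(\<Sum>s | s permutes I. F (p \<circ> s \<circ> inv' p)) = (\<Sum>s | s permutes I. F s)"
proof (rule sum.reindex_bij_witness[of _ "\<lambda>s. inv' p \<circ> s \<circ> p" "\<lambda>s. p \<circ> s \<circ> inv' p"])
  fix s assume "s \<in> {s. s permutes I}"
  then have s: "s permutes I" by simp
  show "inv' p \<circ> (p \<circ> s \<circ> inv' p) \<circ> p = s" "p \<circ> (inv' p \<circ> s \<circ> p) \<circ> inv' p = s"
    using permutes_inverses[OF assms] by (auto simp: fun_eq_iff)
  show "p \<circ> s \<circ> inv' p \<in> {s. s permutes I}" "inv' p \<circ> s \<circ> p \<in> {s. s permutes I}"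
    using s assms by (auto intro!: permutes_compose permutes_inv)
qed auto

lemma sum_permutes_inv: "(\<Sum>s | s permutes I. F (inv' s)) = (\<Sum>s | s permutes I. F s)"
  by (rule sum.reindex_bij_witness[of _ "inv'" "inv'"]) (auto simp: permutes_inv permutes_inv_inv)

lemma sum_permutes_compose_left:
  assumes "p permutes I"
  shows "(\<Sum>s | s permutes I. F (p \<circ> s)) = (\<Sum>s | s permutes I. F s)"
  by (rule sum.reindex_bij_witness[of _ "\<lambda>s. inv' p \<circ> s" "\<lambda>s. p \<circ> s"])
    (use assms in \<open>auto intro!: permutes_compose permutes_inv simp: o_assoc permutes_inv_o\<close>)

lemma sum_permutes_compose_right:
  assumes "p permutes I"
  shows "(\<Sum>s | s permutes I. F (s \<circ> p)) = (\<Sum>s | s permutes I. F s)"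
  by (rule sum.reindex_bij_witness[of _ "\<lambda>s. s \<circ> inv' p" "\<lambda>s. s \<circ> p"])
    (use assms in \<open>auto intro!: permutes_compose permutes_inv simp: o_assoc[symmetric] permutes_inv_o\<close>)

lemma weighted_avg_weighted_avg:
  "weighted_avg I w (weighted_avg J v f) \<sigma> =
     (\<Sum>t | t permutes J. v (num_fixed J t) *\<^sub>R
        (\<Sum>s | s permutes I. w (num_fixed I s) *\<^sub>R f (\<sigma> \<circ> s \<circ> t))) /\<^sub>R (fact (card I) * fact (card J))"
proof -
  let ?c = "inverse (fact (card J)) :: real"
  have "(\<Sum>s | s permutes I. w (num_fixed I s) *\<^sub>R weighted_avg J v f (\<sigma> \<circ> s))
      = (\<Sum>s | s permutes I. \<Sum>t | t permutes J.
          ?c *\<^sub>R (v (num_fixed J t) *\<^sub>R (w (num_fixed I s) *\<^sub>R f (\<sigma> \<circ> s \<circ> t))))"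
    unfolding weighted_avg_def scaleR_sum_right
    by (intro sum.cong refl) (simp only: scaleR_scaleR inverse_mult_distrib ac_simps)
  also have "\<dots> = ?c *\<^sub>R (\<Sum>t | t permutes J. v (num_fixed J t) *\<^sub>R
        (\<Sum>s | s permutes I. w (num_fixed I s) *\<^sub>R f (\<sigma> \<circ> s \<circ> t)))"
    unfolding scaleR_sum_right by (rule sum.swap)
  finally show ?thesis
    unfolding weighted_avg_def[of I] by (simp only: scaleR_scaleR inverse_mult_distrib)
qed

text \<open>
  The weight is a class function of the larger symmetric group, so it is not changed by conjugation with permutations of
  the smaller set.
\<close>

lemma weighted_avg_commute:
  assumes I: "finite I" and "J \<subseteq> I"
  shows "weighted_avg I w (weighted_avg J v f) \<sigma> = weighted_avg J v (weighted_avg I w f) \<sigma>"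
proof -
  have *: "(\<Sum>s | s permutes I. w (num_fixed I s) *\<^sub>R f (\<sigma> \<circ> s \<circ> t))
      = (\<Sum>s | s permutes I. w (num_fixed I s) *\<^sub>R f (\<sigma> \<circ> t \<circ> s))"
    if "t permutes J" for t
  proof -
    have t: "t permutes I" using that assms permutes_subset by blast
    have "(\<Sum>s | s permutes I. w (num_fixed I s) *\<^sub>R f (\<sigma> \<circ> s \<circ> t))
      = (\<Sum>s | s permutes I. w (num_fixed I (t \<circ> s \<circ> inv' t)) *\<^sub>R f (\<sigma> \<circ> (t \<circ> s \<circ> inv' t) \<circ> t))"
      by (rule sum_permutes_conj[OF t, symmetric, of "\<lambda>s. w (num_fixed I s) *\<^sub>R f (\<sigma> \<circ> s \<circ> t)"])
    also have "\<dots> = (\<Sum>s | s permutes I. w (num_fixed I s) *\<^sub>R f (\<sigma> \<circ> t \<circ> s))"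
    proof (intro sum.cong refl)
      fix s
      have "(\<sigma> \<circ> (t \<circ> s \<circ> inv' t) \<circ> t) = \<sigma> \<circ> t \<circ> s"
        using permutes_inverses[OF t] by (auto simp: fun_eq_iff)
      then show "w (num_fixed I (t \<circ> s \<circ> inv' t)) *\<^sub>R f (\<sigma> \<circ> (t \<circ> s \<circ> inv' t) \<circ> t)
          = w (num_fixed I s) *\<^sub>R f (\<sigma> \<circ> t \<circ> s)"
        by (simp add: num_fixed_conj[OF t])
    qed
    finally show ?thesis .
  qed
  have "weighted_avg I w (weighted_avg J v f) \<sigma> =
     (\<Sum>t | t permutes J. v (num_fixed J t) *\<^sub>R
        (\<Sum>s | s permutes I. w (num_fixed I s) *\<^sub>R f (\<sigma> \<circ> t \<circ> s))) /\<^sub>R (fact (card I) * fact (card J))"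
    unfolding weighted_avg_weighted_avg
    by (rule arg_cong2[where f=scaleR, OF refl], rule sum.cong[OF refl], rule arg_cong2[where f=scaleR, OF refl])
      (simp only: mem_Collect_eq *)
  also have "\<dots> = (\<Sum>t | t permutes J. v (num_fixed J t) *\<^sub>R weighted_avg I w f (\<sigma> \<circ> t)) /\<^sub>R fact (card J)"
    unfolding weighted_avg_def scaleR_sum_right
    by (intro sum.cong refl) (simp only: scaleR_scaleR inverse_mult_distrib ac_simps)
  finally show ?thesis
    unfolding weighted_avg_def[of J] .
qed

lemma permutes_fixing_iff: "s permutes I \<and> s i = i \<longleftrightarrow> s permutes (I - {i})" if "i \<in> I"
  using that unfolding permutes_def by (metis DiffE DiffI insertI1 singletonD)

text \<open>
  The basic recursion. The difference \<open>w(x) - w(0)\<close> vanishes at \<open>0\<close>, so it may be written as \<open>x\<close> times the difference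
  quotient at \<open>x - 1\<close>; the factor \<open>x\<close> is the number of fixed points, and spreading it over them turns the sum over
  permutations of \<open>I\<close> into sums over the stabilisers of single points. A permutation has one fixed point fewer when regarded as
  a permutation of the remaining points.
\<close>

lemma weighted_avg_one_at_zero:
  assumes I: "finite I" "I \<noteq> {}"
  shows "weighted_avg I w f \<sigma> = w 0 *\<^sub>R avg I f \<sigma>
     + (\<Sum>i\<in>I. weighted_avg (I - {i}) (diff_quot w) f \<sigma>) /\<^sub>R card I"
proof -
  let ?n = "card I"
  have n: "?n > 0" using I by (simp add: card_gt_0_iff)
  have fix_suc: "num_fixed I s = Suc (num_fixed (I - {i}) s)" if "i \<in> I" "s permutes (I - {i})" for i s
  proof -
    have "s i = i" using that by (auto simp: permutes_def)
    then have "{j \<in> I. s j = j} = insert i {j \<in> I - {i}. s j = j}" using that by auto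
    then show ?thesis using I by (simp add: num_fixed_def)
  qed
  have "(\<Sum>s | s permutes I. (w (num_fixed I s) - w 0) *\<^sub>R f (\<sigma> \<circ> s))
     = (\<Sum>s | s permutes I. \<Sum>i | i \<in> I \<and> s i = i. diff_quot w (num_fixed I s - 1) *\<^sub>R f (\<sigma> \<circ> s))"
  proof (rule sum.cong[OF refl])
    fix s
    show "(w (num_fixed I s) - w 0) *\<^sub>R f (\<sigma> \<circ> s)
       = (\<Sum>i | i \<in> I \<and> s i = i. diff_quot w (num_fixed I s - 1) *\<^sub>R f (\<sigma> \<circ> s))"
      by (cases "num_fixed I s") (auto simp: sum_constant_scaleR diff_quot_def num_fixed_def[symmetric])
  qed
  also have "\<dots> = (\<Sum>i\<in>I. \<Sum>s | s permutes I \<and> s i = i. diff_quot w (num_fixed I s - 1) *\<^sub>R f (\<sigma> \<circ> s))"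
    using I finite_permutations[OF I(1)]
    by (subst sum.swap_restrict) (auto intro!: sum.cong)
  also have "\<dots> = (\<Sum>i\<in>I. \<Sum>s | s permutes (I - {i}). diff_quot w (num_fixed (I - {i}) s) *\<^sub>R f (\<sigma> \<circ> s))"
    by (intro sum.cong refl) (auto simp: permutes_fixing_iff fix_suc)
  also have "\<dots> = (\<Sum>i\<in>I. fact (?n - 1) *\<^sub>R weighted_avg (I - {i}) (diff_quot w) f \<sigma>)"
    using I by (intro sum.cong refl) (simp add: weighted_avg_def)
  finally have *: "(\<Sum>s | s permutes I. w (num_fixed I s) *\<^sub>R f (\<sigma> \<circ> s))
     = (\<Sum>s | s permutes I. w 0 *\<^sub>R f (\<sigma> \<circ> s)) + fact (?n - 1) *\<^sub>R (\<Sum>i\<in>I. weighted_avg (I - {i}) (diff_quot w) f \<sigma>)"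
    by (simp add: scaleR_diff_left sum_subtractf scaleR_sum_right diff_eq_eq add.commute)
  have "fact ?n = real ?n * fact (?n - 1)" using n by (simp add: fact_reduce)
  then have "inverse (fact ?n) * fact (?n - 1) = inverse (real ?n)" using n by simp
  moreover have "weighted_avg I w f \<sigma> = (\<Sum>s | s permutes I. w (num_fixed I s) *\<^sub>R f (\<sigma> \<circ> s)) /\<^sub>R fact ?n"
    by (simp add: weighted_avg_def)
  moreover have "(\<Sum>s | s permutes I. w 0 *\<^sub>R f (\<sigma> \<circ> s)) /\<^sub>R fact ?n = w 0 *\<^sub>R avg I f \<sigma>"
    by (simp add: weighted_avg_def scaleR_sum_right mult.commute)
  ultimately show ?thesis unfolding *
    by (simp add: scaleR_add_right)
qed

section \<open>The number of fixed points of a random permutation\<close>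

lemma expect_step:
  assumes "finite I" "I \<noteq> {}"
  shows "expect I w = w 0 + (\<Sum>i\<in>I. expect (I - {i}) (diff_quot w)) / card I"
  using weighted_avg_one_at_zero[OF assms, of w "\<lambda>_. 1 :: real" id] assms
  by (simp add: expect_def weighted_avg_def card_permutations divide_inverse mult.commute)

lemma expect_empty [simp]: "expect {} w = w 0"
  by (simp add: expect_eq num_fixed_def)

lemma expect_add: "expect I (\<lambda>x. v x + w x) = expect I v + expect I w"
  by (simp add: expect_eq sum.distrib add_divide_distrib)

lemma expect_diff: "expect I (\<lambda>x. v x - w x) = expect I v - expect I w"
  by (simp add: expect_eq sum_subtractf diff_divide_distrib)

lemma expect_scale: "expect I (\<lambda>x. c * w x) = c * expect I w"
  by (simp add: expect_eq sum_distrib_left)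

lemma expect_divide: "expect I (\<lambda>x. w x / c) = expect I w / c"
  using expect_scale[of I "inverse c" w] by (simp add: divide_inverse mult.commute)

lemma expect_mono: "(\<And>x. v x \<le> w x) \<Longrightarrow> expect I v \<le> expect I w"
  by (simp add: expect_eq divide_right_mono sum_mono)

text \<open>
  By the recursion the expectation is determined by the weight and the number of points.
\<close>

lemma expect_card_cong:
  fixes I J :: "'i set"
  assumes "finite I" "finite J" "card I = card J"
  shows "expect I w = expect J w"
  using assms
proof (induction "card I" arbitrary: I J w)
  case 0
  then show ?case by simp
next
  case (Suc n)
  then have ne: "I \<noteq> {}" "J \<noteq> {}" by auto
  obtain j where j: "j \<in> J" using ne by auto
  have "expect (I - {i}) (diff_quot w) = expect (J - {j}) (diff_quot w)" if "i \<in> I" for i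
    using Suc that j by auto
  moreover have "expect (J - {i}) (diff_quot w) = expect (J - {j}) (diff_quot w)" if "i \<in> J" for i
    using Suc.hyps(1)[of "J - {i}" "J - {j}"] Suc that j by auto
  ultimately show ?case
    using Suc.prems Suc.hyps(2) ne by (simp add: expect_step)
qed

text \<open>
  The factorial moments agree with those of a Poisson variable of mean \<open>1\<close> up to order \<open>|I|\<close>: the difference quotient of
  \<open>x choose (j + 1)\<close> is \<open>(x choose j) / (j + 1)\<close>.
\<close>

lemma expect_binomial:
  assumes "finite I"
  shows "expect I (\<lambda>x. real (x choose j)) = (if j \<le> card I then 1 / fact j else 0)"
  using assms
proof (induction j arbitrary: I)
  case 0
  then show ?case by (simp add: expect_eq card_permutations)
next
  case (Suc j)
  show ?case
  proof (cases "I = {}")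
    case False
    have "diff_quot (\<lambda>x. real (x choose Suc j)) = (\<lambda>x. real (x choose j) / real (Suc j))"
    proof
      fix x
      have "real (Suc x) * real (x choose j) = real (Suc x choose Suc j) * real (Suc j)"
        using Suc_times_binomial_eq[of x j] by (metis of_nat_mult)
      then show "diff_quot (\<lambda>x. real (x choose Suc j)) x = real (x choose j) / real (Suc j)"
        by (simp add: diff_quot_def field_simps del: binomial_Suc_Suc)
    qed
    then have "expect I (\<lambda>x. real (x choose Suc j))
        = (\<Sum>i\<in>I. (if j \<le> card (I - {i}) then 1 / fact j else 0) / real (Suc j)) / card I"
      using Suc False by (simp add: expect_step expect_divide del: of_nat_Suc)
    also have "\<dots> = (\<Sum>i\<in>I. if Suc j \<le> card I then 1 / fact (Suc j) else 0) / card I"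
    proof -
      have "(if j \<le> card (I - {i}) then 1 / fact j else 0) / real (Suc j)
          = (if Suc j \<le> card I then 1 / fact (Suc j) else 0)" if "i \<in> I" for i
      proof -
        have "j \<le> card (I - {i}) \<longleftrightarrow> Suc j \<le> card I"
          using that Suc.prems card_gt_0_iff[of I] by auto
        then show ?thesis by (simp add: mult.commute)
      qed
      then show ?thesis by simp
    qed
    finally show ?thesis using Suc.prems False by simp
  qed simp
qed

lemma expect_const: "finite I \<Longrightarrow> expect I (\<lambda>_. c) = c"
  by (simp add: expect_eq card_permutations)

lemma expect_linear: "finite I \<Longrightarrow> I \<noteq> {} \<Longrightarrow> expect I (\<lambda>x. real x) = 1"
  using expect_binomial[of I 1] by (simp add: Suc_leI card_gt_0_iff)

lemma real_choose_two: "real (x choose 2) = real x * (real x - 1) / 2"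
  by (induction x) (simp_all add: numeral_2_eq_2 field_simps)

lemma expect_falling_two:
  assumes "finite I" "card I \<ge> 2"
  shows "expect I (\<lambda>x. real x * (real x - 1)) = 1"
  using expect_binomial[OF assms(1), of 2] assms(2) by (simp add: real_choose_two expect_divide)

section \<open>Functions of a single image point\<close>

text \<open>
  The total weight of the permutations that send \<open>i\<close> to \<open>x\<close>. These numbers are, up to the factor \<open>|I|!\<close>, the matrix entries
  of the operator on the permutation module of \<open>I\<close>.
\<close>

definition fiber_weight :: "'i set \<Rightarrow> (nat \<Rightarrow> real) \<Rightarrow> 'i \<Rightarrow> 'i \<Rightarrow> real" where
  "fiber_weight I w i x = (\<Sum>s | s permutes I. if s i = x then w (num_fixed I s) else 0)"

text \<open>
  The average of \<open>w(X) \<chi>(s) / \<chi>(1)\<close> for the character \<open>\<chi> = X - 1\<close> of the standard representation, of degree \<open>|I| - 1\<close>.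
\<close>

definition std_eigenvalue :: "'i set \<Rightarrow> (nat \<Rightarrow> real) \<Rightarrow> real" where
  "std_eigenvalue I w = expect I (\<lambda>x. w x * (real x - 1)) / (real (card I) - 1)"

lemma fiber_weight_conj:
  assumes "p permutes I"
  shows "fiber_weight I w (p i) (p x) = fiber_weight I w i x"
proof -
  have "(p \<circ> s \<circ> inv' p) (p i) = p x \<longleftrightarrow> s i = x" for s
    using permutes_inverses[OF assms] by (metis comp_apply)
  then show ?thesis
    unfolding fiber_weight_def
    using sum_permutes_conj[OF assms, of "\<lambda>s. if s (p i) = p x then w (num_fixed I s) else 0"]
    by (simp only: num_fixed_conj[OF assms])
qed

lemma fiber_weight_diag:
  assumes "i \<in> I" "j \<in> I"
  shows "fiber_weight I w i i = fiber_weight I w j j"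
  using fiber_weight_conj[OF permutes_swap_id[OF assms(2,1)], of w j j] by simp

text \<open>
  Conjugation shows that the fiber weights take only two values, one for \<open>x = i\<close> and one for \<open>x \<noteq> i\<close>. Counting all
  permutations, once with their weight and once with weight times number of fixed points, gives two linear equations
  for these values.
\<close>

lemma fiber_weight_diff:
  assumes I: "finite I" and i: "i \<in> I" and x: "x \<in> I" "x \<noteq> i"
  shows "fiber_weight I w i i - fiber_weight I w i x = fact (card I) * std_eigenvalue I w"
proof -
  let ?n = "card I"
  have n: "?n \<ge> 2" using assms card_mono[OF I, of "{i, x}"] by simp
  have diag: "fiber_weight I w j j = fiber_weight I w i i" if "j \<in> I" for j
    using fiber_weight_diag[OF that i] .
  have off: "fiber_weight I w i y = fiber_weight I w i x" if "y \<in> I" "y \<noteq> i" for y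
    using fiber_weight_conj[OF permutes_swap_id[OF x(1) that(1)], of w i x] that x
    by (simp add: transpose_def)
  have "fact ?n * expect I (\<lambda>x. w x * real x) = (\<Sum>s | s permutes I. w (num_fixed I s) * num_fixed I s)"
    by (simp add: expect_eq)
  also have "\<dots> = (\<Sum>s | s permutes I. \<Sum>j\<in>I. if s j = j then w (num_fixed I s) else 0)"
    using I by (intro sum.cong refl) (simp add: num_fixed_def sum.If_cases Int_def)
  also have "\<dots> = (\<Sum>j\<in>I. fiber_weight I w j j)"
    unfolding fiber_weight_def by (rule sum.swap)
  also have "\<dots> = ?n * fiber_weight I w i i" using diag by simp
  finally have A: "fact ?n * expect I (\<lambda>x. w x * real x) = ?n * fiber_weight I w i i" .
  have "fact ?n * expect I w = (\<Sum>s | s permutes I. w (num_fixed I s))"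
    by (simp add: expect_eq)
  also have "\<dots> = (\<Sum>s | s permutes I. \<Sum>y\<in>I. if s i = y then w (num_fixed I s) else 0)"
    using I i permutes_in_image by (intro sum.cong refl) (fastforce simp: sum.delta')
  also have "\<dots> = (\<Sum>y\<in>I. fiber_weight I w i y)"
    unfolding fiber_weight_def by (rule sum.swap)
  also have "\<dots> = fiber_weight I w i i + (\<Sum>y\<in>I-{i}. fiber_weight I w i y)"
    using I i by (rule sum.remove)
  also have "(\<Sum>y\<in>I-{i}. fiber_weight I w i y) = (real ?n - 1) * fiber_weight I w i x"
    using off I i n by (simp add: of_nat_diff)
  finally have B: "fact ?n * expect I w = fiber_weight I w i i + (real ?n - 1) * fiber_weight I w i x" .
  have "expect I (\<lambda>x. w x * (real x - 1)) = expect I (\<lambda>x. w x * real x) - expect I w"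
    by (simp add: expect_eq right_diff_distrib sum_subtractf diff_divide_distrib)
  moreover have "(real ?n - 1) * (fact ?n * std_eigenvalue I w) = fact ?n * expect I (\<lambda>x. w x * (real x - 1))"
    using n by (simp add: std_eigenvalue_def)
  ultimately have "(real ?n - 1) * (fact ?n * std_eigenvalue I w)
      = fact ?n * expect I (\<lambda>x. w x * real x) - fact ?n * expect I w"
    by (simp only: right_diff_distrib)
  also have "\<dots> = (real ?n - 1) * (fiber_weight I w i i - fiber_weight I w i x)"
    unfolding A B by (simp add: algebra_simps)
  finally show ?thesis using n by simp
qed

lemma avg_invariant:
  assumes "t permutes J"
  shows "avg J f (\<sigma> \<circ> t) = avg J f \<sigma>"
  using sum_permutes_compose_left[OF assms, of "\<lambda>s. f (\<sigma> \<circ> s)"]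
  by (simp add: weighted_avg_def o_assoc)

lemma avg_of_invariant:
  assumes "finite J" and "\<And>t. t permutes J \<Longrightarrow> f (\<sigma> \<circ> t) = f \<sigma>"
  shows "avg J f \<sigma> = f \<sigma>"
  using assms by (simp add: weighted_avg_def sum_constant_scaleR card_permutations)

text \<open>
  Averaging over a subgroup before averaging over the group changes nothing.
\<close>

lemma avg_absorb:
  assumes I: "finite I" and J: "J \<subseteq> I"
  shows "avg I (avg J g) \<sigma> = avg I g \<sigma>"
proof -
  have "avg I (avg J g) \<sigma> = avg J (avg I g) \<sigma>" by (rule weighted_avg_commute[OF I J])
  also have "\<dots> = avg I g \<sigma>"
    using finite_subset[OF J I] permutes_subset[OF _ J] by (intro avg_of_invariant) (auto intro: avg_invariant)
  finally show ?thesis .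
qed

text \<open>
  If \<open>h\<close> is invariant under the stabiliser of \<open>i\<close>, then for fixed \<open>\<sigma>\<close> the value \<open>h(\<sigma> s)\<close> depends on \<open>s(i)\<close> only, and these values sum to
  \<open>0\<close>. Since the fiber weight is the same for all \<open>x \<noteq> i\<close>, only the difference of its two values survives.
\<close>

lemma weighted_avg_point_invariant:
  assumes I: "finite I" "card I \<ge> 2" and i: "i \<in> I"
    and inv: "\<And>\<sigma> t. t permutes I - {i} \<Longrightarrow> h (\<sigma> \<circ> t) = h \<sigma>"
    and mean_zero: "avg I h \<sigma> = 0"
  shows "weighted_avg I w h \<sigma> = std_eigenvalue I w *\<^sub>R h \<sigma>"
proof -
  let ?n = "card I"
  define \<gamma> where "\<gamma> x = h (\<sigma> \<circ> transpose i x)" for x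
  have h: "h (\<sigma> \<circ> s) = \<gamma> (s i)" if s: "s permutes I" for s
  proof -
    let ?t = "transpose i (s i) \<circ> s"
    have "?t permutes I" using s i permutes_in_image[OF s] by (auto intro!: permutes_compose permutes_swap_id)
    moreover have "?t i = i" by simp
    ultimately have "?t permutes I - {i}" using permutes_fixing_iff[OF i] by blast
    from inv[OF this, of "\<sigma> \<circ> transpose i (s i)"] show ?thesis
      by (simp add: \<gamma>_def o_assoc comp_assoc[of \<sigma>]) 
  qed
  have expand: "(\<Sum>s | s permutes I. v (num_fixed I s) *\<^sub>R h (\<sigma> \<circ> s)) = (\<Sum>x\<in>I. fiber_weight I v i x *\<^sub>R \<gamma> x)"
    for v
  proof -
    have "(\<Sum>s | s permutes I. v (num_fixed I s) *\<^sub>R h (\<sigma> \<circ> s))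
        = (\<Sum>s | s permutes I. \<Sum>x\<in>I. (if s i = x then v (num_fixed I s) else 0) *\<^sub>R \<gamma> x)"
    proof (intro sum.cong refl)
      fix s assume "s \<in> {s. s permutes I}"
      then have s: "s permutes I" by simp
      then have "s i \<in> I" using i by (simp add: permutes_in_image)
      have "(\<Sum>x\<in>I. (if s i = x then v (num_fixed I s) else 0) *\<^sub>R \<gamma> x)
          = (\<Sum>x\<in>I. if s i = x then v (num_fixed I s) *\<^sub>R \<gamma> x else 0)"
        by (intro sum.cong) auto
      then show "v (num_fixed I s) *\<^sub>R h (\<sigma> \<circ> s)
          = (\<Sum>x\<in>I. (if s i = x then v (num_fixed I s) else 0) *\<^sub>R \<gamma> x)"
        using s I \<open>s i \<in> I\<close> by (simp add: h)
    qed
    then show ?thesis by (subst (asm) sum.swap) (simp add: fiber_weight_def scaleR_sum_left)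
  qed
  \<comment> \<open>The constant weight detects the mean: all fibers have the same size, so the values of \<open>\<gamma>\<close> sum to zero.\<close>
  have "fiber_weight I (\<lambda>_. 1) i x = fiber_weight I (\<lambda>_. 1) i i" if "x \<in> I" for x
  proof -
    have "transpose i x (s i) = x \<longleftrightarrow> s i = i" for s :: "'a \<Rightarrow> 'a"
      by (metis transpose_apply_first transpose_involutory)
    then show ?thesis
      unfolding fiber_weight_def
      using sum_permutes_compose_left[OF permutes_swap_id[OF i that],
          of "\<lambda>s. if s i = x then 1 else 0 :: real"]
      by simp
  qed
  then have c: "(\<Sum>x\<in>I. fiber_weight I (\<lambda>_. 1) i x *\<^sub>R \<gamma> x) = fiber_weight I (\<lambda>_. 1) i i *\<^sub>R (\<Sum>x\<in>I. \<gamma> x)"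
    by (simp add: scaleR_sum_right)
  have "fiber_weight I (\<lambda>_. 1) i i \<ge> (\<Sum>s\<in>{id}. if s i = i then 1 else 0)"
    unfolding fiber_weight_def using I by (intro sum_mono2) (auto simp: finite_permutations permutes_id)
  then have "fiber_weight I (\<lambda>_. 1) i i > 0" by simp
  then have \<gamma>_sum: "(\<Sum>x\<in>I. \<gamma> x) = 0"
    using mean_zero expand[of "\<lambda>_. 1"] unfolding c weighted_avg_def by simp
  let ?d = "fact ?n * std_eigenvalue I w"
  have fw: "fiber_weight I w i x = (fiber_weight I w i i - ?d) + (if x = i then ?d else 0)" if "x \<in> I" for x
    using fiber_weight_diff[OF I(1) i that, of w] by (cases "x = i") (simp_all add: algebra_simps)
  have "(\<Sum>x\<in>I. fiber_weight I w i x *\<^sub>R \<gamma> x)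
      = (\<Sum>x\<in>I. (fiber_weight I w i i - ?d) *\<^sub>R \<gamma> x + (if x = i then ?d *\<^sub>R \<gamma> x else 0))"
    by (rule sum.cong[OF refl], subst fw, assumption) (simp add: scaleR_add_left)
  also have "\<dots> = (fiber_weight I w i i - ?d) *\<^sub>R (\<Sum>x\<in>I. \<gamma> x) + ?d *\<^sub>R \<gamma> i"
    using I i by (simp only: sum.distrib scaleR_sum_right sum.delta if_True)
  also have "\<dots> = ?d *\<^sub>R h \<sigma>" by (simp add: \<gamma>_sum) (simp add: \<gamma>_def)
  finally show ?thesis
    unfolding weighted_avg_def[of I w] expand by simp
qed

section \<open>The recursive spectral bound\<close>

text \<open>
  The set \<open>\<Omega>\<close> is the ground set of all permutations under consideration and stays fixed, while the operators live on subsets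
  \<open>I\<close> of it. In this way the induction over \<open>I\<close> never changes the function space.
\<close>

definition inner_on :: "'i set \<Rightarrow> (('i \<Rightarrow> 'i) \<Rightarrow> 'a::real_inner) \<Rightarrow> (('i \<Rightarrow> 'i) \<Rightarrow> 'a) \<Rightarrow> real" where
  "inner_on \<Omega> f g = (\<Sum>\<sigma> | \<sigma> permutes \<Omega>. inner (f \<sigma>) (g \<sigma>))"

lemma inner_on_commute: "inner_on \<Omega> f g = inner_on \<Omega> g f"
  by (simp add: inner_on_def inner_commute)

lemma inner_on_add_left: "inner_on \<Omega> (\<lambda>\<sigma>. f \<sigma> + g \<sigma>) h = inner_on \<Omega> f h + inner_on \<Omega> g h"
  by (simp add: inner_on_def inner_add_left sum.distrib)

lemma inner_on_add_right: "inner_on \<Omega> h (\<lambda>\<sigma>. f \<sigma> + g \<sigma>) = inner_on \<Omega> h f + inner_on \<Omega> h g"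
  by (simp add: inner_on_def inner_add_right sum.distrib)

lemma inner_on_scale_left: "inner_on \<Omega> (\<lambda>\<sigma>. c *\<^sub>R f \<sigma>) h = c * inner_on \<Omega> f h"
  by (simp add: inner_on_def sum_distrib_left)

lemma inner_on_sum_left: "inner_on \<Omega> (\<lambda>\<sigma>. \<Sum>i\<in>A. f i \<sigma>) h = (\<Sum>i\<in>A. inner_on \<Omega> (f i) h)"
  by (simp add: inner_on_def inner_sum_left) (rule sum.swap)

lemma inner_on_zero_right [simp]: "inner_on \<Omega> f (\<lambda>_. 0) = 0"
  by (simp add: inner_on_def)

lemma inner_on_self_nonneg: "inner_on \<Omega> f f \<ge> 0"
  by (simp add: inner_on_def sum_nonneg)

text \<open>
  A permutation and its inverse have the same fixed points.
\<close>

lemma weighted_avg_self_adjoint: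
  assumes "finite \<Omega>" "I \<subseteq> \<Omega>"
  shows "inner_on \<Omega> (weighted_avg I w f) g = inner_on \<Omega> f (weighted_avg I w g)"
proof -
  have "inner_on \<Omega> (weighted_avg I w f) g
      = (\<Sum>\<sigma> | \<sigma> permutes \<Omega>. \<Sum>s | s permutes I. w (num_fixed I s) * inner (f (\<sigma> \<circ> s)) (g \<sigma>)) / fact (card I)"
    by (simp add: inner_on_def weighted_avg_def inner_sum_left sum_distrib_left sum_divide_distrib
        divide_inverse mult.commute mult.left_commute)
  also have "(\<Sum>\<sigma> | \<sigma> permutes \<Omega>. \<Sum>s | s permutes I. w (num_fixed I s) * inner (f (\<sigma> \<circ> s)) (g \<sigma>))
      = (\<Sum>s | s permutes I. \<Sum>\<sigma> | \<sigma> permutes \<Omega>. w (num_fixed I s) * inner (f (\<sigma> \<circ> s)) (g \<sigma>))"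
    by (rule sum.swap)
  also have "\<dots> = (\<Sum>s | s permutes I. \<Sum>\<sigma> | \<sigma> permutes \<Omega>. w (num_fixed I s) * inner (f \<sigma>) (g (\<sigma> \<circ> inv' s)))"
  proof (rule sum.cong[OF refl])
    fix s assume "s \<in> {s. s permutes I}"
    then have s: "s permutes I" by simp
    then have s': "s permutes \<Omega>" using assms permutes_subset by blast
    have "\<sigma> \<circ> s \<circ> inv' s = \<sigma>" for \<sigma> :: "'a \<Rightarrow> 'a"
      using permutes_inverses[OF s] by (simp add: fun_eq_iff)
    then show "(\<Sum>\<sigma> | \<sigma> permutes \<Omega>. w (num_fixed I s) * inner (f (\<sigma> \<circ> s)) (g \<sigma>))
      = (\<Sum>\<sigma> | \<sigma> permutes \<Omega>. w (num_fixed I s) * inner (f \<sigma>) (g (\<sigma> \<circ> inv' s)))"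
      using sum_permutes_compose_right[OF s', of "\<lambda>\<sigma>. w (num_fixed I s) * inner (f \<sigma>) (g (\<sigma> \<circ> inv' s))"]
      by simp
  qed
  also have "\<dots> = (\<Sum>s | s permutes I. \<Sum>\<sigma> | \<sigma> permutes \<Omega>. w (num_fixed I (inv' s)) * inner (f \<sigma>) (g (\<sigma> \<circ> inv' s)))"
    by (intro sum.cong refl) (simp add: num_fixed_inv)
  also have "\<dots> = (\<Sum>s | s permutes I. \<Sum>\<sigma> | \<sigma> permutes \<Omega>. w (num_fixed I s) * inner (f \<sigma>) (g (\<sigma> \<circ> s)))"
    by (rule sum_permutes_inv)
  also have "\<dots> = (\<Sum>\<sigma> | \<sigma> permutes \<Omega>. \<Sum>s | s permutes I. w (num_fixed I s) * inner (f \<sigma>) (g (\<sigma> \<circ> s)))"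
    by (rule sum.swap)
  also have "\<dots> / fact (card I) = inner_on \<Omega> f (weighted_avg I w g)"
    by (simp add: inner_on_def weighted_avg_def inner_sum_right sum_distrib_left sum_divide_distrib
        divide_inverse mult.commute mult.left_commute)
  finally show ?thesis .
qed

text \<open>
  An upper bound for the spectrum of the operator on the functions without trivial component for the permutations of \<open>I\<close>.
  The real part of the Hermitian form is enough, and it is the inner product of complex numbers as vectors of the real plane.
\<close>

definition spectral_bound :: "'i set \<Rightarrow> 'i set \<Rightarrow> (nat \<Rightarrow> real) \<Rightarrow> real \<Rightarrow> bool" where
  "spectral_bound \<Omega> I w c \<longleftrightarrow>
     (\<forall>f :: ('i \<Rightarrow> 'i) \<Rightarrow> complex. (\<forall>\<sigma>. avg I f \<sigma> = 0) \<longrightarrow>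
        inner_on \<Omega> (weighted_avg I w f) f \<le> c * inner_on \<Omega> f f)"

text \<open>
  For a function whose average over the permutations of \<open>I\<close> is zero, this is the orthogonal projection to the span of the functions
  of this kind that are invariant under the stabiliser of a point of \<open>I\<close>. The factor is explained by \<open>avg_point_point_part\<close>.
\<close>

definition point_part :: "'i set \<Rightarrow> (('i \<Rightarrow> 'i) \<Rightarrow> 'a::real_vector) \<Rightarrow> ('i \<Rightarrow> 'i) \<Rightarrow> 'a" where
  "point_part I f \<sigma> = ((real (card I) - 1) / real (card I)) *\<^sub>R (\<Sum>i\<in>I. avg (I - {i}) f \<sigma>)"

lemma diff_quot_real [simp]: "diff_quot real = (\<lambda>_. 1)"
  by (simp add: diff_quot_def fun_eq_iff)

context
  fixes \<Omega> I :: "'i set" and f :: "('i \<Rightarrow> 'i) \<Rightarrow> 'a::real_inner"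
  assumes \<Omega>: "finite \<Omega>" and sub: "I \<subseteq> \<Omega>" and card: "card I \<ge> 2"
    and mean_zero: "\<And>\<sigma>. avg I f \<sigma> = 0"
begin

lemma finite_sub: "finite I" using \<Omega> sub finite_subset by blast

lemma avg_avg_point: "avg I (avg (I - {i}) f) \<sigma> = 0"
  using avg_absorb[OF finite_sub, of "I - {i}" f] mean_zero by auto

lemma weighted_avg_avg_point:
  assumes "i \<in> I"
  shows "weighted_avg I w (avg (I - {i}) f) \<sigma> = std_eigenvalue I w *\<^sub>R avg (I - {i}) f \<sigma>"
  using finite_sub card assms
  by (rule weighted_avg_point_invariant) (simp_all add: avg_invariant avg_avg_point)

lemma weighted_avg_point_part:
  "weighted_avg I w (point_part I f) \<sigma> = std_eigenvalue I w *\<^sub>R point_part I f \<sigma>"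
  unfolding point_part_def weighted_avg_scale weighted_avg_sum
  by (simp add: weighted_avg_avg_point scaleR_sum_right mult.commute)

text \<open>
  The sum over all point averages is \<open>|I|\<close> times the operator with weight \<open>x\<close>. It commutes with the average over
  the stabiliser of \<open>l\<close>, and on the result of that average it acts by the standard eigenvalue \<open>E[X (X - 1)] / (|I| - 1) = 1 / (|I| - 1)\<close>.
\<close>

lemma avg_point_point_part:
  assumes l: "l \<in> I"
  shows "avg (I - {l}) (point_part I f) \<sigma> = avg (I - {l}) f \<sigma>"
proof -
  have ne: "I \<noteq> {}" using l by auto
  have "(\<Sum>i\<in>I. avg (I - {i}) f \<sigma>) = card I *\<^sub>R weighted_avg I real f \<sigma>" for \<sigma>
    using weighted_avg_one_at_zero[OF finite_sub ne, of real f \<sigma>] card by simp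
  then have "point_part I f = (\<lambda>\<sigma>. (real (card I) - 1) *\<^sub>R weighted_avg I real f \<sigma>)"
    using card by (simp add: point_part_def fun_eq_iff)
  then have "avg (I - {l}) (point_part I f) \<sigma>
      = (real (card I) - 1) *\<^sub>R avg (I - {l}) (weighted_avg I real f) \<sigma>"
    by (simp add: weighted_avg_scale)
  also have "avg (I - {l}) (weighted_avg I real f) \<sigma> = weighted_avg I real (avg (I - {l}) f) \<sigma>"
    by (rule weighted_avg_commute[OF finite_sub, symmetric]) auto
  also have "\<dots> = std_eigenvalue I real *\<^sub>R avg (I - {l}) f \<sigma>"
    by (rule weighted_avg_avg_point[OF l])
  also have "std_eigenvalue I real = 1 / (real (card I) - 1)"
    using finite_sub card by (simp add: std_eigenvalue_def expect_falling_two)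
  finally show ?thesis using card by simp
qed

end

lemma inner_point_part:
  assumes "finite \<Omega>" "I \<subseteq> \<Omega>" "\<And>i \<sigma>. i \<in> I \<Longrightarrow> avg (I - {i}) g \<sigma> = 0"
  shows "inner_on \<Omega> (point_part I f) g = 0"
proof -
  have "inner_on \<Omega> (avg (I - {i}) f) g = 0" if "i \<in> I" for i
  proof -
    have "inner_on \<Omega> (avg (I - {i}) f) g = inner_on \<Omega> f (avg (I - {i}) g)"
      using assms(1,2) by (intro weighted_avg_self_adjoint) auto
    also have "avg (I - {i}) g = (\<lambda>_. 0)" using assms(3)[OF that] by auto
    finally show ?thesis by simp
  qed
  then show ?thesis
    by (simp add: point_part_def[abs_def] inner_on_scale_left inner_on_sum_left)
qed

lemma avg_eq_zero_of_point_avg: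
  assumes "finite I" "I \<noteq> {}" "\<And>i \<sigma>. i \<in> I \<Longrightarrow> avg (I - {i}) g \<sigma> = 0"
  shows "avg I g \<sigma> = 0"
proof -
  obtain i where i: "i \<in> I" using assms(2) by auto
  have "avg I g \<sigma> = avg I (avg (I - {i}) g) \<sigma>"
    by (rule avg_absorb[OF assms(1), symmetric]) auto
  also have "avg (I - {i}) g = (\<lambda>_. 0)" using assms(3)[OF i] by auto
  finally show ?thesis by simp
qed

text \<open>
  On functions killed by all point averages the constant term of the recursion vanishes, so the operator is the average of
  the operators for one point fewer.
\<close>

lemma inner_weighted_avg_le_by_points:
  assumes I: "finite I" "I \<noteq> {}"
    and zero: "\<And>i \<sigma>. i \<in> I \<Longrightarrow> avg (I - {i}) g \<sigma> = 0"
    and bound: "\<And>i. i \<in> I \<Longrightarrow> inner_on \<Omega> (weighted_avg (I - {i}) (diff_quot w) g) g \<le> c * inner_on \<Omega> g g"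
  shows "inner_on \<Omega> (weighted_avg I w g) g \<le> c * inner_on \<Omega> g g"
proof -
  have n: "card I > 0" using I by (simp add: card_gt_0_iff)
  have "weighted_avg I w g = (\<lambda>\<sigma>. (1 / card I) *\<^sub>R (\<Sum>i\<in>I. weighted_avg (I - {i}) (diff_quot w) g \<sigma>))"
    using weighted_avg_one_at_zero[OF I, of w g] avg_eq_zero_of_point_avg[OF I zero]
    by (simp add: fun_eq_iff inverse_eq_divide)
  then have "inner_on \<Omega> (weighted_avg I w g) g
      = (\<Sum>i\<in>I. inner_on \<Omega> (weighted_avg (I - {i}) (diff_quot w) g) g) / card I"
    by (simp add: inner_on_scale_left inner_on_sum_left)
  also have "\<dots> \<le> (\<Sum>i\<in>I. c * inner_on \<Omega> g g) / card I"
    using bound by (intro divide_right_mono sum_mono) auto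
  also have "\<dots> = c * inner_on \<Omega> g g" using n by simp
  finally show ?thesis .
qed

text \<open>
  The two cross terms vanish, so the bound may be checked on both summands.
\<close>

lemma inner_on_orthogonal_sum:
  assumes "inner_on \<Omega> u r = 0" and "\<And>\<sigma>. A u \<sigma> = \<tau> *\<^sub>R u \<sigma>"
    and "inner_on \<Omega> (A r) u = 0" and "\<And>\<sigma>. A (\<lambda>\<sigma>. u \<sigma> + r \<sigma>) \<sigma> = A u \<sigma> + A r \<sigma>"
    and "\<tau> \<le> c" and "inner_on \<Omega> (A r) r \<le> c * inner_on \<Omega> r r"
  shows "inner_on \<Omega> (A (\<lambda>\<sigma>. u \<sigma> + r \<sigma>)) (\<lambda>\<sigma>. u \<sigma> + r \<sigma>)
    \<le> c * inner_on \<Omega> (\<lambda>\<sigma>. u \<sigma> + r \<sigma>) (\<lambda>\<sigma>. u \<sigma> + r \<sigma>)"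
proof -
  have Au: "A u = (\<lambda>\<sigma>. \<tau> *\<^sub>R u \<sigma>)" and A: "A (\<lambda>\<sigma>. u \<sigma> + r \<sigma>) = (\<lambda>\<sigma>. A u \<sigma> + A r \<sigma>)"
    using assms by auto
  have "inner_on \<Omega> r u = 0" using assms(1) by (simp add: inner_on_commute)
  moreover have "\<tau> * inner_on \<Omega> u u \<le> c * inner_on \<Omega> u u"
    using assms(5) by (simp add: mult_right_mono inner_on_self_nonneg)
  ultimately show ?thesis
    using assms(1,3,6) unfolding A
    by (simp add: inner_on_add_left inner_on_add_right Au inner_on_scale_left distrib_left)
qed

text \<open>
  With at most one point there is only the identity, and a function of mean zero vanishes; this ends the recursion.
\<close>

lemma spectral_bound_small:
  assumes "finite I" "card I \<le> 1"
  shows "spectral_bound \<Omega> I w c"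
proof -
  have "f \<sigma> = 0" if "avg I f \<sigma> = 0" for f :: "('a \<Rightarrow> 'a) \<Rightarrow> complex" and \<sigma>
  proof -
    have "{s. s permutes I} = {id}"
      using assms by (cases "card I") (auto simp: card_Suc_eq permutes_id permutes_sing)
    then show ?thesis using that assms by (simp add: weighted_avg_def)
  qed
  then have "f = (\<lambda>_. 0)" if "\<forall>\<sigma>. avg I f \<sigma> = 0" for f :: "('a \<Rightarrow> 'a) \<Rightarrow> complex"
    using that by auto
  then show ?thesis
    unfolding spectral_bound_def by (metis inner_on_zero_right mult_zero_right order_refl)
qed

text \<open>
  The induction step of the whole proof: on the point part the operator is the scalar \<open>std_eigenvalue I w\<close>, on its
  orthogonal complement the recursion passes to one point fewer.
\<close>

lemma spectral_bound_step:
  assumes \<Omega>: "finite \<Omega>" and sub: "I \<subseteq> \<Omega>" and card: "card I \<ge> 2"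
    and std: "std_eigenvalue I w \<le> c"
    and step: "\<And>i. i \<in> I \<Longrightarrow> spectral_bound \<Omega> (I - {i}) (diff_quot w) c"
  shows "spectral_bound \<Omega> I w c"
  unfolding spectral_bound_def
proof (intro allI impI)
  fix f :: "('a \<Rightarrow> 'a) \<Rightarrow> complex"
  assume "\<forall>\<sigma>. avg I f \<sigma> = 0"
  then have mz: "\<And>\<sigma>. avg I f \<sigma> = 0" by simp
  have I: "finite I" "I \<noteq> {}" using \<Omega> sub card finite_subset by auto
  define u where "u = point_part I f"
  define r where "r \<sigma> = f \<sigma> - u \<sigma>" for \<sigma>
  have f: "f = (\<lambda>\<sigma>. u \<sigma> + r \<sigma>)" by (simp add: r_def)
  have r_zero: "avg (I - {i}) r \<sigma> = 0" if "i \<in> I" for i \<sigma>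
    using avg_point_point_part[OF \<Omega> sub card mz that]
    by (simp add: r_def[abs_def] weighted_avg_diff u_def)
  have "inner_on \<Omega> u (weighted_avg I w r) = 0"
    unfolding u_def
  proof (rule inner_point_part[OF \<Omega> sub])
    fix i \<sigma> assume "i \<in> I"
    then have "avg (I - {i}) r = (\<lambda>_. 0)" using r_zero by auto
    then show "avg (I - {i}) (weighted_avg I w r) \<sigma> = 0"
      using weighted_avg_commute[OF I(1), of "I - {i}" w "\<lambda>_. 1" r \<sigma>] by simp
  qed
  moreover have "inner_on \<Omega> u r = 0"
    unfolding u_def using r_zero by (intro inner_point_part[OF \<Omega> sub])
  moreover have "inner_on \<Omega> (weighted_avg I w r) r \<le> c * inner_on \<Omega> r r"
  proof (rule inner_weighted_avg_le_by_points[OF I r_zero])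
    fix i assume "i \<in> I"
    then show "inner_on \<Omega> (weighted_avg (I - {i}) (diff_quot w) r) r \<le> c * inner_on \<Omega> r r"
      using step r_zero unfolding spectral_bound_def by blast
  qed
  ultimately show "inner_on \<Omega> (weighted_avg I w f) f \<le> c * inner_on \<Omega> f f"
    unfolding f using std weighted_avg_point_part[OF \<Omega> sub card mz, of w]
    by (intro inner_on_orthogonal_sum[where A = "weighted_avg I w" and \<tau> = "std_eigenvalue I w"])
      (auto simp: u_def inner_on_commute weighted_avg_add)
qed

section \<open>Bounds for derangements and for a fixed number of fixed points\<close>

lemma spectral_bound_mono:
  assumes "spectral_bound \<Omega> I w c" "c \<le> d"
  shows "spectral_bound \<Omega> I w d"
  using assms unfolding spectral_bound_def
  by (meson inner_on_self_nonneg mult_right_mono order_trans)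

lemma spectral_bound_scale:
  assumes "spectral_bound \<Omega> I w c" "a \<ge> 0"
  shows "spectral_bound \<Omega> I (\<lambda>x. a * w x) (a * c)"
proof -
  have "weighted_avg I (\<lambda>x. a * w x) f = (\<lambda>\<sigma>. a *\<^sub>R weighted_avg I w f \<sigma>)"
    for f :: "('a \<Rightarrow> 'a) \<Rightarrow> complex"
    by (simp add: fun_eq_iff weighted_avg_scale_weight)
  then show ?thesis
    using assms unfolding spectral_bound_def
    by (simp add: inner_on_scale_left mult.assoc mult_left_mono)
qed

lemma diff_quot_inverse_shift:
  assumes "d > 0"
  shows "diff_quot (\<lambda>x. a / (real x + real d)) = (\<lambda>x. (- a / real d) / (real x + real (Suc d)))"
proof
  fix x
  have "real x + real d + 1 \<noteq> 0" "real x + 1 \<noteq> 0" by linarith+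
  then show "diff_quot (\<lambda>x. a / (real x + real d)) x = (- a / real d) / (real x + real (Suc d))"
    using assms by (simp add: diff_quot_def divide_simps) (simp add: algebra_simps)
qed

text \<open>
  The variance of the number of fixed points.
\<close>

lemma expect_square:
  assumes "finite I" "card I \<ge> 2"
  shows "expect I (\<lambda>x. (real x - 1)\<^sup>2) = 1"
proof -
  have "expect I (\<lambda>x. (real x - 1)\<^sup>2) = expect I (\<lambda>x. real x * (real x - 1) - real x + 1)"
    by (intro arg_cong[where f="expect I"]) (auto simp: power2_eq_square algebra_simps)
  also have "\<dots> = 1"
    unfolding expect_add expect_diff using assms
    by (simp add: expect_falling_two expect_const) (subst expect_linear, auto)
  finally show ?thesis .
qed

text \<open>
  Integers satisfy \<open>|x - 1| \<le> (x - 1)\<^sup>2\<close>, and the right-hand side has expectation \<open>1\<close>.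
\<close>

lemma std_eigenvalue_inverse_shift:
  assumes "finite I" "card I \<ge> 2" "d > 0"
  shows "std_eigenvalue I (\<lambda>x. a / (real x + real d)) \<le> \<bar>a\<bar> / (real d * (real (card I) - 1))"
proof -
  have "a / (real x + real d) * (real x - 1) \<le> \<bar>a\<bar> / real d * (real x - 1)\<^sup>2" for x :: nat
  proof -
    have "\<bar>real x - 1\<bar> \<le> (real x - 1)\<^sup>2"
    proof (cases x)
      case (Suc y)
      have "real y * 1 \<le> real y * real y \<or> y = 0" by (cases y) auto
      then show ?thesis using Suc by (auto simp: power2_eq_square)
    qed simp
    moreover have "\<bar>a / (real x + real d)\<bar> \<le> \<bar>a\<bar> / real d"
      using assms(3) by (simp add: frac_le)
    ultimately have "\<bar>a / (real x + real d) * (real x - 1)\<bar> \<le> \<bar>a\<bar> / real d * (real x - 1)\<^sup>2"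
      unfolding abs_mult by (intro mult_mono) auto
    then show ?thesis by linarith
  qed
  then have "expect I (\<lambda>x. a / (real x + real d) * (real x - 1)) \<le> expect I (\<lambda>x. \<bar>a\<bar> / real d * (real x - 1)\<^sup>2)"
    by (rule expect_mono)
  also have "\<dots> = \<bar>a\<bar> / real d" by (simp only: expect_scale expect_square[OF assms(1,2)] mult_1_right)
  finally show ?thesis
    using assms(2) by (simp add: std_eigenvalue_def divide_right_mono flip: divide_divide_eq_left)
qed

text \<open>
  The weights \<open>a / (x + d)\<close> are stable under the recursion: the difference quotient is \<open>- (a / d) / (x + d + 1)\<close>. The
  factor \<open>1 / d\<close> gained at each step compensates the loss from \<open>|I| - 1\<close> to \<open>|I| - 2\<close> in the denominator.
\<close>

lemma spectral_bound_inverse_shift: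
  assumes "finite \<Omega>" "I \<subseteq> \<Omega>" "card I \<ge> 2" "d > 0"
  shows "spectral_bound \<Omega> I (\<lambda>x. a / (real x + real d)) (\<bar>a\<bar> / (real d * (real (card I) - 1)))"
  using assms(2-)
proof (induction "card I" arbitrary: I a d rule: less_induct)
  case less
  have I: "finite I" using assms(1) less.prems finite_subset by blast
  show ?case
  proof (rule spectral_bound_step[OF assms(1)])
    fix i assume i: "i \<in> I"
    let ?n = "real (card I)"
    have card: "card (I - {i}) = card I - 1" using i by simp
    show "spectral_bound \<Omega> (I - {i}) (diff_quot (\<lambda>x. a / (real x + real d))) (\<bar>a\<bar> / (real d * (?n - 1)))"
    proof (cases "card I = 2")
      case True
      then show ?thesis using I card by (intro spectral_bound_small) auto
    next
      case False
      then have n: "card I \<ge> 3" using less.prems by simp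
      have "spectral_bound \<Omega> (I - {i}) (\<lambda>x. (- a / real d) / (real x + real (Suc d)))
          (\<bar>- a / real d\<bar> / (real (Suc d) * (real (card (I - {i})) - 1)))"
        using less i card n by (intro less.hyps) auto
      moreover have "\<bar>- a / real d\<bar> / (real (Suc d) * (real (card (I - {i})) - 1)) \<le> \<bar>a\<bar> / (real d * (?n - 1))"
      proof -
        have "?n - 1 \<le> 2 * (?n - 2)" using n by simp
        also have "\<dots> \<le> real (Suc d) * (?n - 2)" using n less.prems by (intro mult_right_mono) auto
        finally have "real d * (?n - 1) \<le> real d * (real (Suc d) * (?n - 2))"
          by (intro mult_left_mono) auto
        then have "\<bar>a\<bar> / (real d * (real (Suc d) * (?n - 2))) \<le> \<bar>a\<bar> / (real d * (?n - 1))"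
          using n less.prems by (intro divide_left_mono) auto
        moreover have "real (card (I - {i})) - 1 = ?n - 2" using card n by simp
        ultimately show ?thesis by (simp only: abs_divide abs_minus_cancel abs_of_nat divide_divide_eq_left)
      qed
      ultimately show ?thesis
        unfolding diff_quot_inverse_shift[OF less.prems(3)] by (rule spectral_bound_mono)
    qed
  qed (use less.prems I in \<open>auto intro!: std_eigenvalue_inverse_shift\<close>)
qed

abbreviation fixing :: "nat \<Rightarrow> nat \<Rightarrow> real" where
  "fixing k x \<equiv> of_bool (x = k)"

lemma diff_quot_fixing_0: "diff_quot (fixing 0) = (\<lambda>x. (- 1) / (real x + real 1))"
  by (simp add: diff_quot_def fun_eq_iff add.commute)

lemma diff_quot_fixing_Suc: "diff_quot (fixing (Suc k)) = (\<lambda>x. 1 / real (Suc k) * fixing k x)"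
  by (auto simp: diff_quot_def fun_eq_iff)

lemma std_eigenvalue_fixing:
  "std_eigenvalue I (fixing k) = expect I (fixing k) * ((real k - 1) / (real (card I) - 1))"
proof -
  have "(\<lambda>x. fixing k x * (real x - 1)) = (\<lambda>x. (real k - 1) * fixing k x)" by auto
  then show ?thesis by (simp only: std_eigenvalue_def expect_scale) simp
qed

text \<open>
  The recursion for rencontres numbers, divided by the number of all permutations.
\<close>

lemma expect_fixing_Suc:
  assumes "finite I" "i \<in> I"
  shows "expect I (fixing (Suc k)) = 1 / real (Suc k) * expect (I - {i}) (fixing k)"
proof -
  have "expect (I - {j}) (fixing k) = expect (I - {i}) (fixing k)" if "j \<in> I" for j
    using assms that by (intro expect_card_cong) auto
  then have "(\<Sum>j\<in>I. expect (I - {j}) (fixing k)) = card I * expect (I - {i}) (fixing k)"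
    by simp
  moreover have "I \<noteq> {}" using assms by auto
  ultimately show ?thesis
    using assms expect_step[of I "fixing (Suc k)"]
    by (simp add: diff_quot_fixing_Suc expect_divide card_gt_0_iff flip: sum_divide_distrib)
qed

text \<open>
  The truncated inclusion-exclusion sums, whose sign relative to the indicator of \<open>x = 0\<close> alternates (Bonferroni).
\<close>

lemma alternating_binomial_sum:
  "(\<Sum>j\<le>J. (-1) ^ j * real (x choose j)) = (if x = 0 then 1 else (-1) ^ J * real ((x - 1) choose J))"
proof (cases x)
  case 0
  then show ?thesis by (induction J) auto
next
  case (Suc y)
  then show ?thesis by (induction J) (auto simp: algebra_simps)
qed

lemma expect_sum: "expect I (\<lambda>x. \<Sum>j\<in>J. f j x) = (\<Sum>j\<in>J. expect I (f j))"
  unfolding expect_eq by (subst sum.swap) (simp add: sum_divide_distrib)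

lemma expect_alternating:
  assumes "finite I"
  shows "expect I (\<lambda>x. \<Sum>j\<le>J. (-1) ^ j * real (x choose j))
       = (\<Sum>j\<le>J. (-1) ^ j * (if j \<le> card I then 1 / fact j else 0))"
  by (simp only: expect_sum expect_scale expect_binomial[OF assms])

lemma expect_fixing_0_lower:
  assumes "finite I" "odd J"
  shows "expect I (fixing 0) \<ge> (\<Sum>j\<le>J. (-1) ^ j * (if j \<le> card I then 1 / fact j else 0))"
  unfolding expect_alternating[OF assms(1), symmetric]
  by (rule expect_mono) (use assms(2) in \<open>auto simp: alternating_binomial_sum\<close>)

lemma expect_fixing_0_upper:
  assumes "finite I" "even J"
  shows "expect I (fixing 0) \<le> (\<Sum>j\<le>J. (-1) ^ j * (if j \<le> card I then 1 / fact j else 0))"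
  unfolding expect_alternating[OF assms(1), symmetric]
  by (rule expect_mono) (use assms(2) in \<open>auto simp: alternating_binomial_sum\<close>)

lemma expect_fixing_0_ge_third:
  assumes "finite I" "card I \<ge> 2"
  shows "expect I (fixing 0) \<ge> 1 / 3"
proof -
  have "1 / 3 \<le> (\<Sum>j\<le>3. (-1) ^ j * (if j \<le> card I then 1 / fact j else 0) :: real)"
    using assms(2) by (simp add: numeral_eq_Suc)
  also have "\<dots> \<le> expect I (fixing 0)"
    by (rule expect_fixing_0_lower[OF assms(1)]) simp
  finally show ?thesis .
qed

text \<open>
  The sums of order five and four are \<open>1/2 - 1/6 + 1/24 - 1/120 = 11/30\<close> and \<open>3/8\<close>; for four points the last term of
  the first one is absent.
\<close>

lemma expect_fixing_0_bounds:
  assumes "finite I" "card I \<ge> 4"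
  shows "11 / 30 \<le> expect I (fixing 0)" "expect I (fixing 0) \<le> 3 / 8"
proof -
  have "11 / 30 \<le> (\<Sum>j\<le>5. (-1) ^ j * (if j \<le> card I then 1 / fact j else 0) :: real)"
    using assms(2) by (simp add: numeral_eq_Suc)
  also have "\<dots> \<le> expect I (fixing 0)"
    by (rule expect_fixing_0_lower[OF assms(1)]) simp
  finally show "11 / 30 \<le> expect I (fixing 0)" .
  have "expect I (fixing 0) \<le> (\<Sum>j\<le>4. (-1) ^ j * (if j \<le> card I then 1 / fact j else 0))"
    by (rule expect_fixing_0_upper[OF assms(1)]) simp
  also have "\<dots> \<le> 3 / 8"
    using assms(2) by (simp add: numeral_eq_Suc)
  finally show "expect I (fixing 0) \<le> 3 / 8" .
qed

lemma expect_fixing_pos: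
  assumes "finite I" "card I = m + k" "m \<ge> 2"
  shows "expect I (fixing k) > 0"
  using assms
proof (induction k arbitrary: I)
  case 0
  then show ?case using expect_fixing_0_ge_third[of I] by simp
next
  case (Suc k)
  then obtain i where "i \<in> I" by (metis add_Suc_right card.empty ex_in_conv nat.simps(3))
  then show ?case using Suc by (simp add: expect_fixing_Suc)
qed

text \<open>
  Four levels of the recursion, with the weights \<open>[x = 0]\<close>, \<open>- 1 / (x + 1)\<close>, \<open>1 / (x + 2)\<close> and \<open>- (1/2) / (x + 3)\<close>. The standard
  eigenvalues at the first and the third level are not positive, at the second it is at most \<open>(1/3) / (m - 2)\<close> for \<open>m = |I|\<close>, and
  the last level is covered by the bound for \<open>a / (x + d)\<close>, which is \<open>(1/6) / (m - 4)\<close> on the remaining \<open>m - 3\<close> points. The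
  common bound \<open>1 / (3 (m - 3))\<close> is at least as large as both and still works for \<open>m = 4\<close>, where the recursion ends at one point.
\<close>

lemma spectral_bound_derangements:
  assumes \<Omega>: "finite \<Omega>" and "I \<subseteq> \<Omega>" and m: "card I \<ge> 4"
  shows "spectral_bound \<Omega> I (fixing 0) (1 / (3 * (real (card I) - 3)))"
proof -
  define m where "m = card I"
  define c where "c = 1 / (3 * (real m - 3))"
  have m4: "m \<ge> 4" and c: "c > 0" using m by (simp_all add: m_def c_def)
  have fin: "finite J" if "J \<subseteq> \<Omega>" for J using that \<Omega> finite_subset by blast
  \<comment> \<open>For \<open>m = 4\<close> one point is left, and the general bound would have denominator \<open>0\<close>.\<close>
  have level3: "spectral_bound \<Omega> J (\<lambda>x. (- 1 / 2) / (real x + real 3)) c"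
    if J: "J \<subseteq> \<Omega>" "card J = m - 3" for J
  proof (cases "m = 4")
    case True
    then show ?thesis using J fin by (intro spectral_bound_small) auto
  next
    case False
    have "spectral_bound \<Omega> J (\<lambda>x. (- 1 / 2) / (real x + real 3))
        (\<bar>- 1 / 2\<bar> / (real 3 * (real (card J) - 1)))"
      using J m4 False by (intro spectral_bound_inverse_shift[OF \<Omega>]) auto
    moreover have "\<bar>- 1 / 2\<bar> / (real 3 * (real (card J) - 1)) \<le> c"
      using J m4 False by (simp add: c_def field_simps of_nat_diff)
    ultimately show ?thesis by (rule spectral_bound_mono)
  qed
  have level2: "spectral_bound \<Omega> J (\<lambda>x. 1 / (real x + real 2)) c"
    if J: "J \<subseteq> \<Omega>" "card J = m - 2" for J
  proof (rule spectral_bound_step[OF \<Omega> J(1)])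
    \<comment> \<open>The concave function \<open>(x - 1) / (x + 2)\<close> lies below its tangent at the mean \<open>1\<close>.\<close>
    have "expect J (\<lambda>x. 1 / (real x + real 2) * (real x - 1)) \<le> expect J (\<lambda>x. (real x - 1) / 3)"
    proof (rule expect_mono)
      fix x :: nat
      show "1 / (real x + real 2) * (real x - 1) \<le> (real x - 1) / 3"
        using zero_le_square[of "real x - 1"] by (simp add: field_simps)
    qed
    also have "\<dots> = 0"
    proof -
      have "J \<noteq> {}" using J m4 by auto
      then show ?thesis using J fin by (simp add: expect_divide expect_diff expect_const expect_linear)
    qed
    finally have "expect J (\<lambda>x. 1 / (real x + real 2) * (real x - 1)) \<le> 0" .
    moreover have "real (card J) - 1 > 0" using J m4 by simp
    ultimately have "std_eigenvalue J (\<lambda>x. 1 / (real x + real 2)) \<le> 0"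
      unfolding std_eigenvalue_def by (rule divide_nonpos_pos)
    then show "std_eigenvalue J (\<lambda>x. 1 / (real x + real 2)) \<le> c" using c by linarith
    show "spectral_bound \<Omega> (J - {j}) (diff_quot (\<lambda>x. 1 / (real x + real 2))) c" if "j \<in> J" for j
    proof -
      have "J - {j} \<subseteq> \<Omega>" "card (J - {j}) = m - 3" using J that by auto
      then show ?thesis using level3 diff_quot_inverse_shift[of 2 1] by simp
    qed
  qed (use J m4 in auto)
  have level1: "spectral_bound \<Omega> J (\<lambda>x. (- 1) / (real x + real 1)) c"
    if J: "J \<subseteq> \<Omega>" "card J = m - 1" for J
  proof (rule spectral_bound_step[OF \<Omega> J(1)])
    \<comment> \<open>A quadratic majorant with equality at \<open>x = 0, 1, 2\<close>; only its first two factorial moments enter.\<close>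
    have "- 1 / (real x + real 1) * (real x - 1) \<le> 1 - real x + real x * (real x - 1) / 3" for x :: nat
    proof -
      have "x = 0 \<or> x = 1 \<or> x \<ge> 2" by auto
      then have "0 \<le> (real x - 1) * (real x * (real x - 2))" by auto
      then show ?thesis by (simp add: field_simps power2_eq_square)
    qed
    then have "expect J (\<lambda>x. - 1 / (real x + real 1) * (real x - 1))
        \<le> expect J (\<lambda>x. 1 - real x + real x * (real x - 1) / 3)"
      by (rule expect_mono)
    also have "\<dots> = 1 / 3"
    proof -
      have *: "finite J" "J \<noteq> {}" "card J \<ge> 2" using J m4 fin by auto
      show ?thesis
        by (simp only: expect_add expect_diff expect_divide expect_const[OF *(1)]
            expect_linear[OF *(1,2)] expect_falling_two[OF *(1,3)])
    qed
    finally have E: "expect J (\<lambda>x. - 1 / (real x + real 1) * (real x - 1)) \<le> 1 / 3" .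
    have card: "real (card J) - 1 = real m - 2" using J m4 by simp
    have "std_eigenvalue J (\<lambda>x. (- 1) / (real x + real 1)) \<le> 1 / 3 / (real m - 2)"
      unfolding std_eigenvalue_def card using E m4 by (intro divide_right_mono) auto
    also have "\<dots> \<le> c" using m4 by (simp add: c_def field_simps)
    finally show "std_eigenvalue J (\<lambda>x. (- 1) / (real x + real 1)) \<le> c" .
    show "spectral_bound \<Omega> (J - {j}) (diff_quot (\<lambda>x. (- 1) / (real x + real 1))) c" if "j \<in> J" for j
    proof -
      have "J - {j} \<subseteq> \<Omega>" "card (J - {j}) = m - 2" using J that by auto
      then show ?thesis using level2 diff_quot_inverse_shift[of 1 "-1"] by simp
    qed
  qed (use J m4 in auto)
  have "spectral_bound \<Omega> I (fixing 0) c"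
  proof (rule spectral_bound_step[OF \<Omega> assms(2)])
    have "expect I (fixing 0) \<ge> 0" using expect_mono[of "\<lambda>_. 0" "fixing 0" I] by (simp add: expect_eq)
    then have "std_eigenvalue I (fixing 0) \<le> 0"
      using m by (simp add: std_eigenvalue_fixing divide_nonneg_pos)
    then show "std_eigenvalue I (fixing 0) \<le> c" using c by linarith
    show "spectral_bound \<Omega> (I - {i}) (diff_quot (fixing 0)) c" if "i \<in> I" for i
      unfolding diff_quot_fixing_0 using level1[of "I - {i}"] assms(2) that by (auto simp: m_def)
  qed (use m in auto)
  then show ?thesis by (simp add: c_def m_def)
qed

text \<open>
  Fixed points are removed one at a time until only derangements of \<open>m\<close> points are left. The bound is measured relative to the
  proportion of permutations with \<open>k\<close> fixed points, which is the eigenvalue of the constant function; both are divided by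
  \<open>k + 1\<close> in the step. Relative to this proportion,
  the standard eigenvalues met on the way are smaller than the first one.
\<close>

lemma spectral_bound_fixing:
  assumes \<Omega>: "finite \<Omega>" and m: "m \<ge> 2"
    and base: "\<And>J. J \<subseteq> \<Omega> \<Longrightarrow> card J = m \<Longrightarrow> spectral_bound \<Omega> J (fixing 0) (expect J (fixing 0) * \<beta>)"
    and "I \<subseteq> \<Omega>" "card I = m + k" "(real k - 1) / (real (m + k) - 1) \<le> \<beta>"
  shows "spectral_bound \<Omega> I (fixing k) (expect I (fixing k) * \<beta>)"
  using assms(4-)
proof (induction k arbitrary: I)
  case 0
  then show ?case using base by simp
next
  case (Suc k)
  have I: "finite I" using Suc \<Omega> finite_subset by blast
  have "expect I (fixing (Suc k)) \<ge> 0"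
    using expect_fixing_pos[OF I Suc.prems(2) m] by simp
  then have "std_eigenvalue I (fixing (Suc k)) \<le> expect I (fixing (Suc k)) * \<beta>"
    unfolding std_eigenvalue_fixing using Suc.prems by (intro mult_left_mono) auto
  moreover have "spectral_bound \<Omega> (I - {i}) (diff_quot (fixing (Suc k))) (expect I (fixing (Suc k)) * \<beta>)"
    if i: "i \<in> I" for i
  proof -
    have "(real k - 1) / (real (m + k) - 1) \<le> (real (Suc k) - 1) / (real (m + Suc k) - 1)"
      using m by (simp add: field_simps)
    then have "spectral_bound \<Omega> (I - {i}) (fixing k) (expect (I - {i}) (fixing k) * \<beta>)"
      using Suc i by (intro Suc.IH) auto
    from spectral_bound_scale[OF this, of "1 / real (Suc k)"] show ?thesis
      by (simp only: diff_quot_fixing_Suc expect_fixing_Suc[OF I i]) (simp add: mult.assoc)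
  qed
  ultimately show ?case
    using Suc.prems m by - (rule spectral_bound_step[OF \<Omega> Suc.prems(1)], auto)
qed

section \<open>Three moved points and the sign character\<close>

text \<open>
  Multiplication by the sign. It is cut off outside the permutations of \<open>\<Omega>\<close>, where the sign need not be multiplicative.
\<close>

definition twist :: "'i set \<Rightarrow> (('i \<Rightarrow> 'i) \<Rightarrow> 'a::real_vector) \<Rightarrow> ('i \<Rightarrow> 'i) \<Rightarrow> 'a" where
  "twist \<Omega> f \<sigma> = (if \<sigma> permutes \<Omega> then of_int (sign \<sigma>) *\<^sub>R f \<sigma> else 0)"

text \<open>
  The version of the spectral bound in which the sign component is removed as well as the trivial one.
\<close>

definition even_spectral_bound :: "'i set \<Rightarrow> 'i set \<Rightarrow> (nat \<Rightarrow> real) \<Rightarrow> real \<Rightarrow> bool" where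
  "even_spectral_bound \<Omega> I w c \<longleftrightarrow>
     (\<forall>f :: ('i \<Rightarrow> 'i) \<Rightarrow> complex. (\<forall>\<sigma>. avg I f \<sigma> = 0) \<longrightarrow> (\<forall>\<sigma>. avg I (twist \<Omega> f) \<sigma> = 0) \<longrightarrow>
        inner_on \<Omega> (weighted_avg I w f) f \<le> c * inner_on \<Omega> f f)"

lemma permutes_compose_iff:
  assumes "s permutes \<Omega>"
  shows "\<sigma> \<circ> s permutes \<Omega> \<longleftrightarrow> \<sigma> permutes \<Omega>"
proof
  assume "\<sigma> \<circ> s permutes \<Omega>"
  then have "(\<sigma> \<circ> s) \<circ> inv' s permutes \<Omega>" by (rule permutes_compose[OF permutes_inv[OF assms]])
  moreover have "(\<sigma> \<circ> s) \<circ> inv' s = \<sigma>" by (simp only: comp_assoc permutes_inv_o(1)[OF assms] comp_id)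
  ultimately show "\<sigma> permutes \<Omega>" by simp
qed (use assms in \<open>auto intro: permutes_compose\<close>)

lemma twist_compose:
  assumes "finite \<Omega>" "s permutes \<Omega>"
  shows "twist \<Omega> f (\<sigma> \<circ> s) = of_int (sign s) *\<^sub>R twist \<Omega> (\<lambda>\<rho>. f (\<rho> \<circ> s)) \<sigma>"
proof (cases "\<sigma> permutes \<Omega>")
  case True
  then have "sign (\<sigma> \<circ> s) = sign \<sigma> * sign s"
    using assms permutation_permutes by (intro sign_compose) blast+
  then show ?thesis using True assms by (simp add: twist_def permutes_compose_iff mult.commute)
qed (use assms in \<open>simp add: twist_def permutes_compose_iff\<close>)

lemma twist_scale: "twist \<Omega> (\<lambda>\<sigma>. c *\<^sub>R f \<sigma>) \<sigma> = c *\<^sub>R twist \<Omega> f \<sigma>"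
  by (simp add: twist_def mult.commute)

lemma twist_sum: "twist \<Omega> (\<lambda>\<sigma>. \<Sum>i\<in>A. f i \<sigma>) \<sigma> = (\<Sum>i\<in>A. twist \<Omega> (f i) \<sigma>)"
  by (simp add: twist_def scaleR_sum_right)

lemma twist_twist: "twist \<Omega> (twist \<Omega> f) \<sigma> = (if \<sigma> permutes \<Omega> then f \<sigma> else 0)"
  by (simp add: twist_def sign_def)

lemma inner_on_twist: "inner_on \<Omega> (twist \<Omega> f) g = inner_on \<Omega> f (twist \<Omega> g)"
  by (simp add: inner_on_def twist_def)

text \<open>
  A weight that lives on even permutations does not see the sign, so the spectrum is invariant under the twist.
\<close>

lemma weighted_avg_twist:
  assumes "finite \<Omega>" "I \<subseteq> \<Omega>"
    and even: "\<And>s. s permutes I \<Longrightarrow> w (num_fixed I s) \<noteq> 0 \<Longrightarrow> sign s = 1"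
  shows "weighted_avg I w (twist \<Omega> h) \<sigma> = twist \<Omega> (weighted_avg I w h) \<sigma>"
proof -
  have "w (num_fixed I s) *\<^sub>R twist \<Omega> h (\<sigma> \<circ> s) = twist \<Omega> (\<lambda>\<sigma>. w (num_fixed I s) *\<^sub>R h (\<sigma> \<circ> s)) \<sigma>"
    if "s permutes I" for s
    using that assms permutes_subset[OF that assms(2)] even[OF that]
    by (cases "w (num_fixed I s) = 0") (simp_all add: twist_compose twist_scale twist_def[of \<Omega> "\<lambda>_. 0"])
  then have "weighted_avg I w (twist \<Omega> h) \<sigma>
      = (\<Sum>s | s permutes I. twist \<Omega> (\<lambda>\<sigma>. w (num_fixed I s) *\<^sub>R h (\<sigma> \<circ> s)) \<sigma>) /\<^sub>R fact (card I)"
    by (simp add: weighted_avg_def)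
  also have "\<dots> = twist \<Omega> (weighted_avg I w h) \<sigma>"
    unfolding weighted_avg_def twist_scale twist_sum ..
  finally show ?thesis .
qed

text \<open>
  The twisted function changes sign under right translation by an odd permutation that leaves the original one invariant.
\<close>

lemma avg_twist_zero:
  assumes "finite \<Omega>" "J \<subseteq> \<Omega>" "t permutes J" "sign t = - 1" "\<And>\<sigma>. h (\<sigma> \<circ> t) = h \<sigma>"
  shows "avg J (twist \<Omega> h) \<sigma> = 0"
proof -
  have t: "t permutes \<Omega>" using assms permutes_subset by blast
  have h: "(\<lambda>\<rho>. h (\<rho> \<circ> t)) = h" using assms(5) by auto
  let ?S = "\<Sum>s | s permutes J. twist \<Omega> h (\<sigma> \<circ> s)"
  have "?S = (\<Sum>s | s permutes J. twist \<Omega> h (\<sigma> \<circ> (s \<circ> t)))"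
    by (rule sum_permutes_compose_right[OF assms(3), symmetric])
  also have "\<dots> = (\<Sum>s | s permutes J. - twist \<Omega> h (\<sigma> \<circ> s))"
    using twist_compose[OF assms(1) t, of h] assms(4) by (simp add: o_assoc h)
  also have "\<dots> = - ?S" by (rule sum_negf)
  finally have "2 *\<^sub>R ?S = 0" unfolding scaleR_2 by (metis add.left_inverse)
  then show ?thesis by (simp add: weighted_avg_def)
qed

text \<open>
  With at least four points there is a transposition that fixes both \<open>i\<close> and \<open>l\<close>. Consequently the point parts of a function and of
  its twist do not interfere.
\<close>

lemma avg_twist_avg_point:
  assumes "finite \<Omega>" "I \<subseteq> \<Omega>" "card I \<ge> 4" "i \<in> I" "l \<in> I"
  shows "avg (I - {l}) (twist \<Omega> (avg (I - {i}) f)) \<sigma> = 0"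
proof -
  have "card (I - {i, l}) \<ge> 2"
    using assms card_Diff_subset[of "{i, l}" I] card_insert_le_m1[of 2 "{l}" i] by auto
  then obtain a b where ab: "a \<in> I - {i, l}" "b \<in> I - {i, l}" "a \<noteq> b"
    by (metis card_2_iff' card_le_Suc0_iff_eq not_less_eq_eq numeral_2_eq_2 card.infinite le_zero_eq nat.simps(3))
  have "transpose a b permutes I - {i}" "transpose a b permutes I - {l}"
    using ab by (auto intro!: permutes_swap_id)
  then show ?thesis
    using assms ab by (intro avg_twist_zero[of \<Omega> _ "transpose a b"]) (auto simp: avg_invariant sign_swap_id)
qed

text \<open>
  As in \<open>spectral_bound_step\<close>, but two copies of the standard component are split off, one of them twisted by the sign. The operator
  has the same eigenvalue on both because it commutes with the twist, and the rest is again killed by all point averages,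
  before and after twisting.
\<close>

lemma even_spectral_bound_step:
  assumes \<Omega>: "finite \<Omega>" and sub: "I \<subseteq> \<Omega>" and card: "card I \<ge> 4"
    and even: "\<And>s. s permutes I \<Longrightarrow> w (num_fixed I s) \<noteq> 0 \<Longrightarrow> sign s = 1"
    and std: "std_eigenvalue I w \<le> c"
    and step: "\<And>i. i \<in> I \<Longrightarrow> even_spectral_bound \<Omega> (I - {i}) (diff_quot w) c"
  shows "even_spectral_bound \<Omega> I w c"
  unfolding even_spectral_bound_def
proof (intro allI impI)
  fix f :: "('a \<Rightarrow> 'a) \<Rightarrow> complex"
  assume "\<forall>\<sigma>. avg I f \<sigma> = 0" "\<forall>\<sigma>. avg I (twist \<Omega> f) \<sigma> = 0"
  then have mz: "\<And>\<sigma>. avg I f \<sigma> = 0" "\<And>\<sigma>. avg I (twist \<Omega> f) \<sigma> = 0" by simp_all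
  have I: "finite I" "I \<noteq> {}" using \<Omega> sub card finite_subset by auto
  have card2: "card I \<ge> 2" using card by simp
  let ?A = "weighted_avg I w"
  define u where "u = point_part I f"
  define v where "v = twist \<Omega> (point_part I (twist \<Omega> f))"
  define r where "r \<sigma> = f \<sigma> - (u \<sigma> + v \<sigma>)" for \<sigma>
  have f: "f = (\<lambda>\<sigma>. (u \<sigma> + v \<sigma>) + r \<sigma>)" by (simp add: r_def)
  have cross: "avg (I - {l}) (twist \<Omega> (point_part I g)) \<sigma> = 0"
    if "l \<in> I" for l \<sigma> and g :: "('a \<Rightarrow> 'a) \<Rightarrow> complex"
  proof -
    have "twist \<Omega> (point_part I g)
        = (\<lambda>\<sigma>. ((real (card I) - 1) / real (card I)) *\<^sub>R (\<Sum>i\<in>I. twist \<Omega> (avg (I - {i}) g) \<sigma>))"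
      unfolding point_part_def[abs_def] by (rule ext) (simp only: twist_scale twist_sum)
    moreover have "avg (I - {l}) (twist \<Omega> (avg (I - {i}) g)) \<sigma> = 0" if "i \<in> I" for i
      using \<Omega> sub card that \<open>l \<in> I\<close> by (rule avg_twist_avg_point)
    ultimately show ?thesis by (simp only: weighted_avg_scale weighted_avg_sum) simp
  qed
  have tv: "twist \<Omega> v = point_part I (twist \<Omega> f)"
  proof
    fix \<sigma>
    have "point_part I (twist \<Omega> f) \<sigma> = 0" if "\<not> \<sigma> permutes \<Omega>"
    proof -
      have "twist \<Omega> f (\<sigma> \<circ> s) = 0" if "s permutes I - {i}" for s i
        using that \<open>\<not> \<sigma> permutes \<Omega>\<close> permutes_compose_iff[OF permutes_subset[OF that, of \<Omega>]] sub
        by (auto simp: twist_def)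
      then show ?thesis by (simp add: point_part_def weighted_avg_def)
    qed
    then show "twist \<Omega> v \<sigma> = point_part I (twist \<Omega> f) \<sigma>" by (simp add: v_def twist_twist)
  qed
  have r_zero: "avg (I - {i}) r = (\<lambda>_. 0)" if "i \<in> I" for i
    using avg_point_point_part[OF \<Omega> sub card2 mz(1) that] cross[OF that]
    by (simp add: r_def[abs_def] weighted_avg_diff weighted_avg_add u_def v_def fun_eq_iff)
  have twist_r: "twist \<Omega> r = (\<lambda>\<sigma>. twist \<Omega> f \<sigma> - twist \<Omega> u \<sigma> - twist \<Omega> v \<sigma>)"
    by (simp add: r_def[abs_def] twist_def fun_eq_iff scaleR_diff_right scaleR_add_right)
  have tr_zero: "avg (I - {i}) (twist \<Omega> r) = (\<lambda>_. 0)" if "i \<in> I" for i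
    using avg_point_point_part[OF \<Omega> sub card2 mz(2) that] cross[OF that]
    unfolding twist_r weighted_avg_diff tv by (simp add: u_def fun_eq_iff)
  have zero_A: "avg (I - {i}) (?A g) \<sigma> = 0"
    if "i \<in> I" "avg (I - {i}) g = (\<lambda>_. 0)" for i \<sigma> and g :: "('a \<Rightarrow> 'a) \<Rightarrow> complex"
    using weighted_avg_commute[OF I(1), of "I - {i}" w "\<lambda>_. 1" g \<sigma>] that by simp
  have twist_A: "twist \<Omega> (?A g) = ?A (twist \<Omega> g)" for g :: "('a \<Rightarrow> 'a) \<Rightarrow> complex"
    by (rule ext) (rule weighted_avg_twist[OF \<Omega> sub even, symmetric])
  have "inner_on \<Omega> u r = 0" "inner_on \<Omega> u (?A r) = 0"
    unfolding u_def using r_zero zero_A by (intro inner_point_part[OF \<Omega> sub]; simp)+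
  moreover have "inner_on \<Omega> v r = 0" "inner_on \<Omega> v (?A r) = 0"
    unfolding v_def inner_on_twist twist_A using tr_zero zero_A
    by (intro inner_point_part[OF \<Omega> sub]; simp)+
  moreover have "?A (\<lambda>\<sigma>. u \<sigma> + v \<sigma>) \<sigma> = std_eigenvalue I w *\<^sub>R (u \<sigma> + v \<sigma>)" for \<sigma>
  proof -
    have "?A v = twist \<Omega> (?A (point_part I (twist \<Omega> f)))" by (simp add: v_def twist_A)
    also have "?A (point_part I (twist \<Omega> f)) = (\<lambda>\<sigma>. std_eigenvalue I w *\<^sub>R point_part I (twist \<Omega> f) \<sigma>)"
      using weighted_avg_point_part[OF \<Omega> sub card2 mz(2)] by auto
    finally have "?A v \<sigma> = std_eigenvalue I w *\<^sub>R v \<sigma>" by (simp add: twist_scale v_def)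
    moreover have "?A u \<sigma> = std_eigenvalue I w *\<^sub>R u \<sigma>"
      unfolding u_def by (rule weighted_avg_point_part[OF \<Omega> sub card2 mz(1)])
    ultimately show ?thesis by (simp add: weighted_avg_add scaleR_add_right)
  qed
  moreover have "inner_on \<Omega> (?A r) r \<le> c * inner_on \<Omega> r r"
  proof (rule inner_weighted_avg_le_by_points[OF I])
    fix i assume i: "i \<in> I"
    then show "avg (I - {i}) r \<sigma> = 0" for \<sigma> using r_zero by simp
    show "inner_on \<Omega> (weighted_avg (I - {i}) (diff_quot w) r) r \<le> c * inner_on \<Omega> r r"
      using step[OF i] r_zero[OF i] tr_zero[OF i] unfolding even_spectral_bound_def by simp
  qed
  ultimately show "inner_on \<Omega> (?A f) f \<le> c * inner_on \<Omega> f f"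
    unfolding f using std
    by (intro inner_on_orthogonal_sum[where A = ?A and \<tau> = "std_eigenvalue I w"])
      (auto simp: inner_on_add_left inner_on_add_right inner_on_commute[of _ "?A r"]
        inner_on_commute[of _ "?A r"] weighted_avg_add)
qed

text \<open>
  A permutation of three points without fixed points is a cycle; on the other hand a point of order two would leave
  the third point fixed.
\<close>

lemma three_cycle_cubed:
  assumes "card K = 3" "s permutes K" "\<And>x. x \<in> K \<Longrightarrow> s x \<noteq> x"
  shows "s (s (s x)) = x"
proof (cases "x \<in> K")
  case False
  then show ?thesis using assms(2) by (simp add: permutes_not_in)
next
  case True
  have K: "s y \<in> K" if "y \<in> K" for y using that assms(2) permutes_in_image by metis
  have inj: "s y \<noteq> s z" if "y \<noteq> z" for y z using permutes_inj[OF assms(2)] that by (metis injD)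
  have "card {x, s x} = 2" using assms(3)[OF True] by auto
  then have "\<not> K \<subseteq> {x, s x}" using assms(1) card_mono[of "{x, s x}" K] by auto
  then obtain y where y: "y \<in> K" "y \<noteq> x" "y \<noteq> s x" by auto
  have Keq: "K = {x, s x, y}"
    using assms(1) True K y assms(3)[OF True]
    by (intro card_subset_eq[symmetric]) (auto intro: card_ge_0_finite)
  have "s (s x) \<noteq> x"
  proof
    assume "s (s x) = x"
    then have "s y \<noteq> x" "s y \<noteq> s x" "s y \<noteq> y" using inj y assms(3) by metis+
    then show False using K[OF y(1)] Keq by auto
  qed
  moreover have "s (s (s x)) \<in> K" "s (s (s x)) \<noteq> s (s x)" "s (s x) \<in> K" "s (s x) \<noteq> s x" using K True assms(3) by auto
  ultimately show ?thesis using inj Keq by (metis insertE singletonD)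
qed

text \<open>
  Its cube is the identity, so the cube of its sign is \<open>1\<close>.
\<close>

lemma sign_moving_three:
  assumes "finite I" "s permutes I" "card I = k + 3" "num_fixed I s = k"
  shows "sign s = 1"
proof -
  define K where "K = {i \<in> I. s i \<noteq> i}"
  have "I = {i \<in> I. s i = i} \<union> K" "{i \<in> I. s i = i} \<inter> K = {}" by (auto simp: K_def)
  then have "card I = num_fixed I s + card K"
    unfolding num_fixed_def using assms(1) by (metis card_Un_disjoint finite_Un)
  then have "card K = 3" using assms by simp
  moreover have "s permutes K"
    by (rule permutes_superset[OF assms(2)]) (auto simp: K_def)
  ultimately have "s (s (s x)) = x" for x by (rule three_cycle_cubed) (auto simp: K_def)
  then have "s \<circ> s \<circ> s = id" by (auto simp: fun_eq_iff)
  moreover have "permutation s" using assms permutation_permutes by blast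
  ultimately have "sign s * sign s * sign s = 1"
    by (metis permutation_compose sign_compose sign_id)
  then show ?thesis by (auto simp: sign_def split: if_splits)
qed

text \<open>
  The even permutations of three points are the identity and the two derangements.
\<close>

lemma sign_permutes_three:
  assumes "card J = 3" "s permutes J"
  shows "(1 + real_of_int (sign s)) / 2 = of_bool (s = id) + fixing 0 (num_fixed J s)"
proof (cases "num_fixed J s = 0")
  case True
  have "sign s = 1" using assms True by (intro sign_moving_three[of J s 0]) (auto intro: card_ge_0_finite)
  moreover have "s \<noteq> id" using True assms by (auto simp: num_fixed_def)
  ultimately show ?thesis using True by simp
next
  case False
  then obtain a where a: "a \<in> J" "s a = a" by (auto simp: num_fixed_def card_eq_0_iff)
  have fin: "finite J" using assms by (auto intro: card_ge_0_finite)
  have "s permutes J - {a}" using permutes_fixing_iff[OF a(1)] assms(2) a(2) by blast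
  moreover have "card (J - {a}) = 2" using assms a by simp
  then obtain b c where bc: "J - {a} = {b, c}" "b \<noteq> c" by (auto simp: card_2_iff)
  ultimately have s: "s permutes {b, c}" by simp
  show ?thesis
  proof (cases "s = id")
    case True
    then show ?thesis using False by simp
  next
    case ne: False
    have "s = transpose b c"
    proof
      fix x
      have "s b \<in> {b, c}" "s c \<in> {b, c}" "s b \<noteq> s c"
        using permutes_in_image[OF s] permutes_inj[OF s] bc(2) by (auto dest: injD)
      moreover have "s b \<noteq> b"
      proof
        assume "s b = b"
        then have "s y = y" for y using calculation permutes_not_in[OF s, of y] by (cases "y \<in> {b, c}") auto
        then show False using ne by auto
      qed
      ultimately show "s x = transpose b c x"
        using permutes_not_in[OF s, of x] by (auto simp: transpose_def)
    qed
    then show ?thesis using ne False bc by (simp add: sign_swap_id)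
  qed
qed

text \<open>
  On three points the trivial and the sign averages add up to the average over the even permutations, that is, over the identity
  and the derangements. If both vanish, the sum over the derangements is \<open>- f\<close>.
\<close>

lemma even_spectral_bound_three:
  assumes \<Omega>: "finite \<Omega>" and J: "J \<subseteq> \<Omega>" "card J = 3"
  shows "even_spectral_bound \<Omega> J (fixing 0) (- 1 / 6)"
  unfolding even_spectral_bound_def
proof (intro allI impI)
  fix f :: "('a \<Rightarrow> 'a) \<Rightarrow> complex"
  assume mz: "\<forall>\<sigma>. avg J f \<sigma> = 0" "\<forall>\<sigma>. avg J (twist \<Omega> f) \<sigma> = 0"
  have fin: "finite J" using J \<Omega> finite_subset by blast
  have "weighted_avg J (fixing 0) f \<sigma> = (- 1 / 6) *\<^sub>R f \<sigma>" if \<sigma>: "\<sigma> permutes \<Omega>" for \<sigma>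
  proof -
    have f6: "fact (card J) = (6 :: real)" using J by (simp add: fact_numeral)
    have plain: "(\<Sum>s | s permutes J. f (\<sigma> \<circ> s)) = 0"
      using mz(1) by (simp add: weighted_avg_def)
    have "(\<Sum>s | s permutes J. twist \<Omega> f (\<sigma> \<circ> s))
        = of_int (sign \<sigma>) *\<^sub>R (\<Sum>s | s permutes J. of_int (sign s) *\<^sub>R f (\<sigma> \<circ> s))"
    proof -
      have "twist \<Omega> g \<sigma> = of_int (sign \<sigma>) *\<^sub>R g \<sigma>" for g :: "('a \<Rightarrow> 'a) \<Rightarrow> complex"
        using \<sigma> by (simp add: twist_def)
      then show ?thesis
        unfolding scaleR_sum_right using twist_compose[OF \<Omega> permutes_subset[OF _ J(1)], of _ f \<sigma>]
        by (intro sum.cong refl) (simp add: mult.commute)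
    qed
    then have signed: "(\<Sum>s | s permutes J. real_of_int (sign s) *\<^sub>R f (\<sigma> \<circ> s)) = 0"
      using mz(2) by (simp add: weighted_avg_def sign_def split: if_splits)
    have "(\<Sum>s | s permutes J. (of_bool (s = id) + fixing 0 (num_fixed J s)) *\<^sub>R f (\<sigma> \<circ> s))
        = (\<Sum>s | s permutes J. ((1 + real_of_int (sign s)) / 2) *\<^sub>R f (\<sigma> \<circ> s))"
      using sign_permutes_three[OF J(2)] by (intro sum.cong refl) simp
    also have "\<dots> = (1 / 2) *\<^sub>R ((\<Sum>s | s permutes J. f (\<sigma> \<circ> s))
        + (\<Sum>s | s permutes J. real_of_int (sign s) *\<^sub>R f (\<sigma> \<circ> s)))"
      unfolding scaleR_sum_right sum.distrib[symmetric]
      by (intro sum.cong refl) (simp add: scaleR_add_left scaleR_add_right add_divide_distrib)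
    finally have "(\<Sum>s | s permutes J. of_bool (s = id) *\<^sub>R f (\<sigma> \<circ> s))
        + (\<Sum>s | s permutes J. fixing 0 (num_fixed J s) *\<^sub>R f (\<sigma> \<circ> s)) = 0"
      by (simp only: scaleR_add_left sum.distrib plain signed) simp
    moreover have "(\<Sum>s | s permutes J. of_bool (s = id) *\<^sub>R f (\<sigma> \<circ> s))
        = (\<Sum>s | s permutes J. if s = id then f \<sigma> else 0)"
      by (intro sum.cong) auto
    then have "(\<Sum>s | s permutes J. of_bool (s = id) *\<^sub>R f (\<sigma> \<circ> s)) = f \<sigma>"
      using fin by (simp add: finite_permutations permutes_id)
    ultimately have "(\<Sum>s | s permutes J. fixing 0 (num_fixed J s) *\<^sub>R f (\<sigma> \<circ> s)) = - f \<sigma>"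
      by (simp add: add_eq_0_iff)
    then show ?thesis by (simp add: weighted_avg_def f6)
  qed
  then have "inner_on \<Omega> (weighted_avg J (fixing 0) f) f = inner_on \<Omega> (\<lambda>\<sigma>. (- 1 / 6) *\<^sub>R f \<sigma>) f"
    unfolding inner_on_def by (intro sum.cong refl) simp
  then show "inner_on \<Omega> (weighted_avg J (fixing 0) f) f \<le> - 1 / 6 * inner_on \<Omega> f f"
    unfolding inner_on_scale_left by simp
qed

text \<open>
  The same descent as in \<open>spectral_bound_fixing\<close>, ending at three points, where the derangement operator is \<open>- 1 / 6\<close>
  while the proportion of derangements is \<open>1 / 3\<close>; the ratio \<open>- 1 / 2\<close> is \<open>(k - 1) / (k + 2)\<close> for \<open>k = 0\<close>.
\<close>

lemma even_spectral_bound_fixing: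
  assumes \<Omega>: "finite \<Omega>" and "I \<subseteq> \<Omega>" "card I = 3 + k" "(real k - 1) / (real k + 2) \<le> \<beta>"
  shows "even_spectral_bound \<Omega> I (fixing k) (expect I (fixing k) * \<beta>)"
  using assms(2-)
proof (induction k arbitrary: I)
  case 0
  then have I: "finite I" using \<Omega> finite_subset by blast
  have "- 1 / 6 \<le> expect I (fixing 0) * \<beta>"
  proof -
    have "expect I (fixing 0) \<le> (\<Sum>j\<le>4. (-1) ^ j * (if j \<le> card I then 1 / fact j else 0))"
      by (rule expect_fixing_0_upper[OF I]) simp
    also have "\<dots> = 1 / 3" using 0(2) by (simp add: numeral_eq_Suc)
    finally have third: "expect I (fixing 0) = 1 / 3"
      using expect_fixing_0_ge_third[OF I] 0(2) by simp
    show ?thesis unfolding third using 0(3) by simp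
  qed
  note ratio = this
  show ?case
    unfolding even_spectral_bound_def
  proof (intro allI impI)
    fix f :: "('a \<Rightarrow> 'a) \<Rightarrow> complex"
    assume "\<forall>\<sigma>. avg I f \<sigma> = 0" "\<forall>\<sigma>. avg I (twist \<Omega> f) \<sigma> = 0"
    then have "inner_on \<Omega> (weighted_avg I (fixing 0) f) f \<le> - 1 / 6 * inner_on \<Omega> f f"
      using even_spectral_bound_three[OF \<Omega> 0(1)] 0(2) unfolding even_spectral_bound_def by simp
    also have "\<dots> \<le> expect I (fixing 0) * \<beta> * inner_on \<Omega> f f"
      using ratio inner_on_self_nonneg by (rule mult_right_mono)
    finally show "inner_on \<Omega> (weighted_avg I (fixing 0) f) f \<le> expect I (fixing 0) * \<beta> * inner_on \<Omega> f f" .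
  qed
next
  case (Suc k)
  have I: "finite I" using Suc \<Omega> finite_subset by blast
  have "expect I (fixing (Suc k)) \<ge> 0"
    using expect_fixing_pos[OF I Suc.prems(2)] by simp
  then have "std_eigenvalue I (fixing (Suc k)) \<le> expect I (fixing (Suc k)) * \<beta>"
    unfolding std_eigenvalue_fixing using Suc.prems by (intro mult_left_mono) (auto simp: add.commute)
  moreover have "even_spectral_bound \<Omega> (I - {i}) (diff_quot (fixing (Suc k))) (expect I (fixing (Suc k)) * \<beta>)"
    if i: "i \<in> I" for i
  proof -
    have "(real k - 1) / (real k + 2) \<le> (real (Suc k) - 1) / (real (Suc k) + 2)"
      by (simp add: field_simps)
    then have "even_spectral_bound \<Omega> (I - {i}) (fixing k) (expect (I - {i}) (fixing k) * \<beta>)"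
      using Suc i by (intro Suc.IH) auto
    moreover have "weighted_avg (I - {i}) (\<lambda>x. 1 / real (Suc k) * fixing k x) f
        = (\<lambda>\<sigma>. (1 / real (Suc k)) *\<^sub>R weighted_avg (I - {i}) (fixing k) f \<sigma>)"
      for f :: "('a \<Rightarrow> 'a) \<Rightarrow> complex"
      by (simp only: fun_eq_iff weighted_avg_scale_weight) simp
    ultimately show ?thesis
      unfolding even_spectral_bound_def diff_quot_fixing_Suc expect_fixing_Suc[OF I i]
      by (simp add: inner_on_scale_left mult.assoc mult_left_mono divide_right_mono)
  qed
  ultimately show ?case
    using Suc.prems sign_moving_three[OF I]
    by - (rule even_spectral_bound_step[OF \<Omega> Suc.prems(1)], auto)
qed

section \<open>Eigenvalues of Hermitian matrices\<close>

definition hermitian :: "complex mat \<Rightarrow> bool" where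
  "hermitian A \<longleftrightarrow> (\<forall>i < dim_row A. \<forall>j < dim_row A. A $$ (i, j) = cnj (A $$ (j, i)))"

lemma cscalar_prod_sum: "v \<in> carrier_vec n \<Longrightarrow> w \<in> carrier_vec n \<Longrightarrow> v \<bullet>c w = (\<Sum>i<n. v $ i * cnj (w $ i))"
  for v w :: "complex vec"
  by (simp add: scalar_prod_def atLeast0LessThan)

lemma mult_mat_vec_index:
  assumes "A \<in> carrier_mat n n" "v \<in> carrier_vec n" "i < n"
  shows "(A *\<^sub>v v) $ i = (\<Sum>j<n. A $$ (i, j) * v $ j)"
  using assms by (simp add: scalar_prod_def atLeast0LessThan)

lemma hermitian_cscalar_prod:
  assumes A: "A \<in> carrier_mat n n" "hermitian A" and v: "v \<in> carrier_vec n" and w: "w \<in> carrier_vec n"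
  shows "(A *\<^sub>v v) \<bullet>c w = v \<bullet>c (A *\<^sub>v w)"
proof -
  have A_cnj: "cnj (A $$ (i, j)) = A $$ (j, i)" if "i < n" "j < n" for i j
    using A that unfolding hermitian_def by (metis carrier_matD(1))
  have "(A *\<^sub>v v) \<bullet>c w = (\<Sum>i<n. \<Sum>j<n. A $$ (i, j) * v $ j * cnj (w $ i))"
    using A v w by (subst cscalar_prod_sum[of _ n])
      (auto simp: mult_mat_vec_index[OF A(1) v] sum_distrib_right simp del: index_mult_mat_vec)
  also have "\<dots> = (\<Sum>j<n. \<Sum>i<n. A $$ (i, j) * v $ j * cnj (w $ i))" by (rule sum.swap)
  also have "\<dots> = v \<bullet>c (A *\<^sub>v w)"
    using A v w by (subst cscalar_prod_sum[of _ n]) 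
      (auto simp: mult_mat_vec_index[OF A(1) w] sum_distrib_left A_cnj simp del: index_mult_mat_vec intro!: sum.cong)
  finally show ?thesis .
qed

lemma hermitian_eigenvalue_real:
  assumes A: "A \<in> carrier_mat n n" "hermitian A" and k: "eigenvalue A k"
  shows "k = complex_of_real (Re k)"
proof -
  obtain v where v: "v \<in> carrier_vec n" "v \<noteq> 0\<^sub>v n" "A *\<^sub>v v = k \<cdot>\<^sub>v v"
    using k A unfolding eigenvalue_def eigenvector_def by auto
  have "v \<bullet>c (k \<cdot>\<^sub>v v) = cnj k * (v \<bullet>c v)" using v(1) by (simp add: conjugate_smult_vec)
  then have "k * (v \<bullet>c v) = cnj k * (v \<bullet>c v)"
    using hermitian_cscalar_prod[OF A v(1) v(1)] v by simp
  moreover have "v \<bullet>c v \<noteq> 0" using v conjugate_square_eq_0_vec by blast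
  ultimately have "k = cnj k" by simp
  then show ?thesis by (simp add: complex_eq_iff)
qed

lemma hermitian_char_matrix:
  assumes "A \<in> carrier_mat n n" "hermitian A"
  shows "hermitian (char_matrix A (complex_of_real \<theta>))"
  unfolding hermitian_def
proof (intro allI impI)
  fix i j assume "i < dim_row (char_matrix A (complex_of_real \<theta>))" "j < dim_row (char_matrix A (complex_of_real \<theta>))"
  then have ij: "i < n" "j < n" using assms by (auto simp: char_matrix_def)
  then have "cnj (A $$ (j, i)) = A $$ (i, j)"
    using assms unfolding hermitian_def by (metis carrier_matD(1))
  then show "char_matrix A (complex_of_real \<theta>) $$ (i, j) = cnj (char_matrix A (complex_of_real \<theta>) $$ (j, i))"
    using ij assms(1) by (simp add: char_matrix_def)
qed

lemma hermitian_kernel_square: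
  assumes M: "M \<in> carrier_mat n n" "hermitian M"
  shows "mat_kernel (M * M) = mat_kernel M"
proof
  show "mat_kernel M \<subseteq> mat_kernel (M * M)" by (rule mat_kernel_mult_subset[OF M(1) M(1)])
  show "mat_kernel (M * M) \<subseteq> mat_kernel M"
  proof
    fix v assume "v \<in> mat_kernel (M * M)"
    then have v: "v \<in> carrier_vec n" "(M * M) *\<^sub>v v = 0\<^sub>v n"
      using mat_kernelD[of "M * M" n n] M by auto
    then have "M *\<^sub>v (M *\<^sub>v v) = 0\<^sub>v n" using M by simp
    moreover have "(M *\<^sub>v (M *\<^sub>v v)) \<bullet>c v = (M *\<^sub>v v) \<bullet>c (M *\<^sub>v v)"
      using M v by (intro hermitian_cscalar_prod) auto
    ultimately have "(M *\<^sub>v v) \<bullet>c (M *\<^sub>v v) = 0" using v by simp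
    then have "M *\<^sub>v v = 0\<^sub>v n" using M v conjugate_square_eq_0_vec mult_mat_vec_carrier by blast
    then show "v \<in> mat_kernel M" using M v by (intro mat_kernelI)
  qed
qed

text \<open>
  Algebraic and geometric multiplicity agree. Since \<open>M\<close> and \<open>M\<^sup>2\<close> have the same kernel for the Hermitian matrix
  \<open>M = A - \<theta>\<close>, all Jordan blocks for \<open>\<theta>\<close> have size one: the kernel dimensions are \<open>\<Sum> min 1 b\<close> and \<open>\<Sum> min 2 b\<close> over the block sizes \<open>b\<close>.
\<close>

lemma hermitian_order_char_poly:
  assumes A: "A \<in> carrier_mat n n" "hermitian A"
  shows "Polynomial.order (complex_of_real \<theta>) (char_poly A) = kernel_dim (char_matrix A (complex_of_real \<theta>))"
proof -
  let ?k = "complex_of_real \<theta>"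
  let ?M = "char_matrix A ?k"
  have M: "?M \<in> carrier_mat n n" "hermitian ?M" using A by (auto intro: hermitian_char_matrix)
  obtain as where "char_poly A = (\<Prod>a\<leftarrow>as. [:- a, 1:])"
    using char_poly_factorized[OF A(1)] by blast
  then obtain n_as where jnf: "jordan_nf A n_as"
    using jordan_nf_iff_linear_factorization[OF A(1)] by blast
  define ns where "ns = map fst (filter (\<lambda>(n, e). e = ?k) n_as)"
  have pos: "x > 0" if x: "x \<in> set ns" for x
  proof -
    obtain e where "(x, e) \<in> set n_as" using x by (auto simp: ns_def)
    then show ?thesis using jnf by (force simp: jordan_nf_def)
  qed
  have dim1: "sum_list (map (min 1) ns) = kernel_dim ?M"
    using dim_gen_eigenspace[OF jnf, of ?k 1] M by (simp add: dim_gen_eigenspace_def ns_def)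
  have dim2: "sum_list (map (min 2) ns) = kernel_dim (?M * ?M)"
    using dim_gen_eigenspace[OF jnf, of ?k 2] M by (simp add: dim_gen_eigenspace_def ns_def numeral_2_eq_2)
  have "kernel_dim (?M * ?M) = kernel_dim ?M"
    using M by (simp add: kernel_dim_def hermitian_kernel_square)
  then have eq: "sum_list (map (min 1) ns) = sum_list (map (min 2) ns)" using dim1 dim2 by simp
  have one: "x = 1" if "x \<in> set ns" for x
  proof -
    have "sum_list (map (min 1) xs) < sum_list (map (min 2) xs)" if "y \<in> set xs" "y \<ge> 2" for y :: nat and xs
      using that
    proof (induction xs)
      case (Cons z xs)
      have le: "sum_list (map (min 1) xs) \<le> sum_list (map (min 2) xs)"
        by (rule sum_list_mono) auto
      show ?case
      proof (cases "z = y")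
        case True
        then have "min 1 z < min 2 z" using Cons by simp
        then show ?thesis using le by (simp only: list.map sum_list.Cons add_less_le_mono)
      next
        case False
        then have "sum_list (map (min 1) xs) < sum_list (map (min 2) xs)" using Cons by simp
        moreover have "min 1 z \<le> min 2 z" by simp
        ultimately show ?thesis by (simp only: list.map sum_list.Cons add_le_less_mono)
      qed
    qed simp
    then have "\<not> x \<ge> 2" using that eq by (metis less_irrefl)
    then show ?thesis using pos[OF that] by simp
  qed
  have "Polynomial.order ?k (char_poly A) = sum_list ns"
    using jordan_nf_order[OF jnf, of ?k] by (simp add: ns_def case_prod_beta')
  also have "\<dots> = sum_list (map (min 1) ns)"
  proof -
    have "map (min 1) ns = ns" using one by (intro map_idI) (metis min.idem)
    then show ?thesis by simp
  qed
  finally show ?thesis using dim1 by simp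
qed

text \<open>
  A maximal orthogonal system in the kernel is a basis of it: independence follows by taking inner products, and subtracting the
  orthogonal projection from a vector of the kernel leaves \<open>0\<close>.
\<close>

lemma kernel_dim_orthogonal:
  fixes M :: "complex mat"
  assumes M: "M \<in> carrier_mat n n" and fin: "finite E" and E: "E \<subseteq> mat_kernel M"
    and orth: "\<And>e e'. e \<in> E \<Longrightarrow> e' \<in> E \<Longrightarrow> e \<noteq> e' \<Longrightarrow> e \<bullet>c e' = 0"
    and nz: "\<And>e. e \<in> E \<Longrightarrow> e \<noteq> 0\<^sub>v n"
    and max: "\<And>v. v \<in> mat_kernel M \<Longrightarrow> (\<And>e. e \<in> E \<Longrightarrow> v \<bullet>c e = 0) \<Longrightarrow> v = 0\<^sub>v n"
  shows "kernel_dim M = card E"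
proof -
  interpret kernel n n M by unfold_locales (rule M)
  have Ec: "E \<subseteq> carrier_vec n" using E mat_kernel_carrier[OF M] by blast
  have prod: "NC.lincomb a E \<bullet>c e = a e * (e \<bullet>c e)" if e: "e \<in> E" for a e
  proof -
    have ec: "e \<in> carrier_vec n" using e Ec by blast
    have "NC.lincomb a E \<bullet>c e = (\<Sum>i<n. (\<Sum>x\<in>E. a x * x $ i) * cnj (e $ i))"
      using Ec ec by (subst cscalar_prod_sum[of _ n]) (auto simp: NC.lincomb_index NC.lincomb_closed fin)
    also have "\<dots> = (\<Sum>x\<in>E. \<Sum>i<n. a x * x $ i * cnj (e $ i))"
      by (subst sum.swap) (simp add: sum_distrib_right)
    also have "\<dots> = (\<Sum>x\<in>E. a x * (x \<bullet>c e))"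
      using Ec ec by (intro sum.cong refl) (subst cscalar_prod_sum[of _ n], auto simp: sum_distrib_left mult.assoc)
    also have "\<dots> = (\<Sum>x\<in>E. if x = e then a e * (e \<bullet>c e) else 0)"
      using orth e by (intro sum.cong refl) auto
    also have "\<dots> = a e * (e \<bullet>c e)" using e fin by simp
    finally show ?thesis .
  qed
  have nz': "e \<bullet>c e \<noteq> 0" if "e \<in> E" for e using nz[OF that] Ec that conjugate_square_eq_0_vec by blast
  have "lin_indpt E"
  proof (rule Ker.finite_lin_indpt2[OF fin E])
    fix a :: "complex vec \<Rightarrow> complex" assume "lincomb a E = 0\<^sub>v n"
    then have "NC.lincomb a E = 0\<^sub>v n" using lincomb_same[OF E] by simp
    then have "a e * (e \<bullet>c e) = 0" if "e \<in> E" for e using prod[OF that, of a] Ec that by auto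
    then show "\<forall>v\<in>E. a v = 0" using nz' by auto
  qed
  moreover have "span E = mat_kernel M"
  proof
    show "span E \<subseteq> mat_kernel M" using Ker.span_is_subset2[OF E] by simp
    show "mat_kernel M \<subseteq> span E"
    proof
      fix v assume v: "v \<in> mat_kernel M"
      then have vc: "v \<in> carrier_vec n" using mat_kernelD(1)[OF M] by blast
      define a where "a e = (v \<bullet>c e) / (e \<bullet>c e)" for e
      define l where "l = lincomb a E"
      have lk: "l \<in> mat_kernel M" unfolding l_def using Ker.lincomb_closed[OF E] by auto
      then have lc: "l \<in> carrier_vec n" using mat_kernelD(1)[OF M] by blast
      have "v - l \<in> mat_kernel M"
        using vc lc mat_kernelD(2)[OF M v] mat_kernelD(2)[OF M lk] M
        by (intro mat_kernelI[OF M]) (auto simp: mult_minus_distrib_mat_vec)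
      moreover have "(v - l) \<bullet>c e = 0" if e: "e \<in> E" for e
      proof -
        have "l \<bullet>c e = a e * (e \<bullet>c e)" unfolding l_def using lincomb_same[OF E] prod[OF e] by simp
        then show ?thesis using nz'[OF e] vc lc e Ec
          by (subst minus_scalar_prod_distrib[of _ n]) (auto simp: a_def)
      qed
      ultimately have "v - l = 0\<^sub>v n" by (rule max)
      have "v = l"
      proof (rule eq_vecI)
        fix i assume "i < dim_vec l"
        moreover from \<open>v - l = 0\<^sub>v n\<close> have "(v - l) $ i = 0\<^sub>v n $ i" by simp
        ultimately show "v $ i = l $ i" using vc lc by simp
      qed (use vc lc in auto)
      then show "v \<in> span E" unfolding l_def using fin
        unfolding Ker.span_def by auto
    qed
  qed
  ultimately have "Ker.basis E" using E by (auto simp: Ker.basis_def)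
  from Ker.dim_basis[OF fin this] show ?thesis using kernel_dim by simp
qed

lemma order_char_poly_orthogonal:
  assumes A: "A \<in> carrier_mat n n" "hermitian A" and fin: "finite E"
    and E: "\<And>e. e \<in> E \<Longrightarrow> e \<in> carrier_vec n \<and> e \<noteq> 0\<^sub>v n \<and> A *\<^sub>v e = complex_of_real \<theta> \<cdot>\<^sub>v e"
    and orth: "\<And>e e'. e \<in> E \<Longrightarrow> e' \<in> E \<Longrightarrow> e \<noteq> e' \<Longrightarrow> e \<bullet>c e' = 0"
    and max: "\<And>v. v \<in> carrier_vec n \<Longrightarrow> A *\<^sub>v v = complex_of_real \<theta> \<cdot>\<^sub>v v \<Longrightarrow>
        (\<And>e. e \<in> E \<Longrightarrow> v \<bullet>c e = 0) \<Longrightarrow> v = 0\<^sub>v n"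
  shows "Polynomial.order (complex_of_real \<theta>) (char_poly A) = card E"
proof -
  let ?M = "char_matrix A (complex_of_real \<theta>)"
  have M: "?M \<in> carrier_mat n n" using A by simp
  have ker: "v \<in> mat_kernel ?M \<longleftrightarrow> A *\<^sub>v v = complex_of_real \<theta> \<cdot>\<^sub>v v" if "v \<in> carrier_vec n" for v
  proof -
    show ?thesis
    proof (cases "v = 0\<^sub>v n")
      case True
      have "B *\<^sub>v 0\<^sub>v n = 0\<^sub>v n" if "B \<in> carrier_mat n n" for B :: "complex mat"
        using that by (intro eq_vecI) auto
      moreover have "complex_of_real \<theta> \<cdot>\<^sub>v 0\<^sub>v n = 0\<^sub>v n" by (intro eq_vecI) auto
      ultimately show ?thesis using A M True by (simp add: mat_kernel[OF M])
    next
      case False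
      then show ?thesis
        using eigenvector_char_matrix[OF A(1), of v "complex_of_real \<theta>"] that A(1)
        by (auto simp: mat_kernel[OF M] eigenvector_def)
    qed
  qed
  have "kernel_dim ?M = card E"
  proof (rule kernel_dim_orthogonal[OF M fin])
    show "E \<subseteq> mat_kernel ?M" using E ker by blast
    show "v = 0\<^sub>v n" if "v \<in> mat_kernel ?M" "\<And>e. e \<in> E \<Longrightarrow> v \<bullet>c e = 0" for v
      using that max ker mat_kernelD(1)[OF M] by blast
  qed (use E orth in auto)
  then show ?thesis using hermitian_order_char_poly[OF A] by simp
qed

text \<open>
  The descending list starts with the \<open>t\<close> copies of the maximum \<open>\<theta>\<close>, so the entry after them is the maximum of the rest.
\<close>

lemma nth_rev_sorted_after_top:
  fixes M :: "real multiset"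
  assumes t: "count M \<theta> = t" and top: "\<And>x. x \<in># M \<Longrightarrow> x \<le> \<theta>" and "t < size M"
  defines "\<mu> \<equiv> rev (sorted_list_of_multiset M) ! t"
  shows "\<mu> \<in># M" "\<mu> < \<theta>" "\<And>x. x \<in># M \<Longrightarrow> x \<noteq> \<theta> \<Longrightarrow> x \<le> \<mu>"
proof -
  define N where "N = filter_mset (\<lambda>x. x \<noteq> \<theta>) M"
  have M: "M = N + replicate_mset t \<theta>"
    using t by (auto simp: multiset_eq_iff N_def)
  have "sorted_list_of_multiset M = sorted_list_of_multiset N @ replicate t \<theta>"
  proof -
    have "sorted (sorted_list_of_multiset N @ replicate t \<theta>)"
      using top by (auto simp: sorted_append M)
    moreover have "mset (sorted_list_of_multiset N @ replicate t \<theta>) = M" by (simp add: M)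
    ultimately show ?thesis by (metis sorted_list_of_multiset_mset sorted_sort_id)
  qed
  moreover define l where "l = sorted_list_of_multiset N"
  ultimately have rev: "rev (sorted_list_of_multiset M) = replicate t \<theta> @ rev l" by simp
  have setl: "set l = set_mset N" by (simp add: l_def)
  have "size M = size N + t" by (simp add: M)
  then have ne: "l \<noteq> []" using assms(3) by (auto simp: l_def dest: arg_cong[of _ _ mset])
  have \<mu>: "\<mu> = last l" unfolding \<mu>_def rev using ne by (simp add: nth_append hd_rev flip: hd_conv_nth)
  then have in_N: "\<mu> \<in># N" using ne setl last_in_set by metis
  then show "\<mu> \<in># M" by (simp add: M)
  show "\<mu> < \<theta>" using in_N top by (force simp: N_def)
  show "x \<le> \<mu>" if "x \<in># M" "x \<noteq> \<theta>" for x
  proof -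
    have "x \<in> set l" using that by (simp add: setl N_def)
    then obtain i where "i < length l" "x = l ! i" by (metis in_set_conv_nth)
    moreover have "sorted l" by (simp add: l_def)
    ultimately show ?thesis
      unfolding \<mu> last_conv_nth[OF ne] by (auto intro: sorted_nth_mono)
  qed
qed

lemma count_image_inj: "inj f \<Longrightarrow> count (image_mset f M) (f x) = count M x"
  by (induction M) (auto simp: inj_eq)

lemma char_poly_nonzero: "A \<in> carrier_mat n n \<Longrightarrow> char_poly A \<noteq> 0"
  using degree_monic_char_poly[of A n] by auto

lemma lambda_after_top:
  assumes A: "A \<in> carrier_mat n n" "hermitian A"
    and t: "Polynomial.order (complex_of_real \<theta>) (char_poly A) = t" "t < n"
    and top: "\<And>k. eigenvalue A k \<Longrightarrow> Re k \<le> \<theta>"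
  shows "eigenvalue A (complex_of_real (lambda (t + 1) A))" "lambda (t + 1) A < \<theta>"
    and "\<And>k. eigenvalue A k \<Longrightarrow> k \<noteq> complex_of_real \<theta> \<Longrightarrow> Re k \<le> lambda (t + 1) A"
proof -
  let ?P = "proots (char_poly A)"
  have cp: "char_poly A \<noteq> 0" using A char_poly_nonzero by blast
  have ev: "k \<in># ?P \<longleftrightarrow> eigenvalue A k" for k
    using eigenvalue_root_char_poly[OF A(1)] cp by simp
  have real: "k = complex_of_real (Re k)" if "k \<in># ?P" for k
    using that hermitian_eigenvalue_real[OF A] ev by blast
  define M where "M = image_mset Re ?P"
  have "image_mset complex_of_real M = ?P"
    unfolding M_def using real by (simp add: multiset.map_comp comp_def cong: image_mset_cong)
  then have "count M \<theta> = count ?P (complex_of_real \<theta>)"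
    by (metis count_image_inj inj_of_real)
  then have c: "count M \<theta> = t" using t cp by simp
  have "size M = n"
    using degree_monic_char_poly[OF A(1)] by (simp add: M_def size_proots_complex)
  then have sz: "t < size M" using t by simp
  have le: "x \<le> \<theta>" if "x \<in># M" for x using that top ev by (auto simp: M_def)
  have \<mu>: "rev (sorted_list_of_multiset M) ! t = lambda (t + 1) A"
    by (simp add: lambda_def eigenvalue_list_def M_def)
  note * = nth_rev_sorted_after_top[OF c le sz, unfolded \<mu>]
  from *(1) obtain k where "k \<in># ?P" "lambda (t + 1) A = Re k" by (auto simp: M_def)
  then show "eigenvalue A (complex_of_real (lambda (t + 1) A))" using real ev by metis
  show "lambda (t + 1) A < \<theta>" by (rule *(2))
  show "Re k \<le> lambda (t + 1) A" if "eigenvalue A k" "k \<noteq> complex_of_real \<theta>" for k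
  proof (rule *(3))
    show "Re k \<in># M" using that ev by (auto simp: M_def)
    show "Re k \<noteq> \<theta>" using real[of k] that ev by auto
  qed
qed

definition mat_trace :: "'a::comm_ring_1 mat \<Rightarrow> 'a" where
  "mat_trace M = (\<Sum>i<dim_row M. M $$ (i, i))"

lemma mat_trace_mult:
  assumes "X \<in> carrier_mat n n" "Y \<in> carrier_mat n n"
  shows "mat_trace (X * Y) = (\<Sum>i<n. \<Sum>j<n. X $$ (i, j) * Y $$ (j, i))"
  using assms by (simp add: mat_trace_def scalar_prod_def atLeast0LessThan)

lemma mat_trace_commute:
  assumes "X \<in> carrier_mat n n" "Y \<in> carrier_mat n n"
  shows "mat_trace (X * Y) = mat_trace (Y * X)"
  unfolding mat_trace_mult[OF assms] mat_trace_mult[OF assms(2,1)]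
  by (subst sum.swap) (simp add: mult.commute)

lemma mat_trace_similar:
  assumes A: "A \<in> carrier_mat n n" and "similar_mat_wit A B P Q"
  shows "mat_trace A = mat_trace B"
proof -
  note * = similar_mat_witD2[OF assms]
  have "mat_trace A = mat_trace (P * (B * Q))" using * by (simp add: assoc_mult_mat[of _ n n _ n _ n])
  also have "\<dots> = mat_trace ((B * Q) * P)" using * by (intro mat_trace_commute[of _ n]) auto
  also have "(B * Q) * P = B" using * by (simp add: assoc_mult_mat[of _ n n _ n _ n])
  finally show ?thesis .
qed

text \<open>
  Both are read off a triangular matrix similar to \<open>A\<close>, whose diagonal consists of the eigenvalues with multiplicity.
\<close>

lemma trace_eq_sum_proots:
  fixes A :: "complex mat"
  assumes A: "A \<in> carrier_mat n n"
  shows "mat_trace A = (\<Sum>x\<in>#proots (char_poly A). x)"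
    and "mat_trace (A * A) = (\<Sum>x\<in>#proots (char_poly A). x\<^sup>2)"
proof -
  obtain es where es: "char_poly A = (\<Prod>a\<leftarrow>es. [:- a, 1:])"
    using char_poly_factorized[OF A] by blast
  define B where "B = schur_upper_triangular A es"
  have B: "B \<in> carrier_mat n n" "upper_triangular B" "similar_mat A B"
    unfolding B_def using schur_upper_triangular[OF A es] by auto
  then obtain P Q where wit: "similar_mat_wit A B P Q" unfolding similar_mat_def by blast
  have zero: "B $$ (i, j) = 0" if "i < n" "j < i" for i j
    using B that unfolding upper_triangular_def by auto
  have "char_poly A = (\<Prod>a\<leftarrow>diag_mat B. [:- a, 1:])"
    using char_poly_similar[OF B(3)] char_poly_upper_triangular[OF B(1,2)] by simp
  moreover have "proots (\<Prod>a\<leftarrow>as. [:- a, 1:]) = mset as" for as :: "complex list"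
    by (induction as) (simp_all add: proots_mult prod_list_zero_iff image_iff del: mult_pCons_left)
  ultimately have "proots (char_poly A) = mset (diag_mat B)" by simp
  then have roots: "proots (char_poly A) = mset (map (\<lambda>i. B $$ (i, i)) [0..<n])"
    using B(1) by (simp add: diag_mat_def)
  have sum: "(\<Sum>x\<in>#proots (char_poly A). f x) = (\<Sum>i<n. f (B $$ (i, i)))" for f :: "complex \<Rightarrow> complex"
    unfolding roots by (simp add: comp_def sum_mset_sum_list interv_sum_list_conv_sum_set_nat atLeast0LessThan flip: mset_map)
  show "mat_trace A = (\<Sum>x\<in>#proots (char_poly A). x)"
    unfolding mat_trace_similar[OF A wit] sum using B by (simp add: mat_trace_def)
  have "A * A = A ^\<^sub>m 2" "B * B = B ^\<^sub>m 2" using A B by (simp_all add: numeral_2_eq_2)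
  then have "mat_trace (A * A) = mat_trace (B * B)"
    using mat_trace_similar[OF _ similar_mat_wit_pow[OF wit, of 2], of n] A by simp
  also have "\<dots> = (\<Sum>i<n. \<Sum>j<n. B $$ (i, j) * B $$ (j, i))" by (rule mat_trace_mult[OF B(1) B(1)])
  also have "\<dots> = (\<Sum>i<n. \<Sum>j<n. if j = i then (B $$ (i, i))\<^sup>2 else 0)"
    using zero by (intro sum.cong refl) (auto simp: power2_eq_square not_less_iff_gr_or_eq, metis nat_neq_iff)
  also have "\<dots> = (\<Sum>i<n. (B $$ (i, i))\<^sup>2)" by simp
  finally show "mat_trace (A * A) = (\<Sum>x\<in>#proots (char_poly A). x\<^sup>2)" unfolding sum .
qed

section \<open>The adjacency operator on functions\<close>

definition perms :: "nat \<Rightarrow> (nat \<Rightarrow> nat) set" where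
  "perms n = {\<sigma>. \<sigma> permutes {1..n}}"

definition vec_of :: "nat \<Rightarrow> ((nat \<Rightarrow> nat) \<Rightarrow> complex) \<Rightarrow> complex vec" where
  "vec_of n f = vec (fact n) (\<lambda>i. f (from_nat_into (perms n) i))"

text \<open>
  The value \<open>0\<close> outside the group makes all averages of such a function at other arguments vanish, so that statements about
  averages need no restriction to the group.
\<close>

definition fun_of :: "nat \<Rightarrow> complex vec \<Rightarrow> (nat \<Rightarrow> nat) \<Rightarrow> complex" where
  "fun_of n x \<sigma> = (if \<sigma> \<in> perms n then x $ inv_into {..<fact n} (from_nat_into (perms n)) \<sigma> else 0)"

lemma finite_perms [simp]: "finite (perms n)"
  by (simp add: perms_def finite_permutations)

lemma card_perms: "card (perms n) = fact n"
  by (simp add: perms_def card_permutations)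

lemma carrier_sym_group: "carrier (sym_group n) = perms n"
  by (simp add: perms_def sym_group_def)

lemma bij_enum: "bij_betw (from_nat_into (perms n)) {..<fact n} (perms n)"
  using bij_betw_from_nat_into_finite[OF finite_perms] by (simp add: card_perms)

lemma enum_in: "i < fact n \<Longrightarrow> from_nat_into (perms n) i \<in> perms n"
  using bij_enum bij_betwE by blast

lemma sum_enum: "(\<Sum>i<fact n. F (from_nat_into (perms n) i)) = (\<Sum>\<sigma>\<in>perms n. F \<sigma>)"
  by (rule sum.reindex_bij_betw[OF bij_enum])

lemma vec_of_carrier [simp]: "vec_of n f \<in> carrier_vec (fact n)"
  by (simp add: vec_of_def)

lemma vec_of_eq_iff: "vec_of n f = vec_of n g \<longleftrightarrow> (\<forall>\<sigma>\<in>perms n. f \<sigma> = g \<sigma>)"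
proof
  assume eq: "vec_of n f = vec_of n g"
  show "\<forall>\<sigma>\<in>perms n. f \<sigma> = g \<sigma>"
  proof
    fix \<sigma> assume "\<sigma> \<in> perms n"
    then obtain i where "i < fact n" "\<sigma> = from_nat_into (perms n) i"
      using bij_enum[of n] by (auto simp: bij_betw_def)
    then show "f \<sigma> = g \<sigma>" using arg_cong[OF eq, of "\<lambda>v. v $ i"] by (simp add: vec_of_def)
  qed
qed (auto simp: vec_of_def enum_in intro!: eq_vecI)

lemma vec_of_fun_of: "x \<in> carrier_vec (fact n) \<Longrightarrow> vec_of n (fun_of n x) = x"
  by (intro eq_vecI)
    (auto simp: vec_of_def fun_of_def enum_in inv_into_f_f[OF bij_betw_imp_inj_on[OF bij_enum]])

lemma vec_of_eq_zero_iff: "vec_of n f = 0\<^sub>v (fact n) \<longleftrightarrow> (\<forall>\<sigma>\<in>perms n. f \<sigma> = 0)"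
proof -
  have "0\<^sub>v (fact n) = vec_of n (\<lambda>_. 0)" by (auto simp: vec_of_def)
  then show ?thesis by (simp add: vec_of_eq_iff)
qed

lemma vec_of_smult: "k \<cdot>\<^sub>v vec_of n f = vec_of n (\<lambda>\<sigma>. k * f \<sigma>)"
  by (auto simp: vec_of_def)

lemma vec_of_cscalar: "vec_of n f \<bullet>c vec_of n g = (\<Sum>\<sigma>\<in>perms n. f \<sigma> * cnj (g \<sigma>))"
  by (subst cscalar_prod_sum[of _ "fact n"]) (auto simp: vec_of_def sum_enum[of "\<lambda>\<sigma>. f \<sigma> * cnj (g \<sigma>)"])

abbreviation adj :: "nat \<Rightarrow> nat \<Rightarrow> complex mat" where
  "adj n k \<equiv> adjacency_matrix (cayley_graph (sym_group n) (point_fixing_set n k))"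

lemma point_fixing_set_iff: "s \<in> point_fixing_set n k \<longleftrightarrow> s \<in> perms n \<and> num_fixed {1..n} s = k"
  by (simp add: point_fixing_set_def carrier_sym_group num_fixed_def fixed_points_def)

lemma adj_carrier [simp]: "adj n k \<in> carrier_mat (fact n) (fact n)"
  by (simp add: adjacency_matrix_def cayley_graph_def carrier_sym_group card_perms Let_def)

lemma adj_dim [simp]: "dim_row (adj n k) = fact n" "dim_col (adj n k) = fact n"
  using adj_carrier[of n k] by blast+

text \<open>
  An unordered pair is an edge in either direction because the connection set is closed under inverses.
\<close>

lemma adj_index:
  assumes ij: "i < fact n" "j < fact n"
  defines "\<sigma> \<equiv> from_nat_into (perms n) i" and "\<tau> \<equiv> from_nat_into (perms n) j"
  shows "adj n k $$ (i, j) = of_bool (inv' \<sigma> \<circ> \<tau> \<in> point_fixing_set n k)"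
proof -
  let ?S = "point_fixing_set n k"
  have \<sigma>: "\<sigma> \<in> perms n" and \<tau>: "\<tau> \<in> perms n" using ij enum_in by (auto simp: \<sigma>_def \<tau>_def)
  have "{\<sigma>, \<tau>} \<in> {{g, g \<circ> s} |g s. g \<in> perms n \<and> s \<in> ?S} \<longleftrightarrow> inv' \<sigma> \<circ> \<tau> \<in> ?S"
  proof
    assume "{\<sigma>, \<tau>} \<in> {{g, g \<circ> s} |g s. g \<in> perms n \<and> s \<in> ?S}"
    then obtain g s where gs: "g permutes {1..n}" "s \<in> ?S" "{\<sigma>, \<tau>} = {g, g \<circ> s}" by (auto simp: perms_def)
    have s: "s permutes {1..n}" using gs by (simp add: point_fixing_set_iff perms_def)
    have "inv' s \<in> ?S" using gs(2) s num_fixed_inv[OF s] by (simp add: point_fixing_set_iff perms_def permutes_inv)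
    moreover have "inv' g \<circ> (g \<circ> s) = s" "inv' (g \<circ> s) \<circ> g = inv' s"
      using permutes_inv_o(2)[OF gs(1)] permutes_inv_o[OF s]
      by (simp_all add: o_assoc o_inv_distrib permutes_bij[OF gs(1)] permutes_bij[OF s])
        (simp_all add: comp_assoc)
    ultimately show "inv' \<sigma> \<circ> \<tau> \<in> ?S" using gs(2,3) by (auto simp: doubleton_eq_iff)
  next
    assume "inv' \<sigma> \<circ> \<tau> \<in> ?S"
    moreover have "\<sigma> \<circ> (inv' \<sigma> \<circ> \<tau>) = \<tau>"
      using \<sigma> by (simp add: o_assoc perms_def permutes_inv_o)
    ultimately show "{\<sigma>, \<tau>} \<in> {{g, g \<circ> s} |g s. g \<in> perms n \<and> s \<in> ?S}"
      using \<sigma> by (intro CollectI exI[of _ \<sigma>] exI[of _ "inv' \<sigma> \<circ> \<tau>"]) simp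
  qed
  then show ?thesis
    using ij by (simp add: adjacency_matrix_def cayley_graph_def carrier_sym_group card_perms
        sym_group_mult Let_def \<sigma>_def \<tau>_def)
qed

lemma inverse_point_fixing: "s \<in> point_fixing_set n k \<Longrightarrow> inv' s \<in> point_fixing_set n k"
  by (simp add: point_fixing_set_iff perms_def permutes_inv num_fixed_inv)

lemma hermitian_adj: "hermitian (adj n k)"
  unfolding hermitian_def
proof (intro allI impI)
  fix i j assume "i < dim_row (adj n k)" "j < dim_row (adj n k)"
  then have ij: "i < fact n" "j < fact n" using adj_carrier[of n k] by auto
  have "inv' \<tau> \<circ> \<sigma> \<in> point_fixing_set n k" if "inv' \<sigma> \<circ> \<tau> \<in> point_fixing_set n k"
    "\<sigma> \<in> perms n" "\<tau> \<in> perms n" for \<sigma> \<tau>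
  proof -
    have b: "bij \<sigma>" "bij \<tau>" using that by (auto simp: perms_def permutes_bij)
    have "inv' (inv' \<sigma> \<circ> \<tau>) = inv' \<tau> \<circ> \<sigma>"
      using o_inv_distrib[OF bij_imp_bij_inv[OF b(1)] b(2)] inv_inv_eq[OF b(1)] by simp
    then show ?thesis using inverse_point_fixing[OF that(1)] by simp
  qed
  then show "adj n k $$ (i, j) = cnj (adj n k $$ (j, i))"
    using ij enum_in by (auto simp: adj_index)
qed

text \<open>
  The neighbours of \<open>\<sigma>\<close> are the products \<open>\<sigma> s\<close>, and substituting \<open>s = \<sigma>\<^sup>-\<^sup>1 \<tau>\<close> turns the row sum into a weighted average.
\<close>

lemma adj_mult_vec_of:
  "adj n k *\<^sub>v vec_of n f = vec_of n (\<lambda>\<sigma>. fact n * weighted_avg {1..n} (fixing k) f \<sigma>)"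
proof (rule eq_vecI)
  fix i assume "i < dim_vec (vec_of n (\<lambda>\<sigma>. fact n * weighted_avg {1..n} (fixing k) f \<sigma>))"
  then have i: "i < fact n" by (simp add: vec_of_def)
  let ?\<sigma> = "from_nat_into (perms n) i"
  have \<sigma>: "?\<sigma> permutes {1..n}" using enum_in[OF i] by (simp add: perms_def)
  have "(adj n k *\<^sub>v vec_of n f) $ i = (\<Sum>j<fact n. adj n k $$ (i, j) * vec_of n f $ j)"
    by (rule mult_mat_vec_index[OF adj_carrier vec_of_carrier i])
  also have "\<dots> = (\<Sum>j<fact n. (\<lambda>\<tau>. of_bool (inv' ?\<sigma> \<circ> \<tau> \<in> point_fixing_set n k) * f \<tau>) (from_nat_into (perms n) j))"
    using i by (intro sum.cong refl) (simp add: adj_index vec_of_def)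
  also have "\<dots> = (\<Sum>\<tau>\<in>perms n. of_bool (inv' ?\<sigma> \<circ> \<tau> \<in> point_fixing_set n k) * f \<tau>)" by (rule sum_enum)
  also have "\<dots> = (\<Sum>s\<in>perms n. of_bool (s \<in> point_fixing_set n k) * f (?\<sigma> \<circ> s))"
  proof -
    have "inv' ?\<sigma> \<circ> (?\<sigma> \<circ> s) = s" for s :: "nat \<Rightarrow> nat" by (simp add: o_assoc permutes_inv_o[OF \<sigma>])
    then show ?thesis
      using sum_permutes_compose_left[OF \<sigma>, of "\<lambda>\<tau>. of_bool (inv' ?\<sigma> \<circ> \<tau> \<in> point_fixing_set n k) * f \<tau>"]
      by (simp add: perms_def)
  qed
  also have "\<dots> = fact n * weighted_avg {1..n} (fixing k) f ?\<sigma>"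
    by (simp add: weighted_avg_def perms_def point_fixing_set_iff scaleR_conv_of_real mult.assoc[symmetric]) 
       (simp add: perms_def of_bool_def if_distrib cong: if_cong)
  finally show "(adj n k *\<^sub>v vec_of n f) $ i = vec_of n (\<lambda>\<sigma>. fact n * weighted_avg {1..n} (fixing k) f \<sigma>) $ i"
    using i by (simp add: vec_of_def)
qed (simp add: vec_of_def)

lemma eigenvalue_adjI:
  assumes "\<sigma>\<^sub>0 \<in> perms n" "f \<sigma>\<^sub>0 \<noteq> 0"
    and "\<And>\<sigma>. \<sigma> \<in> perms n \<Longrightarrow> fact n * weighted_avg {1..n} (fixing k) f \<sigma> = \<kappa> * f \<sigma>"
  shows "eigenvalue (adj n k) \<kappa>"
  unfolding eigenvalue_def eigenvector_def
proof (intro exI conjI)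
  show "vec_of n f \<in> carrier_vec (dim_row (adj n k))" by simp
  show "vec_of n f \<noteq> 0\<^sub>v (dim_row (adj n k))" unfolding adj_dim vec_of_eq_zero_iff using assms(1,2) by blast
  show "adj n k *\<^sub>v vec_of n f = \<kappa> \<cdot>\<^sub>v vec_of n f"
    using assms(3) by (simp add: adj_mult_vec_of vec_of_smult vec_of_eq_iff)
qed

lemma eigenvalue_adjE:
  assumes "eigenvalue (adj n k) \<kappa>"
  obtains f \<sigma>\<^sub>0 where "\<sigma>\<^sub>0 \<in> perms n" "f \<sigma>\<^sub>0 \<noteq> 0" "\<And>\<sigma>. \<sigma> \<notin> perms n \<Longrightarrow> f \<sigma> = 0"
    "\<And>\<sigma>. \<sigma> \<in> perms n \<Longrightarrow> fact n * weighted_avg {1..n} (fixing k) f \<sigma> = \<kappa> * f \<sigma>"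
proof -
  obtain v where v: "v \<in> carrier_vec (fact n)" "v \<noteq> 0\<^sub>v (fact n)" "adj n k *\<^sub>v v = \<kappa> \<cdot>\<^sub>v v"
    using assms unfolding eigenvalue_def eigenvector_def adj_dim by auto
  have "v = vec_of n (fun_of n v)" using vec_of_fun_of[OF v(1)] by simp
  then have "\<exists>\<sigma>\<in>perms n. fun_of n v \<sigma> \<noteq> 0"
    "\<forall>\<sigma>\<in>perms n. fact n * weighted_avg {1..n} (fixing k) (fun_of n v) \<sigma> = \<kappa> * fun_of n v \<sigma>"
    using v(2,3) by (metis vec_of_eq_zero_iff, metis adj_mult_vec_of vec_of_eq_iff vec_of_smult)
  moreover have "fun_of n v \<sigma> = 0" if "\<sigma> \<notin> perms n" for \<sigma> using that by (simp add: fun_of_def)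
  ultimately show ?thesis using that by blast
qed

section \<open>From a spectral gap to the Aldous property\<close>

lemma weighted_avg_invariant_on_support:
  assumes "\<And>s. s permutes I \<Longrightarrow> w (num_fixed I s) \<noteq> 0 \<Longrightarrow> h (\<sigma> \<circ> s) = h \<sigma>"
  shows "weighted_avg I w h \<sigma> = expect I w *\<^sub>R h \<sigma>"
proof -
  have "(\<Sum>s | s permutes I. w (num_fixed I s) *\<^sub>R h (\<sigma> \<circ> s)) = (\<Sum>s | s permutes I. w (num_fixed I s) *\<^sub>R h \<sigma>)"
    using assms by (intro sum.cong refl) (metis mem_Collect_eq scaleR_zero_left)
  then show ?thesis
    by (simp add: weighted_avg_def expect_eq divide_inverse mult.commute flip: scaleR_sum_left)
qed

lemma inner_on_perms: "inner_on {1..n} f g = (\<Sum>\<sigma>\<in>perms n. inner (f \<sigma>) (g \<sigma>))"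
  by (simp add: inner_on_def perms_def)

lemma inner_on_eigen:
  fixes f :: "(nat \<Rightarrow> nat) \<Rightarrow> complex"
  assumes "\<And>\<sigma>. \<sigma> \<in> perms n \<Longrightarrow> weighted_avg {1..n} w f \<sigma> = \<mu> *\<^sub>R f \<sigma>"
  shows "inner_on {1..n} (weighted_avg {1..n} w f) f = \<mu> * inner_on {1..n} f f"
  unfolding inner_on_perms sum_distrib_left using assms by (intro sum.cong) auto

lemma inner_on_eq_zeroD:
  assumes "inner_on {1..n} f f = 0" "\<sigma> \<in> perms n"
  shows "f \<sigma> = 0"
  using assms unfolding inner_on_perms by (simp add: sum_nonneg_eq_0_iff)

text \<open>
  The set \<open>X\<close> contains characters of the symmetric group that are trivial on the connection set: only the trivial one, or also the sign. The assumptions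
  \<open>gap\<close> and \<open>c_less\<close> say that there are no further eigenfunctions for the degree. They are stated for \<open>1 / n!\<close> times the adjacency operator,
  whose eigenvalue for the constant function is \<open>expect {1..n} (fixing k)\<close>.
\<close>

locale point_fixing_gap =
  fixes n k :: nat and X :: "((nat \<Rightarrow> nat) \<Rightarrow> real) set" and c :: real
  assumes finite_X: "finite X"
    and char_id: "\<chi> \<in> X \<Longrightarrow> \<chi> id = 1"
    and char_square: "\<chi> \<in> X \<Longrightarrow> \<sigma> \<in> perms n \<Longrightarrow> \<chi> \<sigma> * \<chi> \<sigma> = 1"
    and char_trivial: "\<chi> \<in> X \<Longrightarrow> \<sigma> \<in> perms n \<Longrightarrow> s \<in> point_fixing_set n k \<Longrightarrow> \<chi> (\<sigma> \<circ> s) = \<chi> \<sigma>"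
    and char_orthogonal: "\<chi> \<in> X \<Longrightarrow> \<psi> \<in> X \<Longrightarrow> \<chi> \<noteq> \<psi> \<Longrightarrow> (\<Sum>\<sigma>\<in>perms n. \<chi> \<sigma> * \<psi> \<sigma>) = 0"
    and gap: "(\<And>\<sigma>. \<sigma> \<notin> perms n \<Longrightarrow> f \<sigma> = 0) \<Longrightarrow>
        (\<And>\<chi>. \<chi> \<in> X \<Longrightarrow> (\<Sum>\<sigma>\<in>perms n. f \<sigma> * complex_of_real (\<chi> \<sigma>)) = 0) \<Longrightarrow>
        inner_on {1..n} (weighted_avg {1..n} (fixing k) f) f \<le> c * inner_on {1..n} f f"
    and c_less: "c < expect {1..n} (fixing k)"
    and card_X: "card X < fact n"
begin

abbreviation valency :: real where "valency \<equiv> fact n * expect {1..n} (fixing k)"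

abbreviation char_vec :: "((nat \<Rightarrow> nat) \<Rightarrow> real) \<Rightarrow> complex vec" where
  "char_vec \<chi> \<equiv> vec_of n (\<lambda>\<sigma>. complex_of_real (\<chi> \<sigma>))"

lemma eigenfunction_le:
  assumes zero: "\<And>\<sigma>. \<sigma> \<notin> perms n \<Longrightarrow> f \<sigma> = 0"
    and orth: "\<And>\<chi>. \<chi> \<in> X \<Longrightarrow> (\<Sum>\<sigma>\<in>perms n. f \<sigma> * complex_of_real (\<chi> \<sigma>)) = 0"
    and eigen: "\<And>\<sigma>. \<sigma> \<in> perms n \<Longrightarrow> weighted_avg {1..n} (fixing k) f \<sigma> = \<mu> *\<^sub>R f \<sigma>"
    and nz: "\<sigma>\<^sub>0 \<in> perms n" "f \<sigma>\<^sub>0 \<noteq> 0"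
  shows "\<mu> \<le> c"
proof -
  have "\<mu> * inner_on {1..n} f f \<le> c * inner_on {1..n} f f"
    using gap[OF zero orth] inner_on_eigen[OF eigen] by simp
  moreover have "inner_on {1..n} f f > 0"
    using inner_on_self_nonneg[of "{1..n}" f] inner_on_eq_zeroD[of n f] nz by fastforce
  ultimately show ?thesis by simp
qed

lemma char_eigenvector:
  assumes "\<chi> \<in> X"
  shows "adj n k *\<^sub>v char_vec \<chi> = complex_of_real valency \<cdot>\<^sub>v char_vec \<chi>"
proof -
  have "weighted_avg {1..n} (fixing k) (\<lambda>\<sigma>. complex_of_real (\<chi> \<sigma>)) \<sigma>
      = expect {1..n} (fixing k) *\<^sub>R complex_of_real (\<chi> \<sigma>)" if "\<sigma> \<in> perms n" for \<sigma>
    using char_trivial[OF assms that]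
    by (intro weighted_avg_invariant_on_support) (auto simp: point_fixing_set_iff perms_def)
  then show ?thesis by (simp add: adj_mult_vec_of vec_of_smult vec_of_eq_iff scaleR_conv_of_real)
qed

lemma char_vec_inner:
  "vec_of n f \<bullet>c char_vec \<chi> = (\<Sum>\<sigma>\<in>perms n. f \<sigma> * complex_of_real (\<chi> \<sigma>))"
  by (simp add: vec_of_cscalar)

text \<open>
  The characters are eigenvectors for the degree, and eigenvectors of a Hermitian matrix for different eigenvalues are
  orthogonal, so the gap applies.
\<close>

lemma eigenvalue_le:
  assumes ev: "eigenvalue (adj n k) \<kappa>" and "\<kappa> \<noteq> complex_of_real valency"
  shows "Re \<kappa> \<le> fact n * c"
proof -
  obtain f \<sigma>\<^sub>0 where f: "\<sigma>\<^sub>0 \<in> perms n" "f \<sigma>\<^sub>0 \<noteq> 0" "\<And>\<sigma>. \<sigma> \<notin> perms n \<Longrightarrow> f \<sigma> = 0"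
    and eigen: "\<And>\<sigma>. \<sigma> \<in> perms n \<Longrightarrow> fact n * weighted_avg {1..n} (fixing k) f \<sigma> = \<kappa> * f \<sigma>"
    using eigenvalue_adjE[OF ev] by metis
  define \<mu> where "\<mu> = Re \<kappa>"
  have \<kappa>: "\<kappa> = complex_of_real \<mu>"
    using hermitian_eigenvalue_real[OF adj_carrier hermitian_adj ev] by (simp add: \<mu>_def)
  have eigenvec: "adj n k *\<^sub>v vec_of n f = \<kappa> \<cdot>\<^sub>v vec_of n f"
    using eigen by (simp add: adj_mult_vec_of vec_of_smult vec_of_eq_iff)
  have "(\<Sum>\<sigma>\<in>perms n. f \<sigma> * complex_of_real (\<chi> \<sigma>)) = 0" if \<chi>: "\<chi> \<in> X" for \<chi>
  proof -
    have "\<kappa> * (vec_of n f \<bullet>c char_vec \<chi>) = complex_of_real valency * (vec_of n f \<bullet>c char_vec \<chi>)"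
      using hermitian_cscalar_prod[OF adj_carrier hermitian_adj vec_of_carrier vec_of_carrier,
          of n k f "\<lambda>\<sigma>. complex_of_real (\<chi> \<sigma>)"]
      unfolding eigenvec char_eigenvector[OF \<chi>]
      by (simp add: vec_of_smult vec_of_cscalar sum_distrib_left mult.assoc mult.left_commute)
    then show ?thesis using assms(2) by (simp add: char_vec_inner)
  qed
  moreover have "weighted_avg {1..n} (fixing k) f \<sigma> = (\<mu> / fact n) *\<^sub>R f \<sigma>" if "\<sigma> \<in> perms n" for \<sigma>
    using eigen[OF that] \<kappa> by (simp add: scaleR_conv_of_real field_simps)
  ultimately have "\<mu> / fact n \<le> c" using f by (intro eigenfunction_le[of f]) auto
  then show ?thesis by (simp add: \<mu>_def field_simps)
qed

lemma order_degree: "Polynomial.order (complex_of_real valency) (char_poly (adj n k)) = card X"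
proof -
  have self: "char_vec \<chi> \<bullet>c char_vec \<chi> = fact n" if "\<chi> \<in> X" for \<chi>
    using char_square[OF that] by (simp add: char_vec_inner card_perms flip: of_real_mult)
  have orth: "char_vec \<chi> \<bullet>c char_vec \<psi> = 0" if "\<chi> \<in> X" "\<psi> \<in> X" "\<chi> \<noteq> \<psi>" for \<chi> \<psi>
    using char_orthogonal[OF that] by (simp add: char_vec_inner flip: of_real_mult of_real_sum)
  have "inj_on char_vec X"
    using self orth by (intro inj_onI) (metis fact_nonzero)
  then have "card (char_vec ` X) = card X" by (rule card_image)
  moreover have "Polynomial.order (complex_of_real valency) (char_poly (adj n k)) = card (char_vec ` X)"
  proof (rule order_char_poly_orthogonal[OF adj_carrier hermitian_adj])
    show "finite (char_vec ` X)" using finite_X by simp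
    show "e \<in> carrier_vec (fact n) \<and> e \<noteq> 0\<^sub>v (fact n) \<and> adj n k *\<^sub>v e = complex_of_real valency \<cdot>\<^sub>v e"
      if e: "e \<in> char_vec ` X" for e
    proof -
      obtain \<chi> where \<chi>: "\<chi> \<in> X" "e = char_vec \<chi>" using e by blast
      have "e \<bullet>c e \<noteq> 0" using self[OF \<chi>(1)] \<chi>(2) by simp
      then have "e \<noteq> 0\<^sub>v (fact n)" by auto
      then show ?thesis using \<chi> char_eigenvector by simp
    qed
    show "e \<bullet>c e' = 0" if "e \<in> char_vec ` X" "e' \<in> char_vec ` X" "e \<noteq> e'" for e e'
      using that orth by blast
    show "v = 0\<^sub>v (fact n)"
      if v: "v \<in> carrier_vec (fact n)" "adj n k *\<^sub>v v = complex_of_real valency \<cdot>\<^sub>v v"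
        "\<And>e. e \<in> char_vec ` X \<Longrightarrow> v \<bullet>c e = 0" for v
    proof (rule ccontr)
      assume nz: "v \<noteq> 0\<^sub>v (fact n)"
      define f where "f = fun_of n v"
      have vf: "v = vec_of n f" using v(1) by (simp add: f_def vec_of_fun_of)
      obtain \<sigma>\<^sub>0 where \<sigma>\<^sub>0: "\<sigma>\<^sub>0 \<in> perms n" "f \<sigma>\<^sub>0 \<noteq> 0" using nz vf vec_of_eq_zero_iff by metis
      have "weighted_avg {1..n} (fixing k) f \<sigma> = expect {1..n} (fixing k) *\<^sub>R f \<sigma>" if "\<sigma> \<in> perms n" for \<sigma>
        using v(2) that unfolding vf adj_mult_vec_of vec_of_smult vec_of_eq_iff
        by (simp add: scaleR_conv_of_real)
      moreover have "(\<Sum>\<sigma>\<in>perms n. f \<sigma> * complex_of_real (\<chi> \<sigma>)) = 0" if "\<chi> \<in> X" for \<chi>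
        using v(3)[of "char_vec \<chi>"] that by (simp add: vf char_vec_inner)
      ultimately have "expect {1..n} (fixing k) \<le> c"
        using \<sigma>\<^sub>0 by (intro eigenfunction_le[of f]) (auto simp: f_def fun_of_def)
      then show False using c_less by simp
    qed
  qed
  ultimately show ?thesis by simp
qed

lemma eigenvalue_le_degree:
  assumes "eigenvalue (adj n k) \<kappa>"
  shows "Re \<kappa> \<le> valency"
proof (cases "\<kappa> = complex_of_real valency")
  case False
  have "fact n * c \<le> valency" using c_less by simp
  then show ?thesis using eigenvalue_le[OF assms False] by linarith
qed simp

lemmas lambda_after_degree =
  lambda_after_top[OF adj_carrier hermitian_adj order_degree card_X eigenvalue_le_degree]

lemma generated_subgroup: "subgroup (generate (sym_group n) (point_fixing_set n k)) (sym_group n)"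
  by (intro group.generate_is_subgroup sym_group_is_group)
    (auto simp: carrier_sym_group point_fixing_set_iff)

lemma char_generated:
  assumes "h \<in> generate (sym_group n) (point_fixing_set n k)" "\<chi> \<in> X"
  shows "\<sigma> \<in> perms n \<Longrightarrow> \<chi> (\<sigma> \<circ> h) = \<chi> \<sigma>"
  using assms(1)
proof (induction arbitrary: \<sigma> rule: generate.induct)
  case one
  then show ?case by (simp add: sym_group_one)
next
  case (incl h)
  then show ?case using char_trivial[OF assms(2)] by blast
next
  case (inv h)
  then have "h \<in> carrier (sym_group n)" by (simp add: carrier_sym_group point_fixing_set_iff)
  then have "inv\<^bsub>sym_group n\<^esub> h = inv' h" by simp
  moreover have "\<chi> (\<sigma> \<circ> inv' h) = \<chi> \<sigma>"
    using inv by (intro char_trivial[OF assms(2)] inverse_point_fixing)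
  ultimately show ?case by (simp only:)
next
  case (eng h1 h2)
  have "h1 \<in> perms n"
    using eng.hyps(1) subgroup.subset[OF generated_subgroup] by (auto simp: carrier_sym_group)
  then have "\<sigma> \<circ> h1 \<in> perms n" using eng.prems by (auto simp: perms_def permutes_compose)
  then have "\<chi> ((\<sigma> \<circ> h1) \<circ> h2) = \<chi> \<sigma>" using eng.IH eng.prems by (simp only:)
  then show ?case by (simp only: sym_group_mult comp_assoc)
qed

text \<open>
  The indicator function of the generated subgroup \<open>H\<close> is invariant under the connection set, and so is its component
  orthogonal to \<open>X\<close>, which is therefore an eigenfunction for the degree and vanishes by the gap. All characters in \<open>X\<close> are
  \<open>1\<close> on \<open>H\<close>, so each of them has coefficient \<open>|H| / n!\<close> in the indicator function; evaluating at the identity gives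
  \<open>1 = |X| |H| / n!\<close>.
\<close>

lemma card_generated:
  "card X * card (generate (sym_group n) (point_fixing_set n k)) = fact n"
proof -
  let ?S = "point_fixing_set n k"
  define H where "H = generate (sym_group n) ?S"
  have sub: "subgroup H (sym_group n)" unfolding H_def by (rule generated_subgroup)
  have H: "H \<subseteq> perms n" using subgroup.subset[OF sub] by (simp add: carrier_sym_group)
  have id: "id \<in> H" using subgroup.one_closed[OF sub] by (simp add: sym_group_one)
  have H_mult: "\<sigma> \<circ> s \<in> H \<longleftrightarrow> \<sigma> \<in> H" if "\<sigma> \<in> perms n" "s \<in> ?S" for \<sigma> s
  proof
    have s: "s \<in> H" "inv' s \<in> H"
      using that inverse_point_fixing by (auto simp: H_def generate.incl)
    show "\<sigma> \<in> H \<Longrightarrow> \<sigma> \<circ> s \<in> H" using subgroup.m_closed[OF sub _ s(1)] by (simp add: sym_group_mult)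
    assume "\<sigma> \<circ> s \<in> H"
    then have "(\<sigma> \<circ> s) \<circ> inv' s \<in> H" using subgroup.m_closed[OF sub _ s(2)] by (simp add: sym_group_mult)
    moreover have "s permutes {1..n}" using that by (simp add: point_fixing_set_iff perms_def)
    then have "(\<sigma> \<circ> s) \<circ> inv' s = \<sigma>" by (simp only: comp_assoc permutes_inv_o comp_id)
    ultimately show "\<sigma> \<in> H" by simp
  qed
  define a :: real where "a = card H / fact n"
  define g where "g \<sigma> = of_bool (\<sigma> \<in> H) - (\<Sum>\<chi>\<in>X. a * \<chi> \<sigma>)" for \<sigma>
  define f where "f \<sigma> = (if \<sigma> \<in> perms n then complex_of_real (g \<sigma>) else 0)" for \<sigma>
  have "(\<Sum>\<sigma>\<in>perms n. g \<sigma> * \<psi> \<sigma>) = 0" if \<psi>: "\<psi> \<in> X" for \<psi>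
  proof -
    have "(\<Sum>\<sigma>\<in>perms n. of_bool (\<sigma> \<in> H) * \<psi> \<sigma>) = (\<Sum>\<sigma>\<in>H. \<psi> \<sigma>)"
      using H by (intro sum.mono_neutral_cong_right) auto
    also have "\<dots> = (\<Sum>\<sigma>\<in>H. 1)"
    proof (rule sum.cong[OF refl])
      fix \<sigma> assume "\<sigma> \<in> H"
      then show "\<psi> \<sigma> = 1"
        using char_generated[OF _ \<psi>, of \<sigma> id] char_id[OF \<psi>] by (simp add: H_def perms_def permutes_id)
    qed
    finally have 1: "(\<Sum>\<sigma>\<in>perms n. of_bool (\<sigma> \<in> H) * \<psi> \<sigma>) = card H" by simp
    have "(\<Sum>\<sigma>\<in>perms n. (\<Sum>\<chi>\<in>X. a * \<chi> \<sigma>) * \<psi> \<sigma>) = (\<Sum>\<chi>\<in>X. a * (\<Sum>\<sigma>\<in>perms n. \<chi> \<sigma> * \<psi> \<sigma>))"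
      by (simp add: sum_distrib_left sum_distrib_right mult.assoc) (rule sum.swap)
    also have "\<dots> = (\<Sum>\<chi>\<in>X. if \<chi> = \<psi> then a * fact n else 0)"
      using char_orthogonal[OF _ \<psi>] char_square[OF \<psi>] by (intro sum.cong refl) (auto simp: card_perms)
    also have "\<dots> = card H" using \<psi> finite_X by (simp add: a_def)
    finally show ?thesis using 1 by (simp add: g_def left_diff_distrib sum_subtractf)
  qed
  then have orth: "(\<Sum>\<sigma>\<in>perms n. f \<sigma> * complex_of_real (\<psi> \<sigma>)) = 0" if "\<psi> \<in> X" for \<psi>
    using that by (simp add: f_def flip: of_real_mult of_real_sum)
  have eigen: "weighted_avg {1..n} (fixing k) f \<sigma> = expect {1..n} (fixing k) *\<^sub>R f \<sigma>" if \<sigma>: "\<sigma> \<in> perms n" for \<sigma>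
  proof (rule weighted_avg_invariant_on_support)
    fix s assume "s permutes {1..n}" "fixing k (num_fixed {1..n} s) \<noteq> (0 :: real)"
    then have s: "s \<in> ?S" "\<sigma> \<circ> s \<in> perms n"
      using \<sigma> by (auto simp: point_fixing_set_iff perms_def permutes_compose)
    have "g (\<sigma> \<circ> s) = g \<sigma>" using H_mult[OF \<sigma> s(1)] char_trivial[OF _ \<sigma> s(1)]
      by (auto simp: g_def intro!: sum.cong)
    then show "f (\<sigma> \<circ> s) = f \<sigma>" using \<sigma> s by (simp add: f_def)
  qed
  have id_perm: "id \<in> perms n" by (simp add: perms_def permutes_id)
  have "f id = 0"
  proof (rule ccontr)
    assume "f id \<noteq> 0"
    then have "expect {1..n} (fixing k) \<le> c"
      using orth eigen id_perm by (intro eigenfunction_le[of f]) (auto simp: f_def)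
    then show False using c_less by simp
  qed
  then have "g id = 0" using id_perm by (simp add: f_def)
  moreover have "(\<Sum>\<chi>\<in>X. a * \<chi> id) = (\<Sum>\<chi>\<in>X. a)" using char_id by (intro sum.cong) auto
  ultimately have "1 = card X * a" using id by (simp add: g_def)
  then have "real (card X * card H) = fact n" by (simp add: a_def field_simps)
  then show ?thesis unfolding H_def by (metis of_nat_eq_iff of_nat_fact)
qed

lemma index_generated:
  "card (rcosets\<^bsub>sym_group n\<^esub> (generate (sym_group n) (point_fixing_set n k))) = card X"
proof -
  let ?H = "generate (sym_group n) (point_fixing_set n k)"
  have "card (rcosets\<^bsub>sym_group n\<^esub> ?H) * card ?H = fact n"
    using group.lagrange[OF sym_group_is_group generated_subgroup]
    by (simp add: Coset.order_def carrier_sym_group card_perms)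
  then have "card (rcosets\<^bsub>sym_group n\<^esub> ?H) * card ?H = card X * card ?H" using card_generated by simp
  moreover have "card ?H \<noteq> 0" using card_generated by (metis fact_nonzero mult_zero_right)
  ultimately show ?thesis by simp
qed

lemma aldous_property_iff:
  "aldous_property n (point_fixing_set n k) \<longleftrightarrow>
     lambda (card X + 1) (adj n k) = lambda 1 (std_rep_sum n (point_fixing_set n k))"
  by (simp add: aldous_property_def index_generated graph_lambda_def Let_def)

end

section \<open>The eigenvalue of the standard representation\<close>

text \<open>
  An eigenfunction is the normalised indicator function of the stabiliser of the point \<open>1\<close> minus its mean.
\<close>

lemma std_eigenvalue_is_eigenvalue:
  assumes n: "n \<ge> 2"
  shows "eigenvalue (adj n k) (complex_of_real (fact n * std_eigenvalue {1..n} (fixing k)))"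
proof -
  define g :: "(nat \<Rightarrow> nat) \<Rightarrow> complex" where "g \<sigma> = of_bool (\<sigma> = id)" for \<sigma>
  define f where "f \<sigma> = avg ({1..n} - {1}) g \<sigma> - avg {1..n} g \<sigma>" for \<sigma>
  have avg_g: "avg J g id = 1 / fact (card J)" if "finite J" for J
  proof -
    have "(\<Sum>s | s permutes J. g s) = (\<Sum>s\<in>{id}. g s)"
      using that by (intro sum.mono_neutral_right) (auto simp: g_def finite_permutations permutes_id)
    then show ?thesis by (simp add: weighted_avg_def g_def scaleR_conv_of_real divide_inverse)
  qed
  have n1: "(fact (n - 1) :: complex) \<noteq> fact n"
    using n by (simp add: fact_reduce[of n])
  have "card ({1..n} - {1}) = n - 1" using n by (subst card_Diff_singleton) auto
  then have "f id = 1 / fact (n - 1) - 1 / fact n"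
    by (simp only: f_def avg_g[OF finite_Diff[OF finite_atLeastAtMost]] avg_g[OF finite_atLeastAtMost]) simp
  then have "f id \<noteq> 0" using n1 by simp
  moreover have "weighted_avg {1..n} (fixing k) f \<sigma> = std_eigenvalue {1..n} (fixing k) *\<^sub>R f \<sigma>" for \<sigma>
  proof (rule weighted_avg_point_invariant)
    show "f (\<rho> \<circ> t) = f \<rho>" if t: "t permutes {1..n} - {1}" for \<rho> t
    proof -
      have "t permutes {1..n}" using t permutes_subset by blast
      then show ?thesis using t by (simp only: f_def avg_invariant)
    qed
    show "avg {1..n} f \<sigma> = 0"
      unfolding f_def[abs_def] weighted_avg_diff by (simp only: avg_absorb finite_atLeastAtMost Diff_subset order_refl) simp
  qed (use n in auto)
  ultimately show ?thesis
    by (intro eigenvalue_adjI[of id n f]) (auto simp: perms_def permutes_id scaleR_conv_of_real)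
qed

text \<open>
  The entries are differences of fiber weights, which take only two values.
\<close>

lemma std_rep_sum_scalar:
  assumes "n \<ge> 2"
  shows "std_rep_sum n (point_fixing_set n k)
    = complex_of_real (fact n * std_eigenvalue {1..n} (fixing k)) \<cdot>\<^sub>m 1\<^sub>m (n - 1)"
proof (rule eq_matI)
  let ?\<tau> = "fact n * std_eigenvalue {1..n} (fixing k)"
  let ?F = "fiber_weight {1..n} (fixing k)"
  fix i j assume "i < dim_row (complex_of_real ?\<tau> \<cdot>\<^sub>m 1\<^sub>m (n - 1))" "j < dim_col (complex_of_real ?\<tau> \<cdot>\<^sub>m 1\<^sub>m (n - 1))"
  then have ij: "i < n - 1" "j < n - 1" by auto
  then have mem: "1 \<in> {1..n}" "i + 2 \<in> {1..n}" "j + 2 \<in> {1..n}" by auto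
  have F: "(\<Sum>\<sigma>\<in>point_fixing_set n k. of_bool (\<sigma> a = b)) = complex_of_real (?F a b)" for a b
  proof -
    have "(\<Sum>\<sigma>\<in>point_fixing_set n k. of_bool (\<sigma> a = b) :: complex)
        = (\<Sum>\<sigma>\<in>perms n. complex_of_real (if \<sigma> a = b then fixing k (num_fixed {1..n} \<sigma>) else 0))"
      by (intro sum.mono_neutral_cong_left) (auto simp: point_fixing_set_iff)
    then show ?thesis by (simp only: fiber_weight_def perms_def of_real_sum)
  qed
  have "std_rep_sum n (point_fixing_set n k) $$ (i, j) = complex_of_real (?F (j + 2) (i + 2) - ?F 1 (i + 2))"
    using ij by (simp add: std_rep_sum_def std_rep_def sum_subtractf F del: of_bool_eq_iff)
  also have "?F 1 (i + 2) = ?F 1 1 - ?\<tau>"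
    using fiber_weight_diff[of "{1..n}" 1 "i + 2" "fixing k"] mem by simp
  also have "?F (j + 2) (i + 2) - (?F 1 1 - ?\<tau>) = (if i = j then ?\<tau> else 0)"
  proof (cases "i = j")
    case True
    then show ?thesis using fiber_weight_diag[OF mem(3,1), of "fixing k"] by simp
  next
    case False
    then have "?F (j + 2) (j + 2) - ?F (j + 2) (i + 2) = ?\<tau>"
      using fiber_weight_diff[OF finite_atLeastAtMost mem(3,2), of "fixing k"] by simp
    then show ?thesis using fiber_weight_diag[OF mem(3,1), of "fixing k"] False by simp
  qed
  finally show "std_rep_sum n (point_fixing_set n k) $$ (i, j) = (complex_of_real ?\<tau> \<cdot>\<^sub>m 1\<^sub>m (n - 1)) $$ (i, j)"
    using ij by simp
qed (auto simp: std_rep_sum_def)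

lemma lambda_one_scalar:
  assumes "N > 0"
  shows "lambda 1 (complex_of_real c \<cdot>\<^sub>m 1\<^sub>m N) = c"
proof -
  let ?M = "complex_of_real c \<cdot>\<^sub>m 1\<^sub>m N"
  have "char_poly ?M = (\<Prod>a\<leftarrow>diag_mat ?M. [:- a, 1:])"
    by (rule char_poly_upper_triangular[of _ N]) (auto simp: upper_triangular_def)
  also have "diag_mat ?M = replicate N (complex_of_real c)"
    by (auto simp: diag_mat_def intro!: nth_equalityI)
  finally have "proots (char_poly ?M) = replicate_mset N (complex_of_real c)"
    by (simp add: prod_list_replicate proots_power multiset_eq_iff)
  then have "set (eigenvalue_list ?M) = {c}" "eigenvalue_list ?M \<noteq> []"
    using assms by (auto simp: eigenvalue_list_def dest: arg_cong[of _ _ set])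
  then show ?thesis unfolding lambda_def by (metis diff_self_eq_0 length_greater_0_conv nth_mem singletonD)
qed

lemma lambda_std_rep_sum:
  assumes "n \<ge> 2"
  shows "lambda 1 (std_rep_sum n (point_fixing_set n k)) = fact n * std_eigenvalue {1..n} (fixing k)"
  using assms by (simp only: std_rep_sum_scalar lambda_one_scalar)

section \<open>The point-fixing graphs\<close>

text \<open>
  Products of two numbers of the same sign are nonnegative, so the mixed terms only increase the square of the sum.
\<close>

lemma sum_squares_le_square_sum_nonpos:
  fixes M :: "real multiset"
  assumes "\<And>x. x \<in># M \<Longrightarrow> x \<le> 0"
  shows "(\<Sum>x\<in>#M. x\<^sup>2) \<le> (\<Sum>x\<in>#M. x)\<^sup>2 \<and> (\<Sum>x\<in>#M. x) \<le> 0"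
  using assms
proof (induction M)
  case (add x M)
  have key: "x\<^sup>2 + q \<le> (x + s)\<^sup>2" if "x \<le> 0" "s \<le> 0" "q \<le> s\<^sup>2" for q s :: real
    using mult_nonpos_nonpos[OF that(1,2)] that(3) by (simp add: power2_sum)
  from add have "x \<le> 0" "(\<Sum>x\<in>#M. x) \<le> 0" "(\<Sum>x\<in>#M. x\<^sup>2) \<le> (\<Sum>x\<in>#M. x)\<^sup>2" by auto
  from key[OF this] this(1,2) show ?case by simp
qed simp

lemma avg_eq_zero:
  assumes "\<And>\<sigma>. \<sigma> \<notin> perms n \<Longrightarrow> f \<sigma> = 0" "(\<Sum>\<sigma>\<in>perms n. f \<sigma>) = 0"
  shows "avg {1..n} f \<sigma> = 0"
proof (cases "\<sigma> \<in> perms n")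
  case True
  then have "\<sigma> permutes {1..n}" by (simp add: perms_def)
  from sum_permutes_compose_left[OF this, of f] show ?thesis
    using assms(2) by (simp add: weighted_avg_def perms_def)
next
  case False
  then have "f (\<sigma> \<circ> s) = 0" if "s permutes {1..n}" for s
    using assms(1) permutes_compose_iff[OF that] by (simp add: perms_def)
  then show ?thesis by (simp add: weighted_avg_def)
qed

lemma point_fixing_gap_trivial:
  assumes "n \<ge> 2" "spectral_bound {1..n} {1..n} (fixing k) c" "c < expect {1..n} (fixing k)"
  shows "point_fixing_gap n k {\<lambda>_. 1} c"
proof
  fix f :: "(nat \<Rightarrow> nat) \<Rightarrow> complex"
  assume zero: "\<And>\<sigma>. \<sigma> \<notin> perms n \<Longrightarrow> f \<sigma> = 0"
    and orth: "\<And>\<chi>. \<chi> \<in> {\<lambda>_. 1} \<Longrightarrow> (\<Sum>\<sigma>\<in>perms n. f \<sigma> * complex_of_real (\<chi> \<sigma>)) = 0"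
  have "(\<Sum>\<sigma>\<in>perms n. f \<sigma>) = 0" using orth[of "\<lambda>_. 1"] by simp
  then have "\<forall>\<sigma>. avg {1..n} f \<sigma> = 0" using avg_eq_zero[of n f] zero by blast
  then show "inner_on {1..n} (weighted_avg {1..n} (fixing k) f) f \<le> c * inner_on {1..n} f f"
    using assms(2) unfolding spectral_bound_def by blast
next
  have "(2::nat) \<le> fact n" using assms(1) fact_mono[of 2 n, where 'a=nat] by simp
  then show "card {\<lambda>_ :: nat \<Rightarrow> nat. 1 :: real} < fact n" by simp
qed (use assms in auto)

lemma sum_sign: "n \<ge> 2 \<Longrightarrow> (\<Sum>\<sigma>\<in>perms n. real_of_int (sign \<sigma>)) = 0"
proof -
  assume "n \<ge> 2"
  then have t: "transpose 1 2 permutes {1..n}" by (intro permutes_swap_id) auto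
  have "sign (transpose 1 2 \<circ> s) = - sign s" if "s permutes {1..n}" for s
  proof -
    have "permutation s" "permutation (transpose 1 (2::nat))"
      using that t permutation_permutes by blast+
    then show ?thesis by (simp add: sign_compose sign_swap_id)
  qed
  then have "(\<Sum>\<sigma>\<in>perms n. real_of_int (sign \<sigma>)) = (\<Sum>\<sigma>\<in>perms n. - real_of_int (sign \<sigma>))"
    using sum_permutes_compose_left[OF t, of "\<lambda>s. real_of_int (sign s)"] by (simp add: perms_def)
  then show ?thesis by (simp add: sum_negf)
qed

lemma point_fixing_gap_sign:
  assumes n: "n = k + 3" and "even_spectral_bound {1..n} {1..n} (fixing k) c" "c < expect {1..n} (fixing k)"
  shows "point_fixing_gap n k {\<lambda>_. 1, \<lambda>\<sigma>. real_of_int (sign \<sigma>)} c"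
proof
  let ?X = "{\<lambda>_. 1, \<lambda>\<sigma>. real_of_int (sign \<sigma>)} :: ((nat \<Rightarrow> nat) \<Rightarrow> real) set"
  show "finite ?X" by simp
  show "\<chi> id = 1" if "\<chi> \<in> ?X" for \<chi> using that by auto
  show "\<chi> \<sigma> * \<chi> \<sigma> = 1" if "\<chi> \<in> ?X" for \<chi> \<sigma> using that by (auto simp: sign_def)
  show "\<chi> (\<sigma> \<circ> s) = \<chi> \<sigma>" if "\<chi> \<in> ?X" "\<sigma> \<in> perms n" "s \<in> point_fixing_set n k" for \<chi> \<sigma> s
  proof -
    have s: "s permutes {1..n}" "num_fixed {1..n} s = k"
      using that by (auto simp: point_fixing_set_iff perms_def)
    then have "sign s = 1" using n by (intro sign_moving_three[of "{1..n}" s k]) auto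
    moreover have "permutation s" "permutation \<sigma>"
      using s that permutation_permutes by (auto simp: perms_def)
    ultimately show ?thesis using that by (auto simp: sign_compose)
  qed
  show "(\<Sum>\<sigma>\<in>perms n. \<chi> \<sigma> * \<psi> \<sigma>) = 0" if "\<chi> \<in> ?X" "\<psi> \<in> ?X" "\<chi> \<noteq> \<psi>" for \<chi> \<psi>
    using that sum_sign[of n] n by auto
  show "c < expect {1..n} (fixing k)" by fact
  have "(6::nat) \<le> fact n" using n fact_mono[of 3 n, where 'a=nat] by (simp add: fact_numeral)
  moreover have "card ?X \<le> 2" by (rule card_insert_le_m1) auto
  ultimately show "card ?X < fact n" by linarith
  fix f :: "(nat \<Rightarrow> nat) \<Rightarrow> complex"
  assume zero: "\<And>\<sigma>. \<sigma> \<notin> perms n \<Longrightarrow> f \<sigma> = 0"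
    and orth: "\<And>\<chi>. \<chi> \<in> ?X \<Longrightarrow> (\<Sum>\<sigma>\<in>perms n. f \<sigma> * complex_of_real (\<chi> \<sigma>)) = 0"
  have "(\<Sum>\<sigma>\<in>perms n. f \<sigma>) = 0" using orth[of "\<lambda>_. 1"] by simp
  then have "\<forall>\<sigma>. avg {1..n} f \<sigma> = 0" using avg_eq_zero[of n f] zero by blast
  moreover have "\<forall>\<sigma>. avg {1..n} (twist {1..n} f) \<sigma> = 0"
  proof
    fix \<sigma>
    have "(\<Sum>\<sigma>\<in>perms n. twist {1..n} f \<sigma>) = (\<Sum>\<sigma>\<in>perms n. f \<sigma> * complex_of_real (real_of_int (sign \<sigma>)))"
      by (intro sum.cong refl) (simp add: twist_def perms_def scaleR_conv_of_real mult.commute)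
    also have "\<dots> = 0" using orth[of "\<lambda>\<sigma>. real_of_int (sign \<sigma>)"] by simp
    finally show "avg {1..n} (twist {1..n} f) \<sigma> = 0"
      by (intro avg_eq_zero) (auto simp: twist_def perms_def)
  qed
  ultimately show "inner_on {1..n} (weighted_avg {1..n} (fixing k) f) f \<le> c * inner_on {1..n} f f"
    using assms(2) unfolding even_spectral_bound_def by blast
qed

lemma (in point_fixing_gap) aldous_property_if_std_bound:
  assumes n: "n \<ge> 2" and c: "c = std_eigenvalue {1..n} (fixing k)"
  shows "aldous_property n (point_fixing_set n k)"
proof -
  let ?L = "lambda (card X + 1) (adj n k)"
  have "fact n * c < valency" using c_less by simp
  then have "complex_of_real (fact n * c) \<noteq> complex_of_real valency" by (simp only: of_real_eq_iff)
  then have "Re (complex_of_real (fact n * c)) \<le> ?L"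
    using std_eigenvalue_is_eigenvalue[OF n, of k] unfolding c by (intro lambda_after_degree(3))
  then have "fact n * c \<le> ?L" by (simp only: Re_complex_of_real)
  moreover have "complex_of_real ?L \<noteq> complex_of_real valency"
    using lambda_after_degree(2) by (metis less_irrefl of_real_eq_iff)
  then have "Re (complex_of_real ?L) \<le> fact n * c"
    using eigenvalue_le[OF lambda_after_degree(1)] by blast
  ultimately show ?thesis
    unfolding aldous_property_iff lambda_std_rep_sum[OF n] c by simp
qed

text \<open>
  Let \<open>D\<close> be the degree, a simple eigenvalue, and suppose that all other eigenvalues are at most \<open>0\<close>. The trace is \<open>0\<close>, so they
  sum to \<open>- D\<close> and their squares sum to at most \<open>D\<^sup>2\<close>. The trace of the square is \<open>n! D\<close>, hence \<open>n! D \<le> 2 D\<^sup>2\<close>, which contradicts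
  \<open>D < n! / 2\<close>.
\<close>

lemma lambda_two_pos:
  assumes gap: "point_fixing_gap n k {\<lambda>_. 1} c" and kn: "k < n" and p: "expect {1..n} (fixing k) < 1 / 2"
    "expect {1..n} (fixing k) > 0"
  shows "lambda 2 (adj n k) > 0"
proof (rule ccontr)
  interpret point_fixing_gap n k "{\<lambda>_. 1}" c by (rule gap)
  assume "\<not> lambda 2 (adj n k) > 0"
  then have le0: "lambda (1 + 1) (adj n k) \<le> 0" by (simp add: numeral_2_eq_2)
  let ?P = "proots (char_poly (adj n k))"
  have cp: "char_poly (adj n k) \<noteq> 0" using adj_carrier char_poly_nonzero by blast
  have ev: "x \<in># ?P \<longleftrightarrow> eigenvalue (adj n k) x" for x
    using eigenvalue_root_char_poly[OF adj_carrier] cp by simp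
  have real: "x = complex_of_real (Re x)" if "x \<in># ?P" for x
    using that hermitian_eigenvalue_real[OF adj_carrier hermitian_adj] ev by blast
  have "count ?P (complex_of_real valency) = 1" using order_degree cp by simp
  moreover from this have "complex_of_real valency \<in># ?P" by (simp only: count_greater_zero_iff[symmetric])
  then obtain Q where P: "?P = add_mset (complex_of_real valency) Q" by (rule mset_add)
  ultimately have "count Q (complex_of_real valency) = 0" by (simp only: count_add_mset if_True) simp
  then have Q: "?P = add_mset (complex_of_real valency) Q" "complex_of_real valency \<notin># Q"
    using P by (simp_all only: not_in_iff)
  define R where "R = image_mset Re Q"
  have R: "image_mset complex_of_real R = Q"
    unfolding R_def using real Q by (simp add: multiset.map_comp comp_def cong: image_mset_cong)
  have "x \<le> 0" if x: "x \<in># R" for x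
  proof -
    obtain z where z: "z \<in># Q" "x = Re z" using x by (auto simp: R_def)
    then have "eigenvalue (adj n k) z" "z \<noteq> complex_of_real valency" using Q ev[of z] by auto
    then have "Re z \<le> lambda (1 + 1) (adj n k)" using lambda_after_degree(3) by simp
    then show ?thesis using z le0 by simp
  qed
  then have squares: "(\<Sum>x\<in>#R. x\<^sup>2) \<le> (\<Sum>x\<in>#R. x)\<^sup>2"
    using sum_squares_le_square_sum_nonpos by blast
  have Rsum: "sum_mset Q = complex_of_real (sum_mset R)" "(\<Sum>x\<in>#Q. x\<^sup>2) = complex_of_real (\<Sum>x\<in>#R. x\<^sup>2)"
    unfolding R[symmetric] by (induction R) auto
  have "mat_trace (adj n k) = 0"
  proof -
    have "inv' \<sigma> \<circ> \<sigma> \<notin> point_fixing_set n k" if "\<sigma> \<in> perms n" for \<sigma>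
    proof -
      have "{i \<in> {1..n}. id i = i} = {1..n}" by auto
      then have "num_fixed {1..n} id = n" by (simp only: num_fixed_def card_atLeastAtMost)
      moreover have "inv' \<sigma> \<circ> \<sigma> = id" using that by (simp add: perms_def permutes_inv_o)
      ultimately show ?thesis using kn by (simp only: point_fixing_set_iff) simp
    qed
    then show ?thesis by (simp add: mat_trace_def adj_index enum_in)
  qed
  then have "complex_of_real (valency + (\<Sum>x\<in>#R. x)) = complex_of_real 0"
    using trace_eq_sum_proots(1)[OF adj_carrier, of n k] unfolding Q by (simp add: Rsum)
  then have s1: "(\<Sum>x\<in>#R. x) = - valency" by (simp only: of_real_eq_iff)
  have "mat_trace (adj n k * adj n k) = complex_of_real (fact n * valency)"
  proof -
    have const: "adj n k *\<^sub>v char_vec (\<lambda>_. 1) = complex_of_real valency \<cdot>\<^sub>v char_vec (\<lambda>_. 1)"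
      by (rule char_eigenvector) simp
    have "(\<Sum>j<fact n. adj n k $$ (i, j) * adj n k $$ (j, i)) = complex_of_real valency" if i: "i < fact n" for i
    proof -
      have "(\<Sum>j<fact n. adj n k $$ (i, j) * adj n k $$ (j, i)) = (\<Sum>j<fact n. adj n k $$ (i, j) * char_vec (\<lambda>_. 1) $ j)"
      proof (intro sum.cong refl)
        fix j assume "j \<in> {..<fact n :: nat}"
        then have j: "j < fact n" by simp
        have "adj n k $$ (i, j) = cnj (adj n k $$ (j, i))"
          using hermitian_adj[of n k] i j unfolding hermitian_def adj_dim by blast
        then show "adj n k $$ (i, j) * adj n k $$ (j, i) = adj n k $$ (i, j) * char_vec (\<lambda>_. 1) $ j"
          using i j by (simp add: adj_index vec_of_def)
      qed
      also have "\<dots> = (adj n k *\<^sub>v char_vec (\<lambda>_. 1)) $ i"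
        by (rule mult_mat_vec_index[OF adj_carrier vec_of_carrier i, symmetric])
      also have "\<dots> = complex_of_real valency"
        unfolding const using i by (simp add: vec_of_def)
      finally show ?thesis .
    qed
    then show ?thesis by (simp add: mat_trace_mult[OF adj_carrier adj_carrier])
  qed
  then have "complex_of_real (valency\<^sup>2 + (\<Sum>x\<in>#R. x\<^sup>2)) = complex_of_real (fact n * valency)"
    using trace_eq_sum_proots(2)[OF adj_carrier, of n k] unfolding Q by (simp add: Rsum)
  then have "fact n * valency = valency\<^sup>2 + (\<Sum>x\<in>#R. x\<^sup>2)" by (simp only: of_real_eq_iff)
  also have "\<dots> \<le> 2 * valency\<^sup>2" using squares s1 by simp
  finally have "fact n * valency \<le> (2 * valency) * valency" by (simp add: power2_eq_square mult.assoc)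
  moreover have "valency > 0" using p by simp
  ultimately have "fact n \<le> 2 * valency" by (rule mult_right_le_imp_le)
  then have "fact n * 1 \<le> fact n * (2 * expect {1..n} (fixing k))" by (simp add: mult.left_commute)
  then have "1 \<le> 2 * expect {1..n} (fixing k)" by (rule mult_left_le_imp_le) simp
  then show False using p by simp
qed

text \<open>
  Put \<open>m = n - k\<close>. For \<open>m = 2\<close> the base case of the descent is the standard eigenvalue \<open>- 1\<close>, relative to the degree.
  For \<open>m \<ge> 4\<close> the proportion of derangements is at least \<open>11 / 30\<close>, and \<open>(11 / 30) (10 / 11) = 1 / 3\<close> turns the absolute bound for
  derangements into a relative one.
\<close>

lemma spectral_bound_fixing_large:
  assumes "n \<ge> k + 2" "n \<noteq> k + 3"
    and std: "(real k - 1) / (real n - 1) \<le> \<beta>" and "- 1 \<le> \<beta>"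
    and large: "n \<ge> k + 4 \<Longrightarrow> 10 / 11 / (real (n - k) - 3) \<le> \<beta>"
  shows "spectral_bound {1..n} {1..n} (fixing k) (expect {1..n} (fixing k) * \<beta>)"
proof (rule spectral_bound_fixing[where m = "n - k"])
  fix J :: "nat set" assume J: "J \<subseteq> {1..n}" "card J = n - k"
  then have fin: "finite J" using finite_subset by blast
  have pos: "expect J (fixing 0) \<ge> 1 / 3" using J assms(1) fin by (intro expect_fixing_0_ge_third) auto
  show "spectral_bound {1..n} J (fixing 0) (expect J (fixing 0) * \<beta>)"
  proof (cases "n = k + 2")
    case True
    show ?thesis
    proof (rule spectral_bound_step[OF _ J(1)])
      have "std_eigenvalue J (fixing 0) = expect J (fixing 0) * - 1"
        unfolding std_eigenvalue_fixing using J(2) True by simp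
      also have "\<dots> \<le> expect J (fixing 0) * \<beta>" using pos assms(4) by (intro mult_left_mono) auto
      finally show "std_eigenvalue J (fixing 0) \<le> expect J (fixing 0) * \<beta>" .
      show "spectral_bound {1..n} (J - {i}) (diff_quot (fixing 0)) (expect J (fixing 0) * \<beta>)" if "i \<in> J" for i
        using J True fin that by (intro spectral_bound_small) auto
    qed (use J True in auto)
  next
    case False
    then have m: "n \<ge> k + 4" using assms by simp
    have E: "expect J (fixing 0) \<ge> 11 / 30" using J m fin by (intro expect_fixing_0_bounds) auto
    have "0 \<le> 10 / 11 / (real (n - k) - 3)" using m by simp
    then have "0 \<le> \<beta>" using large[OF m] by linarith
    have "1 / (3 * (real (card J) - 3)) = 11 / 30 * (10 / 11 / (real (n - k) - 3))"
      using J m by (simp add: field_simps)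
    also have "\<dots> \<le> 11 / 30 * \<beta>" using large[OF m] by (rule mult_left_mono) simp
    also have "\<dots> \<le> expect J (fixing 0) * \<beta>" using E \<open>0 \<le> \<beta>\<close> by (rule mult_right_mono)
    finally show ?thesis
      using J m by (intro spectral_bound_mono[OF spectral_bound_derangements]) auto
  qed
qed (use assms in auto)

text \<open>
  With \<open>m = n - k\<close> and \<open>j = k - 1\<close> the claim is \<open>43 j \<le> m (11 j - 10)\<close>. For \<open>j \<ge> 1\<close> it holds if \<open>m \<ge> 43\<close>, and for \<open>m \<ge> 4\<close> it holds if \<open>j \<ge> 40\<close>;
  since \<open>m + j \<ge> 99\<close>, one of the two is the case.
\<close>

lemma std_bound_large:
  assumes "n \<ge> 100" "k \<ge> 2" "n \<ge> k + 4"
  shows "10 / 11 / (real (n - k) - 3) \<le> (real k - 1) / (real n - 1)"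
proof -
  define m j where "m = real (n - k)" and "j = real k - 1"
  have n: "real n - 1 = m + j" and mj: "m \<ge> 4" "j \<ge> 1" "m + j \<ge> 99"
    using assms by (auto simp: m_def j_def of_nat_diff)
  have "43 * j \<le> m * (11 * j - 10)"
  proof (cases "m \<ge> 43")
    case True
    have "43 * j \<le> 43 * (11 * j - 10)" using mj by simp
    also have "\<dots> \<le> m * (11 * j - 10)" using True mj by (intro mult_right_mono) auto
    finally show ?thesis .
  next
    case False
    then have "43 * j \<le> 4 * (11 * j - 10)" using mj by simp
    also have "\<dots> \<le> m * (11 * j - 10)" using mj by (intro mult_right_mono) auto
    finally show ?thesis .
  qed
  then have "10 * (m + j) \<le> 11 * (j * (m - 3))" by (simp add: algebra_simps)
  then show ?thesis
    unfolding n m_def[symmetric] j_def[symmetric] using mj by (simp add: field_simps)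
qed

lemma aldous_property_large:
  assumes n: "n \<ge> 100" and k: "k \<ge> 2" "n \<ge> k + 2"
  shows "aldous_property n (point_fixing_set n k)"
proof -
  define \<beta> where "\<beta> = (real k - 1) / (real n - 1)"
  have \<beta>: "0 \<le> \<beta>" "\<beta> < 1" using n k by (auto simp: \<beta>_def)
  have pos: "expect {1..n} (fixing k) > 0"
    using k by (intro expect_fixing_pos[of _ "n - k"]) auto
  then have less: "expect {1..n} (fixing k) * \<beta> < expect {1..n} (fixing k)" using \<beta> by simp
  have std: "expect {1..n} (fixing k) * \<beta> = std_eigenvalue {1..n} (fixing k)"
    by (simp add: std_eigenvalue_fixing \<beta>_def)
  show ?thesis
  proof (cases "n = k + 3")
    case True
    have "even_spectral_bound {1..n} {1..n} (fixing k) (expect {1..n} (fixing k) * \<beta>)"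
      using True by (intro even_spectral_bound_fixing) (auto simp: \<beta>_def add.commute)
    then show ?thesis
      using point_fixing_gap.aldous_property_if_std_bound[OF point_fixing_gap_sign[OF True _ less]] std n by simp
  next
    case False
    have "spectral_bound {1..n} {1..n} (fixing k) (expect {1..n} (fixing k) * \<beta>)"
    proof (rule spectral_bound_fixing_large[OF k(2) False])
      show "(real k - 1) / (real n - 1) \<le> \<beta>" by (simp add: \<beta>_def)
      show "- 1 \<le> \<beta>" using \<beta> by simp
      show "10 / 11 / (real (n - k) - 3) \<le> \<beta>" if "n \<ge> k + 4"
        unfolding \<beta>_def by (rule std_bound_large[OF n k(1) that])
    qed
    then show ?thesis
      using point_fixing_gap.aldous_property_if_std_bound[OF point_fixing_gap_trivial[OF _ _ less]] std n by simp
  qed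
qed

lemma not_aldous_property_small:
  assumes n: "n \<ge> 6" and k: "k \<le> 1"
  shows "\<not> aldous_property n (point_fixing_set n k)"
proof -
  let ?p = "expect {1..n} (fixing k)"
  have pos: "?p > 0" using n k by (intro expect_fixing_pos[of _ "n - k"]) auto
  have std: "(real k - 1) / (real n - 1) \<le> 0" using n k by (simp add: divide_nonpos_pos)
  have "spectral_bound {1..n} {1..n} (fixing k) (?p * (10 / 11))"
  proof (rule spectral_bound_fixing_large)
    show "(real k - 1) / (real n - 1) \<le> 10 / 11" using std by linarith
    have "1 \<le> real (n - k) - 3" using n k by simp
    then show "10 / 11 / (real (n - k) - 3) \<le> 10 / 11" by (simp add: field_simps)
  qed (use n k in auto)
  then have gap: "point_fixing_gap n k {\<lambda>_. 1} (?p * (10 / 11))"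
    using n pos by (intro point_fixing_gap_trivial) auto
  have "?p \<le> 3 / 8"
  proof (cases k)
    case 0
    then show ?thesis using n expect_fixing_0_bounds(2)[of "{1..n}"] by simp
  next
    case (Suc l)
    then have "?p = expect ({1..n} - {1}) (fixing 0)"
      using k n expect_fixing_Suc[of "{1..n}" 1 0] by simp
    then show ?thesis using n expect_fixing_0_bounds(2)[of "{1..n} - {1}"] by simp
  qed
  then have "lambda 2 (adj n k) > 0"
    using n k pos by (intro lambda_two_pos[OF gap]) auto
  moreover have "fact n * std_eigenvalue {1..n} (fixing k) \<le> 0"
  proof -
    have "std_eigenvalue {1..n} (fixing k) = ?p * ((real k - 1) / (real n - 1))"
      by (simp add: std_eigenvalue_fixing)
    also have "\<dots> \<le> 0" using std pos by (intro mult_nonneg_nonpos) auto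
    finally show ?thesis by (intro mult_nonneg_nonpos) auto
  qed
  ultimately show ?thesis
    using n point_fixing_gap.aldous_property_iff[OF gap] lambda_std_rep_sum[of n k]
    by (simp add: numeral_2_eq_2)
qed

theorem corollary1p5:
  shows "\<exists>N::nat. N > 0 \<and> (\<forall>n \<ge> N. \<forall>k. k \<le> n - 2 \<longrightarrow>
    (aldous_property n (point_fixing_set n k) \<longleftrightarrow> 2 \<le> k \<and> k \<le> n - 2))"
proof (intro exI conjI allI impI)
  show "(100::nat) > 0" by simp
  fix n k :: nat assume "n \<ge> 100" "k \<le> n - 2"
  then show "aldous_property n (point_fixing_set n k) \<longleftrightarrow> 2 \<le> k \<and> k \<le> n - 2"
    using aldous_property_large[of n k] not_aldous_property_small[of n k] by (cases "k \<le> 1") auto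
qed

end
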